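(* Let $\Gamma$ be a virtually-(torsion free solvable) group and let $H\le\Gamma$ be a finite subgroup. If there is some finite subgroup $T\le\Gamma$ with $H<T$ and $|C_\Gamma(H):C_\Gamma(T)|<\infty$, then $|\mathcal{F}_H|$ is contractible.
   Context: Virtually-(torsion free solvable) means having a finite index subgroup which is torsion free and solvable. $<$ denotes strict inclusion, and $C_\Gamma(K)$ denotes the centralizer of $K$ in $\Gamma$. $\mathcal{F}$ is the set of all finite subgroups of $\Gamma$, $\mathcal{F}_H:=\{K\in\mathcal{F}\mid H<K\}$ ordered by inclusion, and $|\mathcal{F}_H|$ is its geometric realization. *)

theory Defs
  imports "HOL-Algebra.Algebra" "HOL-Analysis.Analysis"
begin

section \<open>Group theory\<close>

definition centralizer :: "('a, 'b) monoid_scheme \<Rightarrow> 'a set \<Rightarrow> 'a set" where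
  "centralizer G K = {g \<in> carrier G. \<forall>k\<in>K. g \<otimes>\<^bsub>G\<^esub> k = k \<otimes>\<^bsub>G\<^esub> g}"

definition torsion_free_group :: "('a, 'b) monoid_scheme \<Rightarrow> bool" where
  "torsion_free_group G \<longleftrightarrow>
    (\<forall>x\<in>carrier G. \<forall>n::nat. n > 0 \<longrightarrow> x [^]\<^bsub>G\<^esub> n = \<one>\<^bsub>G\<^esub> \<longrightarrow> x = \<one>\<^bsub>G\<^esub>)"

text \<open>Finiteness of the index \<open>|L : K|\<close> of subgroups \<open>K \<le> L\<close> of \<open>G\<close>. Finiteness of the set of
  cosets is used because a cardinality in \<open>nat\<close> would not tell an infinite index from \<open>0\<close>.\<close>

definition finite_index :: "('a, 'b) monoid_scheme \<Rightarrow> 'a set \<Rightarrow> 'a set \<Rightarrow> bool" where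
  "finite_index G L K \<longleftrightarrow> finite (rcosets\<^bsub>G\<lparr>carrier := L\<rparr>\<^esub> K)"

definition virtually_torsion_free_solvable :: "('a, 'b) monoid_scheme \<Rightarrow> bool" where
  "virtually_torsion_free_solvable G \<longleftrightarrow>
    (\<exists>S. subgroup S G \<and> finite_index G (carrier G) S \<and>
         torsion_free_group (G\<lparr>carrier := S\<rparr>) \<and> solvable (G\<lparr>carrier := S\<rparr>))"

definition finite_subgroups :: "('a, 'b) monoid_scheme \<Rightarrow> 'a set set" where
  "finite_subgroups G = {K. subgroup K G \<and> finite K}"

definition finite_subgroups_above :: "('a, 'b) monoid_scheme \<Rightarrow> 'a set \<Rightarrow> 'a set set" where
  "finite_subgroups_above G H = {K \<in> finite_subgroups G. H \<subset> K}"


section \<open>Geometric realization of a poset\<close>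

text \<open>The geometric realization of a set \<open>P\<close> ordered by \<open>r\<close> is that of its order complex, whose
  simplices are the nonempty finite chains of \<open>P\<close>. A point is given by its barycentric
  coordinates. Functions are defined on the whole type and vanish outside \<open>P\<close>.\<close>

definition order_simplices :: "'a set \<Rightarrow> ('a \<Rightarrow> 'a \<Rightarrow> bool) \<Rightarrow> 'a set set" where
  "order_simplices P r =
    {C. C \<subseteq> P \<and> finite C \<and> C \<noteq> {} \<and> (\<forall>x\<in>C. \<forall>y\<in>C. r x y \<or> r y x)}"

definition closed_simplex :: "'a set \<Rightarrow> ('a \<Rightarrow> real) set" where
  "closed_simplex C = {f. (\<forall>x. 0 \<le> f x) \<and> (\<forall>x. x \<notin> C \<longrightarrow> f x = 0) \<and> sum f C = 1}"

text \<open>A finite simplex carries its Euclidean topology, which is the one induced by pointwise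
  convergence of the coordinates. The realization carries the weak (coherent) topology: a set is
  open iff its intersection with every closed simplex is open in that simplex. For
  infinite \<open>P\<close> this is in general finer than the topology of pointwise convergence.\<close>

definition geometric_realization :: "'a set \<Rightarrow> ('a \<Rightarrow> 'a \<Rightarrow> bool) \<Rightarrow> ('a \<Rightarrow> real) topology" where
  "geometric_realization P r = topology (\<lambda>U.
     U \<subseteq> (\<Union>C\<in>order_simplices P r. closed_simplex C) \<and>
     (\<forall>C\<in>order_simplices P r.
        openin (subtopology (powertop_real UNIV) (closed_simplex C)) (U \<inter> closed_simplex C)))"

text \<open>The constructor \<open>topology\<close> only yields the intended open sets if the predicate it is applied to
  is closed under finite intersections and arbitrary unions.\<close>

lemma openin_geometric_realization:
  "openin (geometric_realization P r) U \<longleftrightarrow>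
     U \<subseteq> (\<Union>C\<in>order_simplices P r. closed_simplex C) \<and>
     (\<forall>C\<in>order_simplices P r.
        openin (subtopology (powertop_real UNIV) (closed_simplex C)) (U \<inter> closed_simplex C))"
proof -
  let ?X = "\<lambda>C. subtopology (powertop_real UNIV) (closed_simplex C)"
  let ?L = "\<lambda>U. U \<subseteq> (\<Union>C\<in>order_simplices P r. closed_simplex C) \<and>
     (\<forall>C\<in>order_simplices P r. openin (?X C) (U \<inter> closed_simplex C))"
  have inter: "?L (S \<inter> T)" if "?L S" "?L T" for S T
  proof (intro conjI ballI)
    show "S \<inter> T \<subseteq> (\<Union>C\<in>order_simplices P r. closed_simplex C)"
      using that by blast
    fix C assume "C \<in> order_simplices P r"
    with that have "openin (?X C) (S \<inter> closed_simplex C)" "openin (?X C) (T \<inter> closed_simplex C)"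
      by blast+
    then have "openin (?X C) ((S \<inter> closed_simplex C) \<inter> (T \<inter> closed_simplex C))"
      by (rule openin_Int)
    moreover have "(S \<inter> closed_simplex C) \<inter> (T \<inter> closed_simplex C) = S \<inter> T \<inter> closed_simplex C"
      by blast
    ultimately show "openin (?X C) (S \<inter> T \<inter> closed_simplex C)"
      by simp
  qed
  have union: "?L (\<Union>\<K>)" if "\<forall>K\<in>\<K>. ?L K" for \<K>
  proof (intro conjI ballI)
    show "\<Union>\<K> \<subseteq> (\<Union>C\<in>order_simplices P r. closed_simplex C)"
      using that by blast
    fix C assume "C \<in> order_simplices P r"
    then have "openin (?X C) (\<Union>((\<lambda>K. K \<inter> closed_simplex C) ` \<K>))"
      using that by (intro openin_Union) auto
    moreover have "\<Union>((\<lambda>K. K \<inter> closed_simplex C) ` \<K>) = \<Union>\<K> \<inter> closed_simplex C"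
      by blast
    ultimately show "openin (?X C) (\<Union>\<K> \<inter> closed_simplex C)"
      by simp
  qed
  have "istopology ?L"
    unfolding istopology_def using inter union by blast
  then show ?thesis
    unfolding geometric_realization_def by (simp add: topology_inverse')
qed

lemma topspace_geometric_realization:
  "topspace (geometric_realization P r) = (\<Union>C\<in>order_simplices P r. closed_simplex C)"
  (is "_ = ?R")
proof
  show "topspace (geometric_realization P r) \<subseteq> ?R"
    using openin_geometric_realization[of P r "topspace (geometric_realization P r)"] by simp
  have "openin (subtopology (powertop_real UNIV) (closed_simplex C)) (?R \<inter> closed_simplex C)"
    if "C \<in> order_simplices P r" for C
  proof -
    have "?R \<inter> closed_simplex C = topspace (subtopology (powertop_real UNIV) (closed_simplex C))"
      using that by auto
    then show ?thesis
      by (metis openin_topspace)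
  qed
  then have "openin (geometric_realization P r) ?R"
    by (simp add: openin_geometric_realization)
  then show "?R \<subseteq> topspace (geometric_realization P r)"
    by (rule openin_subset)
qed

end

theory Submission
  imports Defs
begin

text \<open>
  Everything rests on one fact: for every finite subgroup \<open>K\<close> containing \<open>H\<close> the join \<open>\<langle>K,T\<rangle>\<close> is again
  finite (\<open>group.finite_join\<close>). Then \<open>f K = \<langle>K,T\<rangle>\<close> is a monotone self-map of the poset with
  \<open>K \<le> f K \<ge> T\<close>, and such a poset has a contractible realization: the identity is homotopic to
  \<open>f\<close> and \<open>f\<close> is homotopic to the constant map \<open>T\<close> (\<open>contractible_conical_poset\<close>).

  For the finiteness let \<open>G = \<langle>K,T\<rangle>\<close> and let \<open>N\<close> be a normal torsion-free solvable subgroup of finite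
  index; it has to be shown that \<open>N\<close> is trivial. The index condition says that an element centralizing
  \<open>H\<close> has a power centralizing \<open>T\<close>. Suppose that \<open>A/B\<close> is a torsion-free abelian section of \<open>N\<close>, normal
  in \<open>G\<close>, whose \<open>H\<close>-fixed elements are \<open>T\<close>-fixed. In the integral group ring put
  \<open>\<epsilon> = |T| \<Sum>H - |H| \<Sum>T\<close> and \<open>\<omega> = |T| \<Sum>K - |K| \<Sum>T\<close>, where \<open>\<Sum>L\<close> is the sum of the elements of \<open>L\<close>.
  Then \<open>\<epsilon>\<close> annihilates \<open>A/B\<close>, because the \<open>H\<close>-norm of an element is \<open>H\<close>-fixed and hence \<open>T\<close>-fixed
  (\<open>eps_kill\<close>). On the other hand some positive multiple of \<open>(g - 1) \<Sum>K\<close> is a combination of left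
  translates of \<open>\<epsilon> \<omega>\<close>, for every \<open>g\<close> in \<open>G\<close>: this is clear for \<open>g\<close> in \<open>K\<close>, a computation for \<open>g\<close> in \<open>T\<close>, and
  passes to products (\<open>diff_sumK_in_span\<close>). These two facts are played against each other twice.

  If \<open>A\<close> has finite index, multiply the identity for \<open>g\<close> in \<open>A\<close> from the right by the sum of a transversal:
  the right-hand side vanishes in \<open>A/B\<close> and the left-hand side is a positive multiple of \<open>g\<close>, so
  \<open>A = B\<close> (\<open>finite_index_case\<close>).

  If \<open>U\<close> is a normal subgroup with \<open>U/A\<close> locally nilpotent, an Ore condition in the group ring gives
  that every \<open>u\<close> in \<open>U\<close> acts on \<open>A/B\<close> unipotently on each element (\<open>unipotent\<close>). As \<open>U/A\<close> is locally nilpotent,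
  this makes \<open>U/B\<close> locally nilpotent (\<open>loc_nilp_lift\<close>).

  A torsion-free locally nilpotent group has unique roots, so centralizers in it are isolated and
  the condition on fixed elements passes to suitable sections (\<open>T_inherits_zero\<close>, \<open>T_inherits_up\<close>). Hence a
  locally nilpotent term of the derived series of \<open>N\<close> can be cut into sections \<open>A/B\<close> of the above kind
  (\<open>layer_induct\<close>). Going up the derived series with the second application, \<open>N\<close> itself
  becomes locally nilpotent; cutting \<open>N\<close> into layers and using the first application, \<open>N\<close> vanishes
  (\<open>finite_amalgam\<close>).

  Groups are written additively until the last step because the ring of finitely supported
  functions \<open>'g \<Rightarrow>\<^sub>0 int\<close> is then the integral group ring. Sections \<open>A/B\<close> are handled by congruences modulo \<open>B\<close>
  inside one group, so that no quotient has to be a type of its own. An abstract group enters through its regular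
  representation.
\<close>

section \<open>Subgroups and commutators in additive notation\<close>

definition conjg :: "'g::group_add \<Rightarrow> 'g \<Rightarrow> 'g" where "conjg g a = g + a - g"
definition commu :: "'g::group_add \<Rightarrow> 'g \<Rightarrow> 'g" where "commu x y = x + y - x - y"

definition subgrp :: "'g::group_add set \<Rightarrow> bool" where
  "subgrp S \<longleftrightarrow> 0 \<in> S \<and> (\<forall>x\<in>S. \<forall>y\<in>S. x - y \<in> S)"

definition normalizes :: "'g::group_add set \<Rightarrow> 'g set \<Rightarrow> bool" where
  "normalizes G A \<longleftrightarrow> (\<forall>g\<in>G. \<forall>a\<in>A. conjg g a \<in> A)"

inductive_set generated :: "'g::group_add set \<Rightarrow> 'g set" for S where
  zero: "0 \<in> generated S"
| base: "x \<in> S \<Longrightarrow> x \<in> generated S"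
| diff: "x \<in> generated S \<Longrightarrow> y \<in> generated S \<Longrightarrow> x - y \<in> generated S"

primrec mul :: "nat \<Rightarrow> 'g::group_add \<Rightarrow> 'g" where
  "mul 0 a = 0" | "mul (Suc n) a = a + mul n a"

lemma subgrp_0: "subgrp S \<Longrightarrow> 0 \<in> S" and subgrp_diff: "subgrp S \<Longrightarrow> x \<in> S \<Longrightarrow> y \<in> S \<Longrightarrow> x - y \<in> S"
  by (auto simp: subgrp_def)
lemma subgrp_minus: "subgrp S \<Longrightarrow> x \<in> S \<Longrightarrow> - x \<in> S"
  using subgrp_diff[of S 0 x] subgrp_0[of S] by simp
lemma subgrp_add: "subgrp S \<Longrightarrow> x \<in> S \<Longrightarrow> y \<in> S \<Longrightarrow> x + y \<in> S"
  using subgrp_diff[of S x "-y"] subgrp_minus[of S y] by simp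
lemma subgrp_mul: "subgrp S \<Longrightarrow> x \<in> S \<Longrightarrow> mul n x \<in> S"
  by (induction n) (auto intro: subgrp_0 subgrp_add)
lemma subgrp_add_iff1: assumes "subgrp S" "x \<in> S" shows "x + y \<in> S \<longleftrightarrow> y \<in> S"
proof
  assume "x + y \<in> S" then have "- x + (x + y) \<in> S" using assms subgrp_add subgrp_minus by blast
  then show "y \<in> S" by (simp add: add.assoc[symmetric])
qed (use assms subgrp_add in blast)

lemmas gsimps = diff_conv_add_uminus add.assoc minus_add

lemma conjg_add: "conjg (g + h) a = conjg g (conjg h a)"
  by (simp add: conjg_def gsimps del: add_uminus_conv_diff)
lemma conjg_plus: "conjg g (a + b) = conjg g a + conjg g b"
  by (simp add: conjg_def gsimps del: add_uminus_conv_diff)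
lemma conjg_uminus: "conjg g (- a) = - conjg g a"
  by (simp add: conjg_def gsimps del: add_uminus_conv_diff)
lemma conjg_diff: "conjg g (a - b) = conjg g a - conjg g b"
  by (metis conjg_plus conjg_uminus add_uminus_conv_diff)
lemma conjg_0 [simp]: "conjg 0 a = a" "conjg g 0 = 0"
  by (simp_all add: conjg_def)
lemma conjg_inv [simp]: "conjg (- g) (conjg g a) = a" "conjg g (conjg (- g) a) = a"
  by (simp_all flip: conjg_add)
lemma conjg_commu: "conjg g (commu x y) = commu (conjg g x) (conjg g y)"
  by (simp add: commu_def conjg_plus conjg_diff)
lemma commu_conjg: "commu x y = conjg x y - y"
  by (simp add: commu_def conjg_def)
lemma conjg_commu_plus: "conjg x y = commu x y + y"
  by (simp add: commu_conjg)
lemma commu_minus: "- commu x y = commu y x"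
  by (simp add: commu_def gsimps del: add_uminus_conv_diff)
lemma commu_0 [simp]: "commu 0 y = 0" "commu x 0 = 0" "commu x x = 0"
  by (simp_all add: commu_def)
lemma conjg_move: "g + a = conjg g a + g"
  by (simp add: conjg_def)
lemma conjg_mul: "conjg g (mul n a) = mul n (conjg g a)"
  by (induction n) (simp_all add: conjg_plus)
lemma mul_add: "mul (m + n) a = mul m a + mul n a"
  by (induction m) (simp_all add: add.assoc)
lemma mul_mult: "mul (m * n) a = mul m (mul n a)"
  by (induction m) (simp_all add: mul_add)
lemma mul_comm: "a + mul n a = mul n a + a"
  by (induction n) (simp_all, metis add.assoc)

lemma generated_subgrp: "subgrp (generated S)"
  by (auto simp: subgrp_def intro: generated.intros)
lemma generated_subset: "S \<subseteq> generated S" by (auto intro: generated.base)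
lemma generated_least: assumes "S \<subseteq> R" "subgrp R" shows "generated S \<subseteq> R"
proof
  fix x assume "x \<in> generated S" then show "x \<in> R"
    by induction (use assms in \<open>auto simp: subgrp_def\<close>)
qed
lemma generated_mono: "S \<subseteq> R \<Longrightarrow> generated S \<subseteq> generated R"
  by (meson generated_least generated_subgrp generated_subset subset_trans)

text \<open>Closure of the generating set under inversion is essential: a conjugate of a subgroup can lie
  properly inside it.\<close>

lemma normalizes_generated:
  assumes "normalizes S A" "\<And>s. s \<in> S \<Longrightarrow> - s \<in> S"
  shows "normalizes (generated S) A"
proof -
  have "conjg g a \<in> A \<and> conjg (- g) a \<in> A" if "g \<in> generated S" "a \<in> A" for g a
    using that
  proof (induction arbitrary: a)
    case (diff x y)
    have "conjg (x - y) a = conjg x (conjg (- y) a)" "conjg (- (x - y)) a = conjg y (conjg (- x) a)"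
      by (simp_all add: gsimps flip: conjg_add del: add_uminus_conv_diff)
    then show ?case using diff by metis
  qed (use assms in \<open>auto simp: normalizes_def\<close>)
  then show ?thesis by (auto simp: normalizes_def)
qed

lemma subgrp_centralizer_mod:
  assumes "subgrp G" "subgrp B" "normalizes G B"
  shows "subgrp {x \<in> G. commu x y \<in> B}"
proof -
  have 1: "commu (- x) y \<in> B" if "x \<in> G" "commu x y \<in> B" for x
  proof -
    have "commu (- x) y = conjg (- x) (- commu x y)"
      by (simp add: commu_def conjg_def gsimps del: add_uminus_conv_diff)
    then show ?thesis using that assms by (simp add: normalizes_def subgrp_minus)
  qed
  have 2: "commu (x + z) y = conjg x (commu z y) + commu x y" for x z
    by (simp add: commu_def conjg_def gsimps del: add_uminus_conv_diff)
  have "commu (x - z) y \<in> B" if "x \<in> G" "commu x y \<in> B" "z \<in> G" "commu z y \<in> B" for x z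
    using 2[of x "- z"] 1[OF that(3,4)] that assms
    by (simp add: normalizes_def subgrp_add)
  then show ?thesis using assms by (auto simp: subgrp_def)
qed

lemma subgrp_centralizer_mod':
  assumes "subgrp G" "subgrp B" "normalizes G B"
  shows "subgrp {y \<in> G. commu x y \<in> B}"
proof -
  have "{y \<in> G. commu x y \<in> B} = {y \<in> G. commu y x \<in> B}"
    using assms(2) by (metis commu_minus subgrp_minus)
  then show ?thesis using subgrp_centralizer_mod[OF assms] by simp
qed

section \<open>The integral group ring\<close>

type_synonym 'g gring = "'g \<Rightarrow>\<^sub>0 int"

lemma frag_of_add: "frag_of (a + b) = frag_of a * frag_of (b::'g::group_add)"
  by (simp add: mult_single)
lemma frag_of_0 [simp]: "frag_of (0::'g::group_add) = 1" by simp
lemma frag_of_conjg: "frag_of g * frag_of a = frag_of (conjg g a) * frag_of g"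
  by (metis conjg_move frag_of_add)

inductive_set addspan :: "'b::ab_group_add set \<Rightarrow> 'b set" for S where
  zero: "0 \<in> addspan S"
| base: "x \<in> S \<Longrightarrow> x \<in> addspan S"
| diff: "x \<in> addspan S \<Longrightarrow> y \<in> addspan S \<Longrightarrow> x - y \<in> addspan S"

lemma addspan_minus: assumes "x \<in> addspan S" shows "- x \<in> addspan S"
proof -
  have "0 - x \<in> addspan S" by (rule addspan.diff[OF addspan.zero assms])
  then show ?thesis by simp
qed
lemma addspan_add: assumes "x \<in> addspan S" "y \<in> addspan S" shows "x + y \<in> addspan S"
proof -
  have "x - (- y) \<in> addspan S" by (rule addspan.diff[OF assms(1) addspan_minus[OF assms(2)]])
  then show ?thesis by simp
qed
lemma addspan_sum: assumes "\<And>i. i \<in> I \<Longrightarrow> f i \<in> addspan S" shows "sum f I \<in> addspan S"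
  using assms
proof (induction I rule: infinite_finite_induct)
  case (insert i I) then show ?case by (metis addspan_add insertCI sum.insert)
qed (simp_all add: addspan.zero)
lemma addspan_sum_list: assumes "\<And>x. x \<in> set xs \<Longrightarrow> f x \<in> addspan S" shows "sum_list (map f xs) \<in> addspan S"
  using assms
proof (induction xs)
  case (Cons x xs) then show ?case using addspan_add[of "f x" S "sum_list (map f xs)"] by simp
qed (simp add: addspan.zero)
lemma addspan_of_nat: fixes x :: "'b::ring_1" assumes "x \<in> addspan S" shows "of_nat n * x \<in> addspan S"
proof (induction n)
  case (Suc n) then show ?case using addspan_add[OF assms Suc] by (simp add: algebra_simps)
qed (simp add: addspan.zero)
lemma addspan_of_int: fixes x :: "'b::ring_1" assumes "x \<in> addspan S" shows "of_int n * x \<in> addspan S"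
proof (cases n rule: int_cases2)
  case (nonneg m) then show ?thesis using addspan_of_nat[OF assms, of m] by simp
next
  case (nonpos m) then show ?thesis using addspan_minus[OF addspan_of_nat[OF assms, of m]] by simp
qed

text \<open>The usual way to see that an additive map carries one span into another: check generators.\<close>

lemma addspan_induct_map:
  assumes "z \<in> addspan S" "\<And>x y. f (x - y) = f x - f y" "\<And>x. x \<in> S \<Longrightarrow> f x \<in> addspan R"
  shows "f z \<in> addspan R"
  using assms(1)
proof induction
  case zero
  have "f 0 = 0" using assms(2)[of 0 0] by simp
  then show ?case by (simp add: addspan.zero)
next
  case (base x) then show ?case by (rule assms(3))
next
  case (diff x y)
  have "f x - f y \<in> addspan R" by (rule addspan.diff[OF diff.IH])
  then show ?case using assms(2)[of x y] by argo
qed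
lemma addspan_mono: "S \<subseteq> addspan R \<Longrightarrow> addspan S \<subseteq> addspan R"
proof
  fix z assume "S \<subseteq> addspan R" "z \<in> addspan S"
  then show "z \<in> addspan R" using addspan_induct_map[where f="\<lambda>x. x" and z=z and S=S and R=R] by fast
qed
lemma of_nat_comm: "of_nat n * (x::'b::ring_1) = x * of_nat n"
  by (rule mult_of_nat_commute)

section \<open>Abelian sections inside the group ring\<close>

text \<open>For a subgroup \<open>A\<close> this is the span of the products \<open>(a - 1) g\<close>, that is, the kernel of the map from the
  group ring to the free abelian group on the right cosets of \<open>A\<close>. The smaller span \<open>augm2 A B\<close> is made
  of the products \<open>(a - 1) (g - 1)\<close> and \<open>(b - 1) g\<close>. If \<open>A/B\<close> is abelian, then \<open>a \<mapsto> a - 1\<close> identifies \<open>A/B\<close>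
  with \<open>augm A / augm2 A B\<close>, the action of \<open>G\<close> by conjugation becomes left multiplication, and right
  multiplication becomes trivial. This lets the group ring act on abelian sections without
  quotient groups.\<close>

definition augm :: "'g::group_add set \<Rightarrow> 'g gring set" where
  "augm A = addspan {frag_of (a + g) - frag_of g | a g. a \<in> A}"

definition augm2 :: "'g::group_add set \<Rightarrow> 'g set \<Rightarrow> 'g gring set" where
  "augm2 A B = addspan ({frag_of (a + g) - frag_of g - frag_of a + 1 | a g. a \<in> A}
               \<union> {frag_of (b + g) - frag_of g | b g. b \<in> B})"

lemma augm_base: "a \<in> A \<Longrightarrow> frag_of (a + g) - frag_of g \<in> augm A"
  unfolding augm_def by (rule addspan.base) blast
lemma augm_diff: "x \<in> augm A \<Longrightarrow> y \<in> augm A \<Longrightarrow> x - y \<in> augm A"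
  unfolding augm_def by (rule addspan.diff)
lemma augm2_base: "a \<in> A \<Longrightarrow> frag_of (a + g) - frag_of g - frag_of a + 1 \<in> augm2 A B"
  unfolding augm2_def by (rule addspan.base) blast
lemma augm2_base': "b \<in> B \<Longrightarrow> frag_of (b + g) - frag_of g \<in> augm2 A B"
  unfolding augm2_def by (rule addspan.base) blast
lemma augm2_diff: "x \<in> augm2 A B \<Longrightarrow> y \<in> augm2 A B \<Longrightarrow> x - y \<in> augm2 A B"
  unfolding augm2_def by (rule addspan.diff)
lemma augm2_add: "x \<in> augm2 A B \<Longrightarrow> y \<in> augm2 A B \<Longrightarrow> x + y \<in> augm2 A B"
  unfolding augm2_def by (rule addspan_add)
lemma augm2_minus: "x \<in> augm2 A B \<Longrightarrow> - x \<in> augm2 A B"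
  unfolding augm2_def by (rule addspan_minus)
lemma augm2_cong: "x - y \<in> augm2 A B \<Longrightarrow> x \<in> augm2 A B \<longleftrightarrow> y \<in> augm2 A B"
  using augm2_diff[of x A B "x - y"] augm2_add[of "x - y" A B y] by auto

lemma augm_left:
  assumes "\<And>a. a \<in> A \<Longrightarrow> conjg g a \<in> A" "z \<in> augm A"
  shows "frag_of g * z \<in> augm A"
  using assms(2) unfolding augm_def
proof (rule addspan_induct_map)
  fix x assume "x \<in> {frag_of (a + g) - frag_of g |a g. a \<in> A}"
  then obtain a h where x: "x = frag_of (a + h) - frag_of h" "a \<in> A" by blast
  have "frag_of g * x = frag_of (conjg g a + (g + h)) - frag_of (g + h)"
    unfolding x by (simp only: right_diff_distrib flip: frag_of_add) (simp add: conjg_move[of g a] add.assoc[symmetric])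
  then show "frag_of g * x \<in> addspan {frag_of (a + g) - frag_of g |a g. a \<in> A}"
    using augm_base[OF assms(1)[OF x(2)], of "g + h"] by (simp add: augm_def)
qed (simp add: right_diff_distrib)

lemma augm_right:
  assumes "z \<in> augm A" shows "z * frag_of g \<in> augm A"
  using assms unfolding augm_def
proof (rule addspan_induct_map)
  fix x assume "x \<in> {frag_of (a + g) - frag_of g |a g. a \<in> A}"
  then obtain a h where x: "x = frag_of (a + h) - frag_of h" "a \<in> A" by blast
  have "x * frag_of g = frag_of (a + (h + g)) - frag_of (h + g)"
    unfolding x by (simp only: left_diff_distrib add.assoc flip: frag_of_add)
  then show "x * frag_of g \<in> addspan {frag_of (a + g) - frag_of g |a g. a \<in> A}"
    using augm_base[OF x(2), of "h + g"] by (simp add: augm_def)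
qed (simp add: left_diff_distrib)

lemma augm2_left:
  assumes "\<And>a. a \<in> A \<Longrightarrow> conjg g a \<in> A" "\<And>a. a \<in> B \<Longrightarrow> conjg g a \<in> B" "z \<in> augm2 A B"
  shows "frag_of g * z \<in> augm2 A B"
proof -
  let ?S = "{frag_of (a + g) - frag_of g - frag_of a + 1 | a g. a \<in> A}
               \<union> {frag_of (b + g) - frag_of g | b g. b \<in> B}"
  have mv: "g + (a + h) = conjg g a + (g + h)" for a h by (simp add: conjg_move[of g a] add.assoc[symmetric])
  have "frag_of g * z \<in> addspan ?S"
    using assms(3) unfolding augm2_def
  proof (rule addspan_induct_map)
    fix x assume "x \<in> ?S"
    then consider a h where "x = frag_of (a + h) - frag_of h - frag_of a + 1" "a \<in> A"
      | b h where "x = frag_of (b + h) - frag_of h" "b \<in> B" by blast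
    then show "frag_of g * x \<in> addspan ?S"
    proof cases
      case 1
      have "frag_of g * x = (frag_of (conjg g a + (g + h)) - frag_of (g + h) - frag_of (conjg g a) + 1)
            - (frag_of (conjg g a + (g + 0)) - frag_of (g + 0) - frag_of (conjg g a) + 1)"
        unfolding 1 by (simp only: right_diff_distrib distrib_left mult_1_right mv flip: frag_of_add, simp add: conjg_move[of g a])
      then show ?thesis
        using augm2_diff[OF augm2_base[OF assms(1)[OF 1(2)], where g="g + h" and B=B] augm2_base[OF assms(1)[OF 1(2)], where g="g + 0" and B=B]]
        by (simp add: augm2_def)
    next
      case 2
      have "frag_of g * x = frag_of (conjg g b + (g + h)) - frag_of (g + h)"
        unfolding 2 by (simp only: right_diff_distrib mv flip: frag_of_add)
      then show ?thesis using augm2_base'[OF assms(2)[OF 2(2)], of "g + h" A] by (simp add: augm2_def)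
    qed
  qed (simp add: right_diff_distrib)
  then show ?thesis by (simp add: augm2_def)
qed

lemma augm2_right:
  assumes "z \<in> augm2 A B"
  shows "z * frag_of g \<in> augm2 A B"
proof -
  let ?S = "{frag_of (a + g) - frag_of g - frag_of a + 1 | a g. a \<in> A}
               \<union> {frag_of (b + g) - frag_of g | b g. b \<in> B}"
  have "z * frag_of g \<in> addspan ?S"
    using assms unfolding augm2_def
  proof (rule addspan_induct_map)
    fix x assume "x \<in> ?S"
    then consider a h where "x = frag_of (a + h) - frag_of h - frag_of a + 1" "a \<in> A"
      | b h where "x = frag_of (b + h) - frag_of h" "b \<in> B" by blast
    then show "x * frag_of g \<in> addspan ?S"
    proof cases
      case 1
      have "x * frag_of g = (frag_of (a + (h + g)) - frag_of (h + g) - frag_of a + 1)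
            - (frag_of (a + g) - frag_of g - frag_of a + 1)"
        unfolding 1 by (simp only: left_diff_distrib distrib_right mult_1_left add.assoc flip: frag_of_add) simp
      then show ?thesis
        using augm2_diff[OF augm2_base[OF 1(2), where g="h + g" and B=B] augm2_base[OF 1(2), where g=g and B=B]]
        by (simp add: augm2_def)
    next
      case 2
      have "x * frag_of g = frag_of (b + (h + g)) - frag_of (h + g)"
        unfolding 2 by (simp only: left_diff_distrib add.assoc flip: frag_of_add)
      then show ?thesis using augm2_base'[OF 2(2), of "h + g" A] by (simp add: augm2_def)
    qed
  qed (simp add: left_diff_distrib)
  then show ?thesis by (simp add: augm2_def)
qed

lemma augm_mult_diff:
  assumes "z \<in> augm A" shows "z * (frag_of g - 1) \<in> augm2 A B"
proof -
  have "z * (frag_of g - 1) \<in> addspan (augm2 A B)"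
    using assms unfolding augm_def
  proof (rule addspan_induct_map)
    fix x assume "x \<in> {frag_of (a + g) - frag_of g |a g. a \<in> A}"
    then obtain a h where x: "x = frag_of (a + h) - frag_of h" "a \<in> A" by blast
    have "x * (frag_of g - 1) = (frag_of (a + (h + g)) - frag_of (h + g) - frag_of a + 1)
         - (frag_of (a + h) - frag_of h - frag_of a + 1)"
      unfolding x by (simp only: left_diff_distrib right_diff_distrib mult_1_right add.assoc flip: frag_of_add) simp
    then show "x * (frag_of g - 1) \<in> addspan (augm2 A B)"
      using augm2_diff[OF augm2_base[OF x(2)] augm2_base[OF x(2)]] by (metis addspan.base)
  qed (simp add: left_diff_distrib)
  then show ?thesis
    unfolding augm2_def using addspan_mono by blast
qed

lemma augm_right_cong: "z \<in> augm A \<Longrightarrow> z * frag_of g - z \<in> augm2 A B"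
  using augm_mult_diff[of z A g B] by (simp add: right_diff_distrib)

lemma augm2_diff_frag:
  assumes "subgrp A" "a \<in> A" "b \<in> A"
  shows "(frag_of a - frag_of b) - (frag_of (a - b) - 1) \<in> augm2 A B"
  using augm2_base[OF subgrp_diff[OF assms], of b B] by (simp add: algebra_simps)

text \<open>Surjectivity of \<open>A/B \<rightarrow> augm A / augm2 A B\<close>: the differences \<open>a - 1\<close> form a subgroup modulo
  \<open>augm2 A B\<close>.\<close>

lemma augm_representative:
  assumes "subgrp A" "z \<in> augm A"
  shows "\<exists>a\<in>A. z - (frag_of a - 1) \<in> augm2 A B"
  using assms(2) unfolding augm_def
proof induction
  case zero
  show ?case by (rule bexI[of _ 0]) (use assms(1) in \<open>auto simp: subgrp_0 augm2_def addspan.zero\<close>)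
next
  case (base x)
  then obtain a g where x: "x = frag_of (a + g) - frag_of g" "a \<in> A" by blast
  have "x - (frag_of a - 1) = frag_of (a + g) - frag_of g - frag_of a + 1" by (simp add: x(1))
  then show ?case using augm2_base[OF x(2), where g=g and B=B] x(2) by metis
next
  case (diff x y)
  then obtain a b where ab: "a \<in> A" "b \<in> A" "x - (frag_of a - 1) \<in> augm2 A B" "y - (frag_of b - 1) \<in> augm2 A B" by blast
  have "(x - y) - (frag_of (a - b) - 1) = (x - (frag_of a - 1)) - (y - (frag_of b - 1))
      + ((frag_of a - frag_of b) - (frag_of (a - b) - 1))" by simp
  then have "(x - y) - (frag_of (a - b) - 1) \<in> augm2 A B"
    using augm2_add[OF augm2_diff[OF ab(3,4)] augm2_diff_frag[OF assms(1) ab(1,2), of B]] by argo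
  then show ?case using subgrp_diff[OF assms(1) ab(1,2)] by blast
qed

text \<open>Injectivity of \<open>A/B \<rightarrow> augm A / augm2 A B\<close>. A retraction is needed: with a section \<open>s\<close> of the right cosets
  of \<open>A\<close>, the map \<open>g \<mapsto> g - s g\<close> into the abelian group \<open>A/B\<close> extends linearly to the group ring, kills
  \<open>augm2 A B\<close> and sends \<open>a - 1\<close> to the class of \<open>a\<close>.\<close>

lemma frag_of_diff_1_iff:
  assumes A: "subgrp A" and B: "subgrp B" "B \<subseteq> A" and comm: "\<And>a b. a \<in> A \<Longrightarrow> b \<in> A \<Longrightarrow> commu a b \<in> B"
    and a: "a \<in> A"
  shows "frag_of a - 1 \<in> augm2 A B \<longleftrightarrow> a \<in> B"
proof
  assume "a \<in> B" then show "frag_of a - 1 \<in> augm2 A B" using augm2_base'[of a B 0 A] by simp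
next
  assume mem: "frag_of a - 1 \<in> augm2 A B"
  define M where "M = \<lparr>carrier = A, monoid.mult = (+), one = 0::'a\<rparr>"
  have M: "carrier M = A" "x \<otimes>\<^bsub>M\<^esub> y = x + y" "\<one>\<^bsub>M\<^esub> = 0" for x y by (simp_all add: M_def)
  interpret M: group M
  proof (rule groupI)
    fix x assume "x \<in> carrier M"
    then show "\<exists>y\<in>carrier M. y \<otimes>\<^bsub>M\<^esub> x = \<one>\<^bsub>M\<^esub>"
      using subgrp_minus[OF A, of x] by (intro bexI[of _ "- x"]) (simp_all add: M)
  qed (auto simp: M add.assoc subgrp_add[OF A] subgrp_0[OF A])
  have invM: "inv\<^bsub>M\<^esub> x = - x" if "x \<in> A" for x
    using that M.inv_equality[of "- x" x] by (simp add: M subgrp_minus[OF A])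
  have subB: "subgroup B M"
    by (rule M.subgroupI) (use B A in \<open>auto simp: M invM subgrp_minus subgrp_add subsetD subgrp_0 dest: subgrp_0\<close>)
  interpret B: normal B M
  proof (rule M.normal_invI[OF subB])
    fix x h assume "x \<in> carrier M" "h \<in> B"
    then have "commu x h + h \<in> B" using comm B by (intro subgrp_add[OF B(1)]) (auto simp: M)
    then show "x \<otimes>\<^bsub>M\<^esub> h \<otimes>\<^bsub>M\<^esub> inv\<^bsub>M\<^esub> x \<in> B"
      using \<open>x \<in> carrier M\<close> by (simp add: M invM commu_conjg conjg_def)
  qed
  have "comm_group (M Mod B)"
  proof (rule group.group_comm_groupI[OF B.factorgroup_is_group])
    fix P1 P2 assume "P1 \<in> carrier (M Mod B)" "P2 \<in> carrier (M Mod B)"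
    then obtain x y where xy: "x \<in> A" "y \<in> A" "P1 = B #>\<^bsub>M\<^esub> x" "P2 = B #>\<^bsub>M\<^esub> y"
      by (auto simp: FactGroup_def RCOSETS_def M)
    have "x + y = commu x y + (y + x)" by (simp add: commu_def gsimps del: add_uminus_conv_diff)
    then have "B #>\<^bsub>M\<^esub> (x + y) = B #>\<^bsub>M\<^esub> (y + x)"
      using M.coset_mult_assoc[of B "commu x y" "y + x"] comm[OF xy(1,2)] xy A B
        M.coset_join2[OF _ subB comm[OF xy(1,2)]]
      by (auto simp: M subgrp_add)
    then show "P1 \<otimes>\<^bsub>M Mod B\<^esub> P2 = P2 \<otimes>\<^bsub>M Mod B\<^esub> P1"
      using xy B.rcos_sum by (simp add: FactGroup_def M)
  qed
  then interpret Q: comm_group "M Mod B" .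
  \<comment> \<open>a section of the right cosets of \<open>A\<close> that sends \<open>A\<close> itself to \<open>0\<close>\<close>
  define s where "s = (\<lambda>g. if g \<in> A then 0 else (SOME x. g - x \<in> A))"
  have s: "g - s g \<in> A" for g
  proof (cases "g \<in> A")
    case False
    have "g - g \<in> A" using subgrp_0[OF A] by simp
    then show ?thesis using False someI[of "\<lambda>x. g - x \<in> A" g] by (simp add: s_def)
  qed (simp add: s_def)
  have s_add: "s (c + g) = s g" if "c \<in> A" for c g
  proof -
    have "(c + g) - x \<in> A \<longleftrightarrow> g - x \<in> A" for x
      using subgrp_add_iff1[OF A that, of "g - x"] by (simp add: gsimps del: add_uminus_conv_diff)
    then show ?thesis using subgrp_add_iff1[OF A that] by (simp add: s_def)
  qed
  define k where "k = (\<lambda>g. B #>\<^bsub>M\<^esub> (g - s g))"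
  have k: "k g \<in> carrier (M Mod B)" for g
    using s[of g] by (auto simp: k_def FactGroup_def RCOSETS_def M)
  obtain h where h: "h \<in> hom (free_Abelian_group UNIV) (M Mod B)" "\<And>x. h (frag_of x) = k x"
  proof (rule Q.free_Abelian_group_universal[of k UNIV])
    show "k ` UNIV \<subseteq> carrier (M Mod B)" using k by blast
  qed (simp only: UNIV_I simp_thms)
  interpret h: group_hom "free_Abelian_group UNIV" "M Mod B" h
    by (intro group_hom.intro group_hom_axioms.intro group_free_Abelian_group Q.is_group h(1))
  have h_add: "h (x + y) = h x \<otimes>\<^bsub>M Mod B\<^esub> h y" for x y
    using h.hom_mult[of x y] by simp
  have h_minus: "h (- x) = inv\<^bsub>M Mod B\<^esub> h x" for x
    using h.hom_inv[of x] by simp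
  have h_diff: "h (x - y) = h x \<otimes>\<^bsub>M Mod B\<^esub> inv\<^bsub>M Mod B\<^esub> h y" for x y
    using h_add[of x "- y"] h_minus by simp
  have k_add: "k (c + g) = k c \<otimes>\<^bsub>M Mod B\<^esub> k g" if "c \<in> A" for c g
  proof -
    have "c + g - s g = c + (g - s g)" by (simp add: gsimps del: add_uminus_conv_diff)
    moreover have "k c = B #>\<^bsub>M\<^esub> c" using that by (simp add: k_def s_def)
    ultimately show ?thesis using that s[of g] B.rcos_sum[of c "g - s g"]
      by (simp add: k_def s_add FactGroup_def M)
  qed
  have k_B: "k b = \<one>\<^bsub>M Mod B\<^esub>" if "b \<in> B" for b
    using that B M.coset_join2[OF _ subB that] by (auto simp: M k_def s_def FactGroup_def subsetD)
  have k0: "k 0 = \<one>\<^bsub>M Mod B\<^esub>" using k_B subgrp_0[OF B(1)] by simp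
  have "h z = \<one>\<^bsub>M Mod B\<^esub>" if "z \<in> augm2 A B" for z
    using that unfolding augm2_def
  proof induction
    case zero show ?case using h.hom_one by simp
  next
    case (base x)
    then consider c g where "x = frag_of (c + g) - frag_of g - frag_of c + 1" "c \<in> A"
      | b g where "x = frag_of (b + g) - frag_of g" "b \<in> B" by blast
    then show ?case
    proof cases
      case 1
      have x: "x = (frag_of (c + g) - frag_of g) - (frag_of c - frag_of 0)" by (simp add: 1(1))
      show ?thesis unfolding x h_diff h k_add[OF 1(2)] k0 using k[of c] k[of g]
        by (simp add: Q.m_assoc del: mult_FactGroup one_FactGroup)
    next
      case 2
      then have "b \<in> A" using B by blast
      then show ?thesis unfolding 2(1) h_diff h using k[of g] k_add[of b g] k_B[OF 2(2)]
        by (simp del: mult_FactGroup one_FactGroup)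
    qed
  next
    case (diff x y) show ?case unfolding h_diff diff.IH
      by (simp del: mult_FactGroup one_FactGroup)
  qed
  then have "h (frag_of a - frag_of 0) = \<one>\<^bsub>M Mod B\<^esub>" using mem by simp
  then have "k a = \<one>\<^bsub>M Mod B\<^esub>" unfolding h_diff h k0 using k[of a]
    by (simp del: mult_FactGroup one_FactGroup)
  then have "B #>\<^bsub>M\<^esub> a = B" using a by (simp add: k_def s_def FactGroup_def)
  then show "a \<in> B" using M.rcos_self[OF _ subB, of a] a by (simp add: M)
qed

lemma augm_sum: "(\<And>i. i \<in> I \<Longrightarrow> f i \<in> augm A) \<Longrightarrow> sum f I \<in> augm A"
  unfolding augm_def by (rule addspan_sum)
lemma augm2_sum: "(\<And>i. i \<in> I \<Longrightarrow> f i \<in> augm2 A B) \<Longrightarrow> sum f I \<in> augm2 A B"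
  unfolding augm2_def by (rule addspan_sum)
lemma augm2_0: "0 \<in> augm2 A B"
  unfolding augm2_def by (rule addspan.zero)

lemma nat_left: "x * (of_nat n * y) = of_nat n * (x * (y::'b::ring_1))"
  by (metis mult.assoc mult_of_nat_commute)

lemma nat_nat: "of_nat (m * n) * (of_nat m * x) = of_nat (m * m * n) * (x::'b::ring_1)"
proof -
  have "m * n * m = m * m * n" by simp
  then show ?thesis by (metis mult.assoc of_nat_mult)
qed

section \<open>Two finite subgroups with a common subgroup\<close>

locale amalgam =
  fixes H K T :: "'g::group_add set"
  assumes fin: "finite H" "finite K" "finite T"
    and sg: "subgrp H" "subgrp K" "subgrp T"
    and sub: "H \<subseteq> K" "H \<subseteq> T"
begin

definition G where "G = generated (K \<union> T)"

lemma sgG: "subgrp G" by (simp add: G_def generated_subgrp)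
lemma KG: "K \<subseteq> G" and TG: "T \<subseteq> G" and HG: "H \<subseteq> G"
  using generated_subset[of "K \<union> T"] sub by (auto simp: G_def)

definition sumH where "sumH = (\<Sum>h\<in>H. frag_of h)"
definition sumK where "sumK = (\<Sum>h\<in>K. frag_of h)"
definition sumT where "sumT = (\<Sum>h\<in>T. frag_of h)"
definition eps where "eps = of_nat (card T) * sumH - of_nat (card H) * sumT"
definition omega where "omega = of_nat (card T) * sumK - of_nat (card K) * sumT"

lemma card_pos: "card H > 0" "card K > 0" "card T > 0"
  using fin sg by (auto simp: card_gt_0_iff subgrp_def)

lemma absorb:
  assumes "subgrp L" "l \<in> L" shows "frag_of l * (\<Sum>h\<in>L. frag_of h) = (\<Sum>h\<in>L. frag_of (h::'g))"
proof -
  have "bij_betw ((+) l) L L"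
    by (rule bij_betwI[of _ _ _ "\<lambda>x. - l + x"]) (use assms in \<open>auto simp: subgrp_add subgrp_minus\<close>)
  then have "(\<Sum>h\<in>L. frag_of (l + h)) = (\<Sum>h\<in>L. frag_of h)" by (rule sum.reindex_bij_betw)
  then show ?thesis by (simp add: sum_distrib_left frag_of_add)
qed

lemma omega_eq_sum_diff: "omega = (\<Sum>(k,t)\<in>K\<times>T. frag_of k - frag_of t)"
proof -
  have "(\<Sum>(k,t)\<in>K\<times>T. frag_of k - frag_of t) = (\<Sum>k\<in>K. \<Sum>t\<in>T. frag_of k - frag_of t)"
    by (simp add: sum.cartesian_product)
  also have "\<dots> = omega" by (simp add: omega_def sumK_def sumT_def sum_subtractf sum_distrib_left)
  finally show ?thesis ..
qed

text \<open>The elements \<open>g\<close> with this property are closed under differences, because the span is stable under left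
  translation. So only generators matter. For \<open>g\<close> in \<open>K\<close> the left-hand side is zero. For \<open>g\<close> in \<open>T\<close> both
  \<open>(g - 1) eps omega\<close> and the left-hand side are the same multiple of \<open>(g - 1) omega\<close>, since \<open>g - 1\<close>
  annihilates \<open>sumT\<close>.\<close>

lemma diff_sumK_in_span:
  assumes "g \<in> G"
  shows "of_nat (card T * card T * card H) * (frag_of g - 1) * sumK \<in> addspan {frag_of p * eps * omega |p. p \<in> G}"
    (is "?N * _ * _ \<in> addspan ?S")
proof -
  have left: "frag_of p * z \<in> addspan ?S" if "p \<in> G" "z \<in> addspan ?S" for p z
    using that(2)
  proof (rule addspan_induct_map)
    fix x assume "x \<in> ?S"
    then obtain q where "x = frag_of q * eps * omega" "q \<in> G" by blast
    then have "frag_of p * x = frag_of (p + q) * eps * omega" "p + q \<in> G"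
      using that subgrp_add[OF sgG] by (simp_all add: frag_of_add mult.assoc)
    then show "frag_of p * x \<in> addspan ?S" by (auto intro: addspan.base)
  qed (simp add: right_diff_distrib)
  have hw: "frag_of h * omega = omega" if "h \<in> H" for h
    using that absorb[OF sg(2), of h] absorb[OF sg(3), of h] sub
    by (simp add: omega_def right_diff_distrib subsetD sumK_def sumT_def of_nat_comm mult.assoc[symmetric])
  have ew: "eps * omega = of_nat (card T * card H) * omega - of_nat (card H) * (sumT * omega)"
    using hw by (simp add: eps_def sumH_def left_diff_distrib sum_distrib_right mult.assoc)
  have "g \<in> generated (K \<union> T)" using assms by (simp add: G_def)
  then show ?thesis
  proof induction
    case zero show ?case by (simp add: addspan.zero)
  next
    case (base t)
    show ?case
    proof (cases "t \<in> K")
      case True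
      then have "(frag_of t - 1) * sumK = 0" using absorb[OF sg(2)] by (simp add: left_diff_distrib sumK_def)
      then show ?thesis by (simp add: mult.assoc addspan.zero)
    next
      case False
      then have t: "t \<in> T" using base by blast
      have 0: "(frag_of t - 1) * sumT = 0" using absorb[OF sg(3) t] by (simp add: left_diff_distrib sumT_def)
      have 1: "(frag_of t - 1) * omega = of_nat (card T) * ((frag_of t - 1) * sumK)"
        by (simp only: omega_def right_diff_distrib nat_left 0) simp
      have "(frag_of t - 1) * (eps * omega) = of_nat (card T * card H) * ((frag_of t - 1) * omega) - of_nat (card H) * ((frag_of t - 1) * sumT * omega)"
        unfolding ew by (simp only: right_diff_distrib nat_left mult.assoc)
      also have "\<dots> = ?N * (frag_of t - 1) * sumK"
        unfolding 1 0 nat_nat by (simp only: mult_zero_left mult_zero_right diff_zero mult.assoc)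
      finally have eq: "?N * (frag_of t - 1) * sumK = frag_of t * (frag_of 0 * eps * omega) - frag_of 0 * eps * omega"
        by (simp add: left_diff_distrib)
      have "frag_of 0 * eps * omega \<in> addspan ?S" using subgrp_0[OF sgG] by (intro addspan.base) blast
      then show ?thesis unfolding eq using left[of t] t TG by (intro addspan.diff) auto
    qed
  next
    case (diff x y)
    have "x - y \<in> G" using diff subgrp_diff[OF sgG] by (simp add: G_def)
    have xy: "frag_of (x - y) * frag_of y = (frag_of x :: 'g gring)" by (simp flip: frag_of_add)
    have "frag_of (x - y) - 1 = (frag_of x - 1) - frag_of (x - y) * (frag_of y - (1 :: 'g gring))"
      unfolding right_diff_distrib xy by simp
    then have eq: "?N * (frag_of (x - y) - 1) * sumK = ?N * (frag_of x - 1) * sumK - frag_of (x - y) * (?N * (frag_of y - 1) * sumK)"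
      by (simp only: right_diff_distrib left_diff_distrib mult.assoc nat_left)
    show ?case unfolding eq by (rule addspan.diff[OF diff.IH(1) left[OF \<open>x - y \<in> G\<close> diff.IH(2)]])
  qed
qed

end

text \<open>The assumption \<open>good\<close> says that \<open>H\<close>-fixed elements of the torsion-free abelian section \<open>A/B\<close> are
  \<open>T\<close>-fixed.\<close>

locale good_section = amalgam H K T for H K T :: "'g::group_add set" +
  fixes A B :: "'g set"
  assumes sgA: "subgrp A" and sgB: "subgrp B" and BA: "B \<subseteq> A" and AG: "A \<subseteq> G"
    and nA: "normalizes G A" and nB: "normalizes G B"
    and comm: "\<And>a b. a \<in> A \<Longrightarrow> b \<in> A \<Longrightarrow> commu a b \<in> B"
    and good: "\<And>a t. a \<in> A \<Longrightarrow> (\<And>h. h \<in> H \<Longrightarrow> commu h a \<in> B) \<Longrightarrow> t \<in> T \<Longrightarrow> commu t a \<in> B"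
    and tf: "\<And>a n. a \<in> A \<Longrightarrow> n > 0 \<Longrightarrow> mul n a \<in> B \<Longrightarrow> a \<in> B"
begin

lemma cjA: "g \<in> G \<Longrightarrow> a \<in> A \<Longrightarrow> conjg g a \<in> A" using nA by (auto simp: normalizes_def)
lemma cjB: "g \<in> G \<Longrightarrow> a \<in> B \<Longrightarrow> conjg g a \<in> B" using nB by (auto simp: normalizes_def)
lemma augm_l: "g \<in> G \<Longrightarrow> z \<in> augm A \<Longrightarrow> frag_of g * z \<in> augm A" by (rule augm_left) (rule cjA)
lemma augm2_l: "g \<in> G \<Longrightarrow> z \<in> augm2 A B \<Longrightarrow> frag_of g * z \<in> augm2 A B" by (rule augm2_left) (rule cjA cjB; assumption)+
lemma frag_B: "a \<in> A \<Longrightarrow> frag_of a - 1 \<in> augm2 A B \<longleftrightarrow> a \<in> B"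
  by (rule frag_of_diff_1_iff[OF sgA sgB BA comm])

lemma conjg_frag:
  assumes "g \<in> G" "a \<in> A"
  shows "frag_of g * (frag_of a - 1) - (frag_of (conjg g a) - 1) \<in> augm2 A B"
proof -
  have "frag_of g * (frag_of a - 1) - (frag_of (conjg g a) - 1) = frag_of (conjg g a + g) - frag_of g - frag_of (conjg g a) + 1"
    unfolding frag_of_add frag_of_conjg[symmetric] by (simp add: right_diff_distrib)
  then show ?thesis using augm2_base[OF cjA[OF assms], of g B] by metis
qed

lemma frag_diff_B: assumes "a \<in> A" "b \<in> A" shows "frag_of a - frag_of b \<in> augm2 A B \<longleftrightarrow> a - b \<in> B"
  using augm2_cong[OF augm2_diff_frag[OF sgA assms, of B]] frag_B[OF subgrp_diff[OF sgA assms]] by simp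

lemma fixed_iff:
  assumes "z \<in> augm A" "g \<in> G" "a \<in> A" "z - (frag_of a - 1) \<in> augm2 A B"
  shows "frag_of g * z - z \<in> augm2 A B \<longleftrightarrow> commu g a \<in> B"
proof -
  have "(frag_of g * z - z) - (frag_of (conjg g a) - frag_of a)
     = frag_of g * (z - (frag_of a - 1)) - (z - (frag_of a - 1)) + (frag_of g * (frag_of a - 1) - (frag_of (conjg g a) - 1))"
    by (simp add: algebra_simps)
  also have "\<dots> \<in> augm2 A B"
    by (intro augm2_add augm2_diff augm2_l assms conjg_frag)
  finally have d: "(frag_of g * z - z) - (frag_of (conjg g a) - frag_of a) \<in> augm2 A B" .
  have "frag_of g * z - z \<in> augm2 A B \<longleftrightarrow> frag_of (conjg g a) - frag_of a \<in> augm2 A B" by (rule augm2_cong[OF d])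
  also have "\<dots> \<longleftrightarrow> conjg g a - a \<in> B" by (rule frag_diff_B[OF cjA[OF assms(2,3)] assms(3)])
  finally show ?thesis by (simp only: commu_conjg)
qed

lemma sum_left_cong:
  assumes "\<And>l. l \<in> L \<Longrightarrow> frag_of l * z - z \<in> augm2 A B"
  shows "(\<Sum>l\<in>L. frag_of l) * z - of_nat (card L) * z \<in> augm2 A B"
proof -
  have "(\<Sum>l\<in>L. frag_of l) * z - of_nat (card L) * z = (\<Sum>l\<in>L. frag_of l * z - z)"
    by (simp add: sum_subtractf sum_distrib_right)
  also have "\<dots> \<in> augm2 A B" using assms unfolding augm2_def by (rule addspan_sum)
  finally show ?thesis .
qed

text \<open>With \<open>z' = sumH z\<close>, an \<open>H\<close>-fixed element of \<open>A/B\<close>, the product \<open>sumT z'\<close> is \<open>|T| z'\<close> because \<open>z'\<close> is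
  even \<open>T\<close>-fixed, and it is \<open>|H| sumT z\<close> because \<open>sumT\<close> absorbs elements of \<open>H\<close>. The difference of the two values
  is \<open>eps z\<close>.\<close>

lemma eps_kill:
  assumes "z \<in> augm A" shows "eps * z \<in> augm2 A B"
proof -
  have hz: "sumH * z \<in> augm A"
    unfolding sumH_def sum_distrib_right using HG by (intro augm_sum augm_l assms) auto
  obtain a where a: "a \<in> A" "sumH * z - (frag_of a - 1) \<in> augm2 A B" using augm_representative[OF sgA hz] by blast
  have "frag_of h * (sumH * z) - sumH * z \<in> augm2 A B" if "h \<in> H" for h
    using absorb[OF sg(1) that] by (simp add: sumH_def mult.assoc[symmetric] augm2_def addspan.zero)
  then have "commu h a \<in> B" if "h \<in> H" for h using fixed_iff[OF hz _ a] that HG by blast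
  then have "commu t a \<in> B" if "t \<in> T" for t using good[OF a(1) _ that] by blast
  then have *: "frag_of t * (sumH * z) - sumH * z \<in> augm2 A B" if "t \<in> T" for t
    using fixed_iff[OF hz _ a] that TG by blast
  have 1: "sumT * (sumH * z) - of_nat (card T) * (sumH * z) \<in> augm2 A B"
    unfolding sumT_def by (rule sum_left_cong) (rule *)
  have tth: "sumT * frag_of h = sumT" if "h \<in> H" for h
  proof -
    have "bij_betw (\<lambda>x. x + h) T T"
      by (rule bij_betwI[of _ _ _ "\<lambda>x. x - h"])
        (use sg(3) that sub in \<open>auto simp: subgrp_add subgrp_diff subsetD\<close>)
    then have "(\<Sum>x\<in>T. frag_of (x + h)) = (\<Sum>x\<in>T. frag_of x)" by (rule sum.reindex_bij_betw)
    then show ?thesis by (simp add: sumT_def sum_distrib_right frag_of_add)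
  qed
  have "sumT * sumH = of_nat (card H) * sumT"
    unfolding sumH_def sum_distrib_left using tth by simp
  then have "sumT * (sumH * z) = of_nat (card H) * (sumT * z)" by (simp add: mult.assoc[symmetric])
  then have "eps * z = - (sumT * (sumH * z) - of_nat (card T) * (sumH * z))"
    by (simp add: eps_def left_diff_distrib mult.assoc)
  then show ?thesis using augm2_minus[OF 1] by simp
qed

lemma int_frag: "a \<in> A \<Longrightarrow> of_nat n * (frag_of a - 1) - (frag_of (mul n a) - 1) \<in> augm2 A B"
proof (induction n)
  case 0 then show ?case by (simp add: augm2_def addspan.zero)
next
  case (Suc n)
  have "of_nat (Suc n) * (frag_of a - 1) - (frag_of (mul (Suc n) a) - 1)
    = (of_nat n * (frag_of a - 1) - (frag_of (mul n a) - 1)) - (frag_of (a + mul n a) - frag_of (mul n a) - frag_of a + 1)"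
    by (simp add: algebra_simps)
  then show ?case using augm2_diff[OF Suc.IH[OF Suc.prems] augm2_base[OF Suc.prems]] by metis
qed

lemma frag_tf: assumes "a \<in> A" "n > 0" "of_nat n * (frag_of a - 1) \<in> augm2 A B" shows "a \<in> B"
proof -
  have "frag_of (mul n a) - 1 \<in> augm2 A B" using augm2_cong[OF int_frag[OF assms(1), of n]] assms(3) by simp
  then show ?thesis using frag_B[OF subgrp_mul[OF sgA assms(1)]] tf[OF assms(1,2)] by blast
qed

lemma augm_sum_mult:
  assumes "a \<in> A" "finite L"
  shows "(frag_of a - 1) * (\<Sum>l\<in>L. frag_of l) - of_nat (card L) * (frag_of a - 1) \<in> augm2 A B"
proof -
  have "(frag_of a - 1) * (\<Sum>l\<in>L. frag_of l) - of_nat (card L) * (frag_of a - 1)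
    = (\<Sum>l\<in>L. frag_of (a + l) - frag_of l - frag_of a + 1)"
    by (simp add: sum.distrib sum_subtractf sum_distrib_left left_diff_distrib frag_of_add algebra_simps)
  also have "\<dots> \<in> augm2 A B" by (intro augm2_sum augm2_base assms)
  finally show ?thesis .
qed

text \<open>Let \<open>tau\<close> be the sum of the transversal \<open>R\<close> of \<open>A\<close>. Left translation permutes the cosets, so
  \<open>omega tau\<close>, a combination of differences of translates of \<open>tau\<close>, lies in \<open>augm A\<close> and is killed by \<open>eps\<close>. Hence
  a multiple of \<open>(a - 1) sumK tau\<close> is zero in \<open>A/B\<close>; but right multiplication by \<open>sumK tau\<close> is multiplication
  by \<open>|K| |R|\<close> there, and \<open>A/B\<close> is torsion-free.\<close>

lemma finite_index_case:
  assumes R: "finite R" "R \<subseteq> G" "R \<noteq> {}" "\<And>g. g \<in> G \<Longrightarrow> \<exists>!r. r \<in> R \<and> g - r \<in> A"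
  shows "A \<subseteq> B"
proof
  fix a assume a: "a \<in> A"
  define tau where "tau = (\<Sum>r\<in>R. frag_of r)"
  \<comment> \<open>the representative in \<open>R\<close> of the coset of \<open>g\<close>\<close>
  define s where "s = (\<lambda>g. THE r. r \<in> R \<and> g - r \<in> A)"
  have s: "s g \<in> R" "g - s g \<in> A" if "g \<in> G" for g
    using theI'[OF R(4)[OF that]] by (auto simp: s_def)
  have s_eq: "r = s g" if "r \<in> R" "g - r \<in> A" "g \<in> G" for r g
    using R(4)[OF that(3)] s[OF that(3)] that by blast
  have tau: "frag_of g * tau - tau \<in> augm A" if g: "g \<in> G" for g
  proof -
    have inj: "inj_on (\<lambda>r. s (g + r)) R"
    proof (rule inj_onI)
      fix r r' assume r: "r \<in> R" "r' \<in> R" and eq: "s (g + r) = s (g + r')"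
      have G: "g + r \<in> G" "g + r' \<in> G" using g r R(2) subgrp_add[OF sgG] by auto
      have "(g + r - s (g + r)) - (g + r' - s (g + r')) \<in> A" using s(2)[OF G(1)] s(2)[OF G(2)] subgrp_diff[OF sgA] by blast
      also have "(g + r - s (g + r)) - (g + r' - s (g + r')) = conjg g (r - r')"
        unfolding eq by (simp add: conjg_def gsimps del: add_uminus_conv_diff)
      finally have "conjg (- g) (conjg g (r - r')) \<in> A" using cjA subgrp_minus[OF sgG g] by blast
      then have "r - r' \<in> A" by simp
      moreover have "r - r \<in> A" using subgrp_0[OF sgA] by simp
      ultimately show "r = r'" using R(4)[of r] r R(2) by blast
    qed
    have "(\<lambda>r. s (g + r)) ` R \<subseteq> R" using s(1) g R(2) subgrp_add[OF sgG] by auto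
    then have "bij_betw (\<lambda>r. s (g + r)) R R"
      using inj R(1) by (simp add: bij_betw_def endo_inj_surj)
    then have "tau = (\<Sum>r\<in>R. frag_of (s (g + r)))" unfolding tau_def by (rule sum.reindex_bij_betw[symmetric])
    moreover have "frag_of g * tau = (\<Sum>r\<in>R. frag_of (g + r))" by (simp add: tau_def sum_distrib_left frag_of_add)
    ultimately have "frag_of g * tau - tau = (\<Sum>r\<in>R. frag_of (g + r) - frag_of (s (g + r)))"
      by (simp only: sum_subtractf)
    also have "\<dots> \<in> augm A"
    proof (rule augm_sum)
      fix r assume "r \<in> R"
      then have "g + r \<in> G" using g R(2) subgrp_add[OF sgG] by auto
      then have "frag_of ((g + r - s (g + r)) + s (g + r)) - frag_of (s (g + r)) \<in> augm A" by (intro augm_base s)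
      then show "frag_of (g + r) - frag_of (s (g + r)) \<in> augm A" by simp
    qed
    finally show ?thesis .
  qed
  have wtau: "omega * tau \<in> augm A"
    unfolding omega_eq_sum_diff sum_distrib_right
  proof (rule augm_sum, clarify)
    fix k t assume "k \<in> K" "t \<in> T"
    then have "(frag_of k * tau - tau) - (frag_of t * tau - tau) \<in> augm A" using KG TG by (intro augm_diff tau) auto
    then show "(frag_of k - frag_of t) * tau \<in> augm A"
      by (simp add: left_diff_distrib)
  qed
  have fbasp: "addspan (augm2 A B) \<subseteq> augm2 A B" unfolding augm2_def by (rule addspan_mono) simp
  define N where "N = card T * card T * card H"
  have map: "z * tau \<in> addspan (augm2 A B)" if "z \<in> addspan {frag_of p * eps * omega |p. p \<in> G}" for z
    using that
  proof (rule addspan_induct_map)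
    fix x assume "x \<in> {frag_of p * eps * omega |p. p \<in> G}"
    then obtain p where p: "x = frag_of p * eps * omega" "p \<in> G" by blast
    have "x * tau = frag_of p * (eps * (omega * tau))" by (simp only: p(1) mult.assoc)
    then have "x * tau \<in> augm2 A B" using augm2_l[OF p(2) eps_kill[OF wtau]] by metis
    then show "x * tau \<in> addspan (augm2 A B)" by (rule addspan.base)
  qed (rule left_diff_distrib)
  have "a \<in> G" using a AG by blast
  then have 1: "of_nat N * (frag_of a - 1) * sumK * tau \<in> augm2 A B"
    using map[OF diff_sumK_in_span, of a] fbasp unfolding N_def by blast
  have fbN: "of_nat n * z \<in> augm2 A B" if "z \<in> augm2 A B" for n z using that unfolding augm2_def by (rule addspan_of_nat)
  have rt: "z * tau \<in> augm2 A B" if "z \<in> augm2 A B" for z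
    unfolding tau_def sum_distrib_left by (intro augm2_sum augm2_right that)
  have "(frag_of a - 1) * sumK * tau - of_nat (card K * card R) * (frag_of a - 1)
     = ((frag_of a - 1) * sumK - of_nat (card K) * (frag_of a - 1)) * tau
      + of_nat (card K) * ((frag_of a - 1) * tau - of_nat (card R) * (frag_of a - 1))"
    by (simp only: left_diff_distrib right_diff_distrib mult.assoc of_nat_mult) simp
  also have "\<dots> \<in> augm2 A B"
    unfolding sumK_def tau_def
    by (intro augm2_add fbN augm_sum_mult rt[unfolded tau_def] a fin R(1))
  finally have "of_nat N * ((frag_of a - 1) * sumK * tau - of_nat (card K * card R) * (frag_of a - 1)) \<in> augm2 A B" by (rule fbN)
  then have "of_nat N * (frag_of a - 1) * sumK * tau - of_nat (N * (card K * card R)) * (frag_of a - 1) \<in> augm2 A B"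
    by (simp only: right_diff_distrib left_diff_distrib mult.assoc of_nat_mult)
  then have "of_nat (N * (card K * card R)) * (frag_of a - 1) \<in> augm2 A B" using 1 augm2_cong by blast
  moreover have "N * (card K * card R) > 0" using card_pos R by (simp add: N_def card_gt_0_iff)
  ultimately show "a \<in> B" using frag_tf[OF a] by blast
qed

end

section \<open>Two-sided operators on the group ring\<close>

text \<open>A list of triples \<open>(r,l,x)\<close> stands for the operator \<open>z \<mapsto> \<Sum> r u\<^sup>l z x\<close>. Since right multiplication is
  trivial on \<open>augm A / augm2 A B\<close>, the operator acts there as left multiplication by its trace \<open>\<Sum> r u\<^sup>l\<close>. Keeping
  \<open>u\<close> on the left and the other factors on the right makes composition as simple as that of polynomials in
  \<open>u\<close>.\<close>

definition apply_op :: "'g::group_add \<Rightarrow> (int \<times> nat \<times> 'g) list \<Rightarrow> 'g gring \<Rightarrow> 'g gring" where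
  "apply_op u L z = (\<Sum>(r,l,x)\<leftarrow>L. of_int r * (frag_of (mul l u) * (z * frag_of x)))"

definition op_trace :: "'g::group_add \<Rightarrow> (int \<times> nat \<times> 'g) list \<Rightarrow> 'g gring" where
  "op_trace u L = (\<Sum>(r,l,x)\<leftarrow>L. of_int r * frag_of (mul l u))"

lemma sum_list_cong: "(\<And>x. x \<in> set xs \<Longrightarrow> f x = g x) \<Longrightarrow> sum_list (map f xs) = sum_list (map g xs)"
  by (simp cong: map_cong)

lemma apply_op_diff: "apply_op u L (x - y) = apply_op u L x - apply_op u L y"
  unfolding apply_op_def by (induction L) (auto simp: right_diff_distrib left_diff_distrib)

lemma apply_op_0 [simp]: "apply_op u L 0 = 0" using apply_op_diff[of u L 0 0] by simp
lemma apply_op_add: "apply_op u L (x + y) = apply_op u L x + apply_op u L y"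
  using apply_op_diff[of u L "x + y" y] by simp
lemma apply_op_sum: "apply_op u L (sum f I) = (\<Sum>i\<in>I. apply_op u L (f i))"
  by (induction I rule: infinite_finite_induct) (simp_all add: apply_op_add)
lemma apply_op_of_nat: "apply_op u L (of_nat n * x) = of_nat n * apply_op u L x"
proof (induction n)
  case (Suc n)
  have "of_nat (Suc n) * x = x + of_nat n * x" by (simp add: distrib_right)
  then show ?case using Suc apply_op_add[of u L x "of_nat n * x"] by (simp add: distrib_right)
qed simp

lemma apply_op_in:
  assumes "\<And>r l x. (r,l,x) \<in> set L \<Longrightarrow> frag_of (mul l u) * (z * frag_of x) \<in> addspan S"
  shows "apply_op u L z \<in> addspan S"
  unfolding apply_op_def
proof (rule addspan_sum_list)
  fix p assume "p \<in> set L"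
  then show "(case p of (r,l,x) \<Rightarrow> of_int r * (frag_of (mul l u) * (z * frag_of x))) \<in> addspan S"
  proof -
    assume "p \<in> set L"
    moreover obtain r l x where "p = (r, l, x)" by (metis prod_cases3)
    ultimately have p: "(r, l, x) \<in> set L" "p = (r, l, x)" by simp_all
    then have "frag_of (mul l u) * (z * frag_of x) \<in> addspan S" by (intro assms) simp
    then show ?thesis using p by (simp add: addspan_of_int)
  qed
qed

definition op_comp :: "(int \<times> nat \<times> 'g) list \<Rightarrow> (int \<times> nat \<times> 'g) list \<Rightarrow> (int \<times> nat \<times> 'g::group_add) list" where
  "op_comp L' L = concat (map (\<lambda>(r',l',x'). map (\<lambda>(r,l,x). (r' * r, l' + l, x + x')) L) L')"

lemma set_op_comp:
  assumes "(s,m,y) \<in> set (op_comp L' L)"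
  obtains r' l' x' r l x where "(r',l',x') \<in> set L'" "(r,l,x) \<in> set L" "s = r' * r" "m = l' + l" "y = x + x'"
proof -
  obtain p' p where "p' \<in> set L'" "p \<in> set L"
    "(s,m,y) = (case p' of (r',l',x') \<Rightarrow> case p of (r,l,x) \<Rightarrow> (r' * r, l' + l, x + x'))"
    using assms by (auto simp: op_comp_def)
  moreover obtain r l x where "p = (r, l, x)" by (metis prod_cases3)
  moreover obtain r' l' x' where "p' = (r', l', x')" by (metis prod_cases3)
  ultimately show thesis using that by simp
qed

lemma sum_list_concat_map: "(\<Sum>p\<leftarrow>concat (map f xs). h p) = (\<Sum>x\<leftarrow>xs. \<Sum>p\<leftarrow>f x. h p)"
  by (induction xs) simp_all

lemma int_left: "x * (of_int n * y) = of_int n * (x * (y::'b::ring_1))"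
  by (simp only: mult.assoc[symmetric] mult_of_int_commute[of n x])

lemma frag_int_left: "frag_of g * (of_int n * y) = of_int n * (frag_of g * (y::'g::group_add gring))"
  by (rule int_left)

lemma apply_op_op_comp: "apply_op u (op_comp L' L) z = apply_op u L' (apply_op u L z)"
proof -
  have 1: "of_int r' * (frag_of (mul l' u) * ((\<Sum>(r,l,x)\<leftarrow>L. of_int r * (frag_of (mul l u) * (z * frag_of x))) * frag_of x'))
     = (\<Sum>(r,l,x)\<leftarrow>L. of_int (r' * r) * (frag_of (mul (l' + l) u) * (z * frag_of (x + x'))))" for r' l' x'
    by (induction L) (auto simp: distrib_left distrib_right mul_add frag_of_add mult.assoc frag_int_left)
  have 2: "(\<Sum>(r,l,x)\<leftarrow>map (\<lambda>(r,l,x). (r' * r, l' + l, x + x')) L. of_int r * (frag_of (mul l u) * (z * frag_of x)))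
     = (\<Sum>(r,l,x)\<leftarrow>L. of_int (r' * r) * (frag_of (mul (l' + l) u) * (z * frag_of (x + x'))))" for r' l' x'
    by (induction L) auto
  show ?thesis unfolding apply_op_def op_comp_def sum_list_concat_map
    by (rule sum_list_cong) (auto simp only: 1 2 split: prod.split)
qed

lemma op_trace_apply_op: "op_trace u L * z = (\<Sum>(r,l,x)\<leftarrow>L. of_int r * (frag_of (mul l u) * z))"
  unfolding op_trace_def by (induction L) (auto simp: distrib_right mult.assoc)

lemma op_trace_op_comp: "op_trace u (op_comp L' L) = op_trace u L' * op_trace u L"
proof -
  have 2: "(\<Sum>(r,l,x)\<leftarrow>map (\<lambda>(r,l,x). (r' * r, l' + l, x + x')) L. of_int r * frag_of (mul l u))
     = of_int r' * (frag_of (mul l' u) * op_trace u L)" for r' l' x'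
    unfolding op_trace_def
    by (induction L) (auto simp: distrib_left mul_add frag_of_add mult.assoc frag_int_left)
  have "op_trace u (op_comp L' L) = (\<Sum>(r,l,x)\<leftarrow>op_comp L' L. of_int r * frag_of (mul l u))" by (rule op_trace_def)
  also have "\<dots> = op_trace u L' * op_trace u L"
    unfolding op_trace_apply_op unfolding op_comp_def sum_list_concat_map
    by (rule sum_list_cong) (auto simp only: 2 split: prod.split)
  finally show ?thesis .
qed

section \<open>Iterated commutators and relative local nilpotence\<close>

text \<open>Iterated commutators \<open>[f\<^sub>1,[f\<^sub>2,\<dots>[f\<^sub>n,f]\<dots>]]\<close> of elements of \<open>F\<close>. For a normal subgroup \<open>A\<close>, \<open>loc_nilp A U\<close> says that
  \<open>U/A\<close> is locally nilpotent: if \<open>F = -F\<close>, the subgroups \<open>comm_series F i\<close> form a descending central series of the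
  subgroup generated by \<open>F\<close>, and it reaches \<open>A\<close>.\<close>

primrec commset :: "'g::group_add set \<Rightarrow> nat \<Rightarrow> 'g set" where
  "commset F 0 = F"
| "commset F (Suc n) = (\<lambda>(f,t). commu f t) ` (F \<times> commset F n)"

definition loc_nilp :: "'g::group_add set \<Rightarrow> 'g set \<Rightarrow> bool" where
  "loc_nilp A U \<longleftrightarrow> (\<forall>F. finite F \<and> F \<subseteq> U \<longrightarrow> (\<exists>n. commset F n \<subseteq> A))"

definition central_chain :: "(nat \<Rightarrow> 'g::group_add set) \<Rightarrow> bool" where
  "central_chain E \<longleftrightarrow> (\<forall>i. subgrp (E i) \<and> E (Suc i) \<subseteq> E i \<and> (\<forall>x\<in>E 0. \<forall>y\<in>E i. commu x y \<in> E (Suc i)))"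

definition comm_series :: "'g::group_add set \<Rightarrow> nat \<Rightarrow> 'g set" where
  "comm_series F i = generated (\<Union>j\<in>{i..}. commset F j)"

lemma central_chain_sub: assumes "central_chain E" "i \<le> j" shows "E j \<subseteq> E i"
  using assms(2) by (induction rule: dec_induct) (use assms(1) in \<open>auto simp: central_chain_def\<close>)

lemma commset_generated: "commset F j \<subseteq> generated F"
proof (induction j)
  case 0 then show ?case by (simp add: generated_subset)
next
  case (Suc j)
  show ?case
  proof clarsimp
    fix f t assume "f \<in> F" "t \<in> commset F j"
    then have "f \<in> generated F" "t \<in> generated F" using Suc by (auto intro: generated.base)
    then show "commu f t \<in> generated F" unfolding commu_def by (intro subgrp_diff[OF generated_subgrp] subgrp_add[OF generated_subgrp])
  qed
qed

lemma comm_series_0: "comm_series F 0 = generated F"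
proof
  show "comm_series F 0 \<subseteq> generated F" unfolding comm_series_def by (rule generated_least) (auto simp: generated_subgrp dest: subsetD[OF commset_generated])
  have "commset F 0 \<subseteq> (\<Union>j\<in>{0..}. commset F j)" by (rule UN_upper) simp
  then have "F \<subseteq> (\<Union>j\<in>{0..}. commset F j)" by simp
  then show "generated F \<subseteq> comm_series F 0" unfolding comm_series_def by (rule generated_mono)
qed

lemma comm_series_subgrp: "subgrp (comm_series F i)" by (simp add: comm_series_def generated_subgrp)
lemma comm_series_antimono: "i \<le> j \<Longrightarrow> comm_series F j \<subseteq> comm_series F i"
  unfolding comm_series_def by (rule generated_mono, rule UN_mono) auto
lemma commset_comm_series: "i \<le> j \<Longrightarrow> commset F j \<subseteq> comm_series F i"
  unfolding comm_series_def by (rule subset_trans[OF _ generated_subset]) auto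

lemma normalizes_mono: "normalizes G A \<Longrightarrow> H \<subseteq> G \<Longrightarrow> normalizes H A" by (auto simp: normalizes_def)

lemma comm_series_normalizes:
  assumes "\<And>f. f \<in> F \<Longrightarrow> - f \<in> F" shows "normalizes (generated F) (comm_series F i)"
proof (rule normalizes_generated[OF _ assms])
  have "conjg f y \<in> comm_series F i" if "f \<in> F" "y \<in> generated (\<Union>j\<in>{i..}. commset F j)" for f y
    using that(2)
  proof induction
    case zero then show ?case using subgrp_0[OF comm_series_subgrp] by simp
  next
    case (base y)
    then obtain j where j: "i \<le> j" "y \<in> commset F j" by auto
    then have "commu f y \<in> commset F (Suc j)" using that(1) by auto
    then have "commu f y + y \<in> comm_series F i" using j commset_comm_series[of i "Suc j" F] commset_comm_series[of i j F]
      by (intro subgrp_add[OF comm_series_subgrp]) auto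
    then show ?case by (simp add: commu_conjg)
  next
    case (diff x y) then show ?case by (simp add: conjg_diff subgrp_diff[OF comm_series_subgrp])
  qed
  then show "normalizes F (comm_series F i)" by (auto simp: normalizes_def comm_series_def)
qed

lemma comm_series_central_chain:
  assumes "\<And>f. f \<in> F \<Longrightarrow> - f \<in> F" shows "central_chain (comm_series F)"
proof -
  have "commu x y \<in> comm_series F (Suc i)" if x: "x \<in> comm_series F 0" and y: "y \<in> comm_series F i" for x y i
  proof -
    have n: "normalizes (comm_series F j) (comm_series F (Suc i))" "normalizes (generated F) (comm_series F (Suc i))" for j
      using comm_series_normalizes[OF assms] normalizes_mono comm_series_antimono[of 0 j F] by (auto simp: comm_series_0)
    have F: "commu f y \<in> comm_series F (Suc i)" if "f \<in> F" for f
    proof -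
      have "generated (\<Union>j\<in>{i..}. commset F j) \<subseteq> {y \<in> comm_series F i. commu f y \<in> comm_series F (Suc i)}"
      proof (rule generated_least)
        show "subgrp {y \<in> comm_series F i. commu f y \<in> comm_series F (Suc i)}" by (rule subgrp_centralizer_mod'[OF comm_series_subgrp comm_series_subgrp n(1)])
        show "(\<Union>j\<in>{i..}. commset F j) \<subseteq> {y \<in> comm_series F i. commu f y \<in> comm_series F (Suc i)}"
        proof clarsimp
          fix j y assume j: "i \<le> j" "y \<in> commset F j"
          then have "commu f y \<in> commset F (Suc j)" using that by auto
          then show "y \<in> comm_series F i \<and> commu f y \<in> comm_series F (Suc i)"
            using j commset_comm_series[of i j F] commset_comm_series[of "Suc i" "Suc j" F] by auto
        qed
      qed
      then show ?thesis using y by (auto simp: comm_series_def)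
    qed
    have "generated F \<subseteq> {x \<in> generated F. commu x y \<in> comm_series F (Suc i)}"
      by (rule generated_least) (use F generated_subset subgrp_centralizer_mod[OF generated_subgrp comm_series_subgrp n(2)] in auto)
    then show ?thesis using x by (auto simp: comm_series_0)
  qed
  then show ?thesis unfolding central_chain_def using comm_series_subgrp comm_series_antimono[of _ "Suc _"] by (metis le_SucI order_refl)
qed

lemma commset_A: assumes "subgrp A" "normalizes F A" "commset F n \<subseteq> A" "n \<le> m" shows "commset F m \<subseteq> A"
  using assms(4)
proof (induction rule: dec_induct)
  case (step m) then show ?case using assms(1,2) by (auto simp: commu_conjg normalizes_def intro!: subgrp_diff)
qed (rule assms(3))

lemma comm_series_A: assumes "subgrp A" "normalizes F A" "commset F n \<subseteq> A" shows "comm_series F n \<subseteq> A"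
  unfolding comm_series_def by (rule generated_least[OF _ assms(1)]) (use commset_A[OF assms] in auto)

section \<open>An Ore condition\<close>

lemma conjg_mul_self [simp]: "conjg (- mul l u) u = u"
proof -
  have "mul l u + u = u + mul l u" by (simp add: mul_comm)
  then have "conjg (mul l u) u = u" by (simp add: conjg_def)
  then show ?thesis by (metis conjg_inv(1))
qed

context good_section begin

lemma apply_op_augm:
  assumes "u \<in> G" "z \<in> augm A" shows "apply_op u L z \<in> augm A"
  using augm_l[OF subgrp_mul[OF sgG assms(1)] augm_right[OF assms(2)]] unfolding augm_def by (intro apply_op_in)
lemma apply_op_augm2:
  assumes "u \<in> G" "z \<in> augm2 A B" shows "apply_op u L z \<in> augm2 A B"
  using augm2_l[OF subgrp_mul[OF sgG assms(1)] augm2_right[OF assms(2)]] unfolding augm2_def by (intro apply_op_in)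

lemma apply_op_on_augm:
  assumes "u \<in> G" "z \<in> augm A" shows "apply_op u L z - op_trace u L * z \<in> augm2 A B"
proof -
  have "apply_op u L z - op_trace u L * z = (\<Sum>(r,l,x)\<leftarrow>L. of_int r * (frag_of (mul l u) * (z * frag_of x - z)))"
    unfolding apply_op_def op_trace_apply_op by (induction L) (auto simp: algebra_simps)
  also have "\<dots> \<in> augm2 A B" unfolding augm2_def
  proof (rule addspan_sum_list)
    fix p assume "p \<in> set L"
    obtain r l x where p: "p = (r,l,x)" by (metis prod_cases3)
    have "frag_of (mul l u) * (z * frag_of x - z) \<in> augm2 A B"
      by (rule augm2_l[OF subgrp_mul[OF sgG assms(1)] augm_right_cong[OF assms(2)]])
    then show "(case p of (r,l,x) \<Rightarrow> of_int r * (frag_of (mul l u) * (z * frag_of x - z)))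
       \<in> addspan ({frag_of (a + g) - frag_of g - frag_of a + 1 |a g. a \<in> A} \<union> {frag_of (b + g) - frag_of g |b g. b \<in> B})"
      unfolding p prod.case augm2_def by (rule addspan_of_int)
  qed
  finally show ?thesis .
qed

text \<open>Left multiplication by \<open>u\<close> sends \<open>g\<close> to \<open>g v\<close> with \<open>v = -g + u + g\<close>, so whether an operator sends \<open>g\<close> into \<open>augm A\<close>
  depends only on \<open>v\<close>. The operators considered are those that do so whenever \<open>v\<close> lies in \<open>W\<close>.\<close>

definition kills where
  "kills u L W \<longleftrightarrow> (\<forall>g\<in>G. conjg (- g) u \<in> W \<longrightarrow> apply_op u L (frag_of g) \<in> augm A)"

text \<open>A common multiple of the factors \<open>z \<mapsto> u z - z v\<close> for the finitely many \<open>v\<close> in \<open>W\<close>, modulo \<open>augm A\<close>. The factor for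
  \<open>v\<close> kills the \<open>g\<close> conjugating \<open>u\<close> to \<open>v\<close>; its trace is \<open>u - 1\<close>. The elements of \<open>W\<close> are treated one after the other.
  If \<open>L\<close> already takes care of \<open>W\<close> and a further \<open>v\<close> is to be added, the right factors \<open>x\<close> in \<open>L\<close> turn \<open>v\<close> into its conjugates
  by \<open>x\<close>. There are finitely many of these and they all lie in one coset of the next term of the central chain, so the
  induction hypothesis for that coset supplies an operator to compose with. At the bottom of the
  chain all of \<open>W\<close> lies in one coset of \<open>A\<close> and a single factor suffices.\<close>

lemma ore_condition:
  assumes E: "central_chain E" "E n \<subseteq> A" "E 0 \<subseteq> G" and u: "u \<in> G"
    and "i \<le> n" "c \<in> E 0" "finite W" "\<And>v. v \<in> W \<Longrightarrow> - c + v \<in> E i"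
  shows "\<exists>L m. (\<forall>(r,l,x)\<in>set L. x \<in> generated (insert c (E i))) \<and> op_trace u L = (frag_of u - 1) ^ m \<and> kills u L W"
  using assms(5-8)
proof (induction i arbitrary: c W rule: inc_induct)
  case base
  let ?L = "[(1,1,0),(-1,0,c)]"
  have "kills u ?L W"
    unfolding kills_def
  proof (intro ballI impI)
    fix g assume g: "g \<in> G" "conjg (- g) u \<in> W"
    have a: "- c + conjg (- g) u \<in> A" using base g(2) E(2) by blast
    have "g + c \<in> G" using g(1) base(1) E(3) subgrp_add[OF sgG] by blast
    then have "frag_of (conjg (g + c) (- c + conjg (- g) u) + (g + c)) - frag_of (g + c) \<in> augm A"
      by (intro augm_base cjA a)
    moreover have "conjg (g + c) (- c + conjg (- g) u) + (g + c) = u + g"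
      by (simp add: conjg_def gsimps del: add_uminus_conv_diff)
    ultimately have "frag_of (u + g) - frag_of (g + c) \<in> augm A" by simp
    then show "apply_op u ?L (frag_of g) \<in> augm A" by (simp add: apply_op_def frag_of_add)
  qed
  moreover have "op_trace u ?L = (frag_of u - 1) ^ 1" by (simp add: op_trace_def)
  moreover have "\<forall>(r,l,x)\<in>set ?L. x \<in> generated (insert c (E n))" by (auto intro: generated.base generated.zero)
  ultimately show ?case by blast
next
  case (step i)
  have sgE: "subgrp (E j)" for j using E(1) by (auto simp: central_chain_def)
  have E0: "E j \<subseteq> E 0" for j using central_chain_sub[OF E(1)] by simp
  have nE: "normalizes (E 0) (E j)" for j
  proof -
    have "conjg x y \<in> E j" if "x \<in> E 0" "y \<in> E j" for x y
    proof -
      have "commu x y \<in> E j" using E(1) that unfolding central_chain_def by blast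
      then have "commu x y + y \<in> E j" using that(2) by (intro subgrp_add[OF sgE])
      then show ?thesis by (simp add: commu_conjg)
    qed
    then show ?thesis by (auto simp: normalizes_def)
  qed
  show ?case using step.prems(2,3)
  proof (induction W rule: finite_induct)
    case empty
    have "kills u [(1,0,0)] {}" by (simp add: kills_def)
    moreover have "op_trace u [(1,0,0)] = (frag_of u - 1) ^ 0" by (simp add: op_trace_def)
    moreover have "\<forall>(r,l,x)\<in>set [(1::int,0::nat,0)]. x \<in> generated (insert c (E i))" by (auto intro: generated.zero)
    ultimately show ?case by blast
  next
    case (insert v W)
    then obtain L m where L: "\<And>r l x. (r,l,x) \<in> set L \<Longrightarrow> x \<in> generated (insert c (E i))"
      "op_trace u L = (frag_of u - 1) ^ m" "kills u L W" by blast
    have wv: "- c + v \<in> E i" using insert.prems by simp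
    have v0: "v \<in> E 0"
    proof -
      have "c + (- c + v) \<in> E 0" by (rule subgrp_add[OF sgE step.prems(1)]) (use wv E0 in auto)
      then show ?thesis by simp
    qed
    have gE: "generated (insert c (E i)) \<subseteq> {x \<in> E 0. commu (- v) x \<in> E (Suc i)}"
    proof (rule generated_least)
      show "subgrp {x \<in> E 0. commu (- v) x \<in> E (Suc i)}" by (rule subgrp_centralizer_mod'[OF sgE sgE nE])
      have "commu (- v) c \<in> E (Suc i)"
      proof -
        have "commu c (- (- c + v)) \<in> E (Suc i)"
          using E(1) step.prems(1) subgrp_minus[OF sgE wv] unfolding central_chain_def by blast
        moreover have "commu (- v) c = - commu c (- (- c + v))"
          by (simp add: commu_def gsimps del: add_uminus_conv_diff)
        ultimately show ?thesis using subgrp_minus[OF sgE] by simp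
      qed
      moreover have "commu (- v) x \<in> E (Suc i)" if "x \<in> E i" for x
        using E(1) subgrp_minus[OF sgE v0] that unfolding central_chain_def by blast
      ultimately show "insert c (E i) \<subseteq> {x \<in> E 0. commu (- v) x \<in> E (Suc i)}"
        using step.prems(1) E0 by auto
    qed
    \<comment> \<open>the conjugates of \<open>v\<close> that the right factors of \<open>L\<close> produce\<close>
    define W' where "W' = (\<lambda>(r,l,x). conjg (- x) v) ` set L"
    have W': "finite W'" "\<And>y. y \<in> W' \<Longrightarrow> - v + y \<in> E (Suc i)"
    proof -
      fix y assume "y \<in> W'"
      then obtain r l x where rlx: "(r,l,x) \<in> set L" "y = conjg (- x) v" by (auto simp: W'_def)
      then have "- x \<in> generated (insert c (E i))" using L(1) subgrp_minus[OF generated_subgrp] by blast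
      then have "commu (- v) (- x) \<in> E (Suc i)" using gE by blast
      then show "- v + y \<in> E (Suc i)"
        by (simp add: rlx commu_def conjg_def gsimps del: add_uminus_conv_diff)
    qed (simp add: W'_def)
    obtain L' m' where L': "\<And>r l x. (r,l,x) \<in> set L' \<Longrightarrow> x \<in> generated (insert v (E (Suc i)))"
      "op_trace u L' = (frag_of u - 1) ^ m'" "kills u L' W'" using step.IH[OF v0 W'] by blast
    have "generated (insert v (E (Suc i))) \<subseteq> generated (insert c (E i))"
    proof (rule generated_least[OF _ generated_subgrp])
      have "c + (- c + v) \<in> generated (insert c (E i))" by (rule subgrp_add[OF generated_subgrp]) (use wv in \<open>auto intro: generated.base\<close>)
      then show "insert v (E (Suc i)) \<subseteq> generated (insert c (E i))"
        using central_chain_sub[OF E(1), of i "Suc i"] by (auto intro: generated.base)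
    qed
    then have "\<forall>(r,l,x)\<in>set (op_comp L' L). x \<in> generated (insert c (E i))"
      using L(1) L'(1) by (auto elim!: set_op_comp intro!: subgrp_add[OF generated_subgrp])
    moreover have "op_trace u (op_comp L' L) = (frag_of u - 1) ^ (m' + m)"
      by (simp add: op_trace_op_comp L L' power_add)
    moreover have "kills u (op_comp L' L) (insert v W)"
      unfolding kills_def apply_op_op_comp
    proof (intro ballI impI)
      fix g assume g: "g \<in> G" "conjg (- g) u \<in> insert v W"
      show "apply_op u L' (apply_op u L (frag_of g)) \<in> augm A"
      proof (cases "conjg (- g) u \<in> W")
        case True
        then show ?thesis using L(3) g(1) by (auto simp: kills_def intro: apply_op_augm[OF u])
      next
        case False
        then have gv: "conjg (- g) u = v" using g(2) by blast
        have "apply_op u L' (frag_of (mul l u + g + x)) \<in> augm A" if "(r,l,x) \<in> set L" for r l x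
        proof -
          have "x \<in> G" using L(1)[OF that] gE E(3) by blast
          then have "mul l u + g + x \<in> G" using g(1) u by (intro subgrp_add[OF sgG] subgrp_mul[OF sgG])
          moreover have "conjg (- (mul l u + g + x)) u = conjg (- x) v"
            by (simp only: minus_add add.assoc conjg_add conjg_mul_self gv)
          moreover have "conjg (- x) v \<in> W'" using that by (force simp: W'_def)
          ultimately show ?thesis using L'(3) by (auto simp: kills_def)
        qed
        then have in_augm: "of_int r * apply_op u L' (frag_of (mul l u + g + x)) \<in> augm A" if "(r,l,x) \<in> set L" for r l x
          using that unfolding augm_def by (intro addspan_of_int)
        have "apply_op u L' (apply_op u L (frag_of g)) = (\<Sum>(r,l,x)\<leftarrow>L. of_int r * apply_op u L' (frag_of (mul l u + g + x)))"
        proof -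
          have ai: "apply_op u L' (of_int r * z) = of_int r * apply_op u L' z" for r z
          proof (cases r rule: int_cases2)
            case (nonneg n) then show ?thesis using apply_op_of_nat[of u L' n z] by simp
          next
            case (nonpos n) then show ?thesis using apply_op_of_nat[of u L' n z] apply_op_diff[of u L' 0 "of_nat n * z"] by simp
          qed
          have "apply_op u L' (\<Sum>(r,l,x)\<leftarrow>xs. of_int r * (frag_of (mul l u) * (frag_of g * frag_of x)))
             = (\<Sum>(r,l,x)\<leftarrow>xs. of_int r * apply_op u L' (frag_of (mul l u + g + x)))" for xs
            by (induction xs) (auto simp: apply_op_add ai frag_of_add mult.assoc)
          then show ?thesis by (simp add: apply_op_def[of u L])
        qed
        also have "\<dots> \<in> augm A"
          unfolding augm_def
        proof (rule addspan_sum_list)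
          fix p assume "p \<in> set L"
          moreover obtain r l x where "p = (r,l,x)" by (metis prod_cases3)
          ultimately show "(case p of (r,l,x) \<Rightarrow> of_int r * apply_op u L' (frag_of (mul l u + g + x)))
             \<in> addspan {frag_of (a + g) - frag_of g |a g. a \<in> A}" using in_augm by (simp add: augm_def)
        qed
        finally show ?thesis .
      qed
    qed
    ultimately show ?case by blast
  qed
qed

end

section \<open>Unipotent action on abelian sections\<close>

lemma addspan_finite:
  assumes "z \<in> addspan (f ` P)" shows "\<exists>P0. finite P0 \<and> P0 \<subseteq> P \<and> z \<in> addspan (f ` P0)"
  using assms
proof induction
  case zero show ?case by (intro exI[of _ "{}"]) (simp add: addspan.zero)
next
  case (base x)
  then obtain p where "p \<in> P" "x = f p" by blast
  then show ?case by (intro exI[of _ "{p}"]) (simp add: addspan.base)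
next
  case (diff x y)
  then obtain P1 P2 where P: "finite P1" "P1 \<subseteq> P" "x \<in> addspan (f ` P1)" "finite P2" "P2 \<subseteq> P" "y \<in> addspan (f ` P2)" by blast
  have "addspan (f ` P1) \<subseteq> addspan (f ` (P1 \<union> P2))" "addspan (f ` P2) \<subseteq> addspan (f ` (P1 \<union> P2))"
    by (intro addspan_mono subsetI addspan.base; blast)+
  then have "x - y \<in> addspan (f ` (P1 \<union> P2))" using P by (intro addspan.diff) blast+
  then show ?case using P by (intro exI[of _ "P1 \<union> P2"]) blast
qed

context good_section begin

text \<open>The pairs \<open>(p,q)\<close> for which all group elements occurring in \<open>p eps q\<close> conjugate \<open>u\<close> into \<open>S\<close>. An
  operator that kills these finitely many conjugates sends \<open>p eps q\<close> into \<open>augm A\<close> (\<open>apply_op_eps\<close>).\<close>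

definition admissible where "admissible u S p q \<longleftrightarrow> p \<in> G \<and> q \<in> G \<and> (\<forall>t\<in>T. conjg (- (p + t + q)) u \<in> S)"

definition adm_span where
  "adm_span u S R = addspan ({frag_of p * eps * frag_of q * (frag_of x - 1) | p q x. admissible u S p q \<and> x \<in> R} \<union> augm2 A B)"

lemma adm_span_base: "admissible u S p q \<Longrightarrow> x \<in> R \<Longrightarrow> frag_of p * eps * frag_of q * (frag_of x - 1) \<in> adm_span u S R"
  unfolding adm_span_def by (rule addspan.base) blast
lemma adm_span_augm2: "z \<in> augm2 A B \<Longrightarrow> z \<in> adm_span u S R"
  unfolding adm_span_def by (rule addspan.base) blast
lemma adm_span_diff: "z \<in> adm_span u S R \<Longrightarrow> y \<in> adm_span u S R \<Longrightarrow> z - y \<in> adm_span u S R"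
  unfolding adm_span_def by (rule addspan.diff)
lemma adm_span_add: "z \<in> adm_span u S R \<Longrightarrow> y \<in> adm_span u S R \<Longrightarrow> z + y \<in> adm_span u S R"
  unfolding adm_span_def by (rule addspan_add)
lemma adm_span_int: "z \<in> adm_span u S R \<Longrightarrow> of_int n * z \<in> adm_span u S R"
  unfolding adm_span_def by (rule addspan_of_int)
lemma adm_span_sum: "(\<And>i. i \<in> I \<Longrightarrow> f i \<in> adm_span u S R) \<Longrightarrow> sum f I \<in> adm_span u S R"
  unfolding adm_span_def by (rule addspan_sum)
lemma adm_span_sum_list:
  assumes "\<And>r l x. (r,l,x) \<in> set L \<Longrightarrow> f l x \<in> adm_span u S R"
  shows "(\<Sum>(r,l,x)\<leftarrow>L. of_int r * f l x) \<in> adm_span u S R"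
  unfolding adm_span_def
proof (rule addspan_sum_list)
  fix p assume "p \<in> set L"
  moreover obtain r l x where "p = (r,l,x)" by (metis prod_cases3)
  ultimately show "(case p of (r,l,x) \<Rightarrow> of_int r * f l x)
     \<in> addspan ({frag_of p * eps * frag_of q * (frag_of x - 1) | p q x. admissible u S p q \<and> x \<in> R} \<union> augm2 A B)"
    using adm_span_int[OF assms] by (simp add: adm_span_def)
qed

lemma admissible_shift:
  assumes "admissible u S p q" "u \<in> G" "normalizes S S" "subgrp S" "S \<subseteq> G" "x \<in> S"
  shows "admissible u S (mul l u + p) (q + x)"
proof -
  have "conjg (- (mul l u + p + t + (q + x))) u \<in> S" if "t \<in> T" for t
  proof -
    have "conjg (- (mul l u + p + t + (q + x))) u = conjg (- x) (conjg (- (p + t + q)) u)"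
      by (simp only: minus_add add.assoc conjg_add conjg_mul_self)
    then show ?thesis using assms that subgrp_minus[OF assms(4,6)] by (auto simp: admissible_def normalizes_def)
  qed
  then show ?thesis using assms by (auto simp: admissible_def intro!: subgrp_add[OF sgG] subgrp_mul[OF sgG])
qed

lemma eps_expand: "frag_of p * eps * frag_of q
   = of_nat (card T) * (\<Sum>h\<in>H. frag_of (p + h + q)) - of_nat (card H) * (\<Sum>t\<in>T. frag_of (p + t + q))"
proof -
  have "frag_of p * (\<Sum>h\<in>L. frag_of h) * frag_of q = (\<Sum>h\<in>L. frag_of (p + h + q))" for L
    by (simp add: sum_distrib_left sum_distrib_right frag_of_add)
  then show ?thesis unfolding eps_def sumH_def sumT_def
    by (simp only: right_diff_distrib left_diff_distrib nat_left) (simp only: mult.assoc)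
qed

lemma apply_op_eps:
  assumes "\<And>t. t \<in> T \<Longrightarrow> apply_op u L (frag_of (p + t + q)) \<in> augm A"
  shows "apply_op u L (frag_of p * eps * frag_of q) \<in> augm A"
proof -
  have n: "of_nat n * z \<in> augm A" if "z \<in> augm A" for n z using that unfolding augm_def by (rule addspan_of_nat)
  show ?thesis unfolding eps_expand apply_op_diff apply_op_of_nat apply_op_sum
    using sub(2) by (intro augm_diff n augm_sum assms) auto
qed

text \<open>Apply \<open>L\<close> to \<open>p eps q (y - 1)\<close> with \<open>y\<close> in \<open>E i\<close>. Moving a right factor \<open>x\<close> of \<open>L\<close> past \<open>y - 1\<close> costs a term with the
  commutator of \<open>x\<close> and \<open>y\<close>, which is one step deeper in the chain. What remains is
  \<open>L (p eps q) (y - 1)\<close>, and this is in \<open>augm2 A B\<close> as soon as \<open>L (p eps q)\<close> is in \<open>augm A\<close>. So finitely many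
  conjugates of \<open>u\<close> have to be killed.\<close>

lemma adm_span_step:
  assumes E: "central_chain E" "E 0 \<subseteq> G" and u: "u \<in> G" and b: "b \<in> adm_span u (E 0) (E i)"
  shows "\<exists>W. finite W \<and> W \<subseteq> E 0 \<and> (\<forall>L. kills u L W \<and> (\<forall>(r,l,x)\<in>set L. x \<in> E 0) \<longrightarrow> apply_op u L b \<in> adm_span u (E 0) (E (Suc i)))"
  using b unfolding adm_span_def[of u "E 0" "E i"]
proof induction
  case zero then show ?case by (intro exI[of _ "{}"]) (simp add: adm_span_def addspan.zero)
next
  case (diff x y)
  from diff.IH obtain W1 W2 where W: "finite W1" "W1 \<subseteq> E 0" "finite W2" "W2 \<subseteq> E 0"
    and W1: "\<And>L. kills u L W1 \<and> (\<forall>(r,l,x)\<in>set L. x \<in> E 0) \<Longrightarrow> apply_op u L x \<in> adm_span u (E 0) (E (Suc i))"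
    and W2: "\<And>L. kills u L W2 \<and> (\<forall>(r,l,x)\<in>set L. x \<in> E 0) \<Longrightarrow> apply_op u L y \<in> adm_span u (E 0) (E (Suc i))"
    by blast
  have "kills u L W1 \<and> kills u L W2" if "kills u L (W1 \<union> W2)" for L using that by (auto simp: kills_def)
  then show ?case using W W1 W2 by (intro exI[of _ "W1 \<union> W2"]) (auto simp: apply_op_diff intro!: adm_span_diff)
next
  case (base b)
  have sgE: "subgrp (E j)" for j using E(1) by (auto simp: central_chain_def)
  have nE: "normalizes (E 0) (E 0)" using sgE[of 0] by (auto simp: normalizes_def conjg_def intro!: subgrp_diff subgrp_add)
  from base show ?case
  proof
    assume "b \<in> augm2 A B"
    then show ?thesis by (intro exI[of _ "{}"]) (auto intro!: adm_span_augm2 apply_op_augm2[OF u])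
  next
    assume "b \<in> {frag_of p * eps * frag_of q * (frag_of x - 1) |p q x. admissible u (E 0) p q \<and> x \<in> E i}"
    then obtain p q xs where b: "b = frag_of p * eps * frag_of q * (frag_of xs - 1)" and ok: "admissible u (E 0) p q" and xs: "xs \<in> E i"
      by blast
    define y where "y = frag_of p * eps * frag_of q"
    define W where "W = (\<lambda>t. conjg (- (p + t + q)) u) ` T"
    have "apply_op u L b \<in> adm_span u (E 0) (E (Suc i))" if L: "kills u L W" "\<forall>(r,l,x)\<in>set L. x \<in> E 0" for L
    proof -
      have "apply_op u L y \<in> augm A"
        unfolding y_def
      proof (rule apply_op_eps)
        fix t assume "t \<in> T"
        moreover have "p + t + q \<in> G" using \<open>t \<in> T\<close> ok TG by (auto simp: admissible_def intro!: subgrp_add[OF sgG])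
        ultimately show "apply_op u L (frag_of (p + t + q)) \<in> augm A" using L(1) by (auto simp: kills_def W_def)
      qed
      then have 1: "apply_op u L y * (frag_of xs - 1) \<in> augm2 A B" by (rule augm_mult_diff)
      define f where "f = (\<lambda>l x. frag_of (mul l u + p) * eps * frag_of (q + (x + xs)) * (frag_of (commu (- xs) (- x)) - 1))"
      have pt: "frag_of (mul l u) * (b * frag_of x) = frag_of (mul l u) * (y * frag_of x) * (frag_of xs - 1) + f l x" for l x
      proof -
        have "x + (xs + commu (- xs) (- x)) = xs + x" by (simp add: commu_def gsimps del: add_uminus_conv_diff)
        then have "frag_of x * (frag_of xs * frag_of (commu (- xs) (- x))) = frag_of xs * frag_of x"
          by (metis frag_of_add)
        then show ?thesis
          unfolding b y_def f_def frag_of_add by (simp add: algebra_simps)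
      qed
      have "apply_op u L b = apply_op u L y * (frag_of xs - 1) + (\<Sum>(r,l,x)\<leftarrow>L. of_int r * f l x)"
        unfolding apply_op_def pt by (induction L) (auto simp: distrib_left distrib_right mult.assoc)
      also have "\<dots> \<in> adm_span u (E 0) (E (Suc i))"
      proof (rule adm_span_add[OF adm_span_augm2[OF 1] adm_span_sum_list])
        fix r l x assume "(r,l,x) \<in> set L"
        then have x: "x \<in> E 0" using L(2) by auto
        have "xs \<in> E 0" using xs central_chain_sub[OF E(1), of 0 i] by auto
        then have "admissible u (E 0) (mul l u + p) (q + (x + xs))"
          using subgrp_add[OF sgE x] by (intro admissible_shift[OF ok u nE sgE E(2)])
        moreover have "commu (- xs) (- x) \<in> E (Suc i)"
        proof -
          have "commu (- x) (- xs) \<in> E (Suc i)" using E(1) subgrp_minus[OF sgE x] subgrp_minus[OF sgE xs] unfolding central_chain_def by blast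
          then show ?thesis using subgrp_minus[OF sgE] commu_minus by metis
        qed
        ultimately show "f l x \<in> adm_span u (E 0) (E (Suc i))" unfolding f_def by (rule adm_span_base)
      qed
      finally show ?thesis .
    qed
    moreover have "finite W" "W \<subseteq> E 0" using fin ok by (auto simp: W_def admissible_def)
    ultimately show ?thesis by blast
  qed
qed

lemma umul_augm: assumes "u \<in> G" "z \<in> augm A" shows "(frag_of u - 1) ^ m * z \<in> augm A"
proof (induction m)
  case (Suc m)
  have "(frag_of u - 1) ^ Suc m * z = frag_of u * ((frag_of u - 1) ^ m * z) - (frag_of u - 1) ^ m * z"
    by (simp add: left_diff_distrib mult.assoc)
  then show ?case using augm_diff[OF augm_l[OF assms(1) Suc] Suc] by metis
qed (simp add: assms)
lemma umul_augm2: assumes "u \<in> G" "z \<in> augm2 A B" shows "(frag_of u - 1) ^ m * z \<in> augm2 A B"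
proof (induction m)
  case (Suc m)
  have "(frag_of u - 1) ^ Suc m * z = frag_of u * ((frag_of u - 1) ^ m * z) - (frag_of u - 1) ^ m * z"
    by (simp add: left_diff_distrib mult.assoc)
  then show ?case using augm2_diff[OF augm2_l[OF assms(1) Suc] Suc] by metis
qed (simp add: assms)

text \<open>Descend along the chain until the right factors \<open>x - 1\<close> have \<open>x\<close> in \<open>A\<close>. Then
  \<open>q (x - 1)\<close> lies in \<open>augm A\<close> and \<open>eps\<close> annihilates it modulo \<open>augm2 A B\<close>. Each step multiplies by a power of
  \<open>u - 1\<close>, the trace of the operator.\<close>

lemma unipotent_on_adm_span:
  assumes E: "central_chain E" "E n \<subseteq> A" "E 0 \<subseteq> G" and u: "u \<in> G"
    and b: "b \<in> adm_span u (E 0) (E 0)" "b \<in> augm A"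
  shows "\<exists>m. (frag_of u - 1) ^ m * b \<in> augm2 A B"
proof -
  have sgE: "subgrp (E j)" for j using E(1) by (auto simp: central_chain_def)
  have "\<exists>m. (frag_of u - 1) ^ m * b \<in> adm_span u (E 0) (E i)" if "i \<le> n" for i
    using that
  proof (induction i)
    case 0 then show ?case using b by (intro exI[of _ 0]) simp
  next
    case (Suc i)
    then obtain m where m: "(frag_of u - 1) ^ m * b \<in> adm_span u (E 0) (E i)" by auto
    from adm_span_step[OF E(1,3) u m] obtain W where W: "finite W" "W \<subseteq> E 0"
      "\<And>L. kills u L W \<Longrightarrow> (\<forall>(r,l,x)\<in>set L. x \<in> E 0) \<Longrightarrow> apply_op u L ((frag_of u - 1) ^ m * b) \<in> adm_span u (E 0) (E (Suc i))" by blast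
    obtain L m' where L: "\<forall>(r,l,x)\<in>set L. x \<in> generated (insert 0 (E 0))" "op_trace u L = (frag_of u - 1) ^ m'" "kills u L W"
      using ore_condition[OF E u, of 0 0 W] W subgrp_0[OF sgE] by auto
    have "generated (insert 0 (E 0)) \<subseteq> E 0" using subgrp_0[OF sgE] by (intro generated_least sgE) auto
    then have 1: "apply_op u L ((frag_of u - 1) ^ m * b) \<in> adm_span u (E 0) (E (Suc i))" using L by (intro W(3)) auto
    have "apply_op u L ((frag_of u - 1) ^ m * b) - (frag_of u - 1) ^ m' * ((frag_of u - 1) ^ m * b) \<in> adm_span u (E 0) (E (Suc i))"
      using adm_span_augm2[OF apply_op_on_augm[OF u umul_augm[OF u b(2)]], of L] by (simp add: L(2))
    from adm_span_diff[OF 1 this] have "(frag_of u - 1) ^ (m' + m) * b \<in> adm_span u (E 0) (E (Suc i))"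
      by (simp add: power_add mult.assoc)
    then show ?case by blast
  qed
  then obtain m where m: "(frag_of u - 1) ^ m * b \<in> adm_span u (E 0) (E n)" by blast
  have "adm_span u (E 0) (E n) \<subseteq> addspan (augm2 A B)"
    unfolding adm_span_def
  proof (rule addspan_mono, rule subsetI, erule UnE)
    fix z assume "z \<in> {frag_of p * eps * frag_of q * (frag_of x - 1) |p q x. admissible u (E 0) p q \<and> x \<in> E n}"
    then obtain p q x where z: "z = frag_of p * eps * frag_of q * (frag_of x - 1)" "p \<in> G" "q \<in> G" "x \<in> A"
      using E(2) by (auto simp: admissible_def)
    have "frag_of q * (frag_of x - 1) = frag_of (conjg q x + q) - frag_of q"
      unfolding frag_of_add frag_of_conjg[symmetric] by (simp add: right_diff_distrib)
    then have "frag_of q * (frag_of x - 1) \<in> augm A" using augm_base[OF cjA[OF z(3,4)]] by metis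
    then have "frag_of p * (eps * (frag_of q * (frag_of x - 1))) \<in> augm2 A B" by (intro augm2_l z eps_kill)
    then show "z \<in> addspan (augm2 A B)" unfolding z by (intro addspan.base) (simp only: mult.assoc)
  qed (rule addspan.base)
  also have "addspan (augm2 A B) \<subseteq> augm2 A B" unfolding augm2_def by (rule addspan_mono) simp
  finally show ?thesis using m by blast
qed

end

context good_section begin

lemma generated_conjg:
  assumes "\<And>x. x \<in> S \<Longrightarrow> conjg g x \<in> R" "x \<in> generated S" shows "conjg g x \<in> generated R"
  using assms(2)
  by induction (auto simp: conjg_diff intro: generated.intros assms(1))

lemma KT_uminus: "q \<in> K \<union> T \<Longrightarrow> - q \<in> K \<union> T" using sg by (auto intro: subgrp_minus)

text \<open>The reduction to \<open>adm_span\<close>. As \<open>omega\<close> is a sum of differences \<open>k - t\<close>, an operator \<open>L\<close> applied to \<open>p eps omega\<close> gives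
  differences of elements \<open>L (p eps q)\<close> with \<open>q\<close> in \<open>K \<union> T\<close>. Choose \<open>L\<close> so that these are in \<open>augm A\<close>. Modulo
  \<open>augm2 A B\<close> the factor \<open>q\<close> can then be moved across the right factors \<open>x\<close> of \<open>L\<close> at the price of conjugating them, so
  \<open>L (p eps q)\<close> equals \<open>trace L (p eps)\<close> up to terms \<open>p' eps (q x q\<^sup>-\<^sup>1 - 1)\<close>, which are in \<open>adm_span\<close>. The term
  independent of \<open>q\<close> cancels in the differences.\<close>

lemma unipotent_on_span:
  assumes U: "subgrp U" "normalizes G U" "U \<subseteq> G" "loc_nilp A U" and u: "u \<in> U"
    and c: "c \<in> addspan {frag_of p * eps * omega |p. p \<in> G}" "c \<in> augm A"
  shows "\<exists>m. (frag_of u - 1) ^ m * c \<in> augm2 A B"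
proof -
  have uG: "u \<in> G" using u U by blast
  have set_eq: "{frag_of p * eps * omega |p. p \<in> G} = (\<lambda>p. frag_of p * eps * omega) ` G" by blast
  obtain P where P: "finite P" "P \<subseteq> G" "c \<in> addspan ((\<lambda>p. frag_of p * eps * omega) ` P)"
    using addspan_finite[of c "\<lambda>p. frag_of p * eps * omega" G] c(1) unfolding set_eq by blast
  define Q where "Q = K \<union> T"
  have Q: "finite Q" "Q \<subseteq> G" "0 \<in> Q" using fin KG TG subgrp_0[OF sg(2)] by (auto simp: Q_def)
  have Qm: "- q \<in> Q" if "q \<in> Q" for q using that KT_uminus by (simp add: Q_def)
  have PG: "p + t + q \<in> G" if "p \<in> P" "t \<in> T" "q \<in> G" for p t q
    using that P TG by (auto intro!: subgrp_add[OF sgG])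
  define W where "W = (\<lambda>(p,t,q). conjg (- (p + t + q)) u) ` (P \<times> T \<times> Q)"
  define W' where "W' = W \<union> uminus ` W"
  \<comment> \<open>one more factor \<open>q'\<close> than in \<open>W\<close>: conjugates of elements of \<open>W\<close> by elements of \<open>Q\<close> are to lie in \<open>F\<close>\<close>
  define F where "F = (\<lambda>(p,t,q,q'). conjg (- (p + t + q + q')) u) ` (P \<times> T \<times> Q \<times> Q)"
  define F' where "F' = F \<union> uminus ` F"
  have WU: "W \<subseteq> U"
    using U(2) u PG Q(2) subgrp_minus[OF sgG] unfolding W_def normalizes_def by force
  then have W'U: "W' \<subseteq> U" unfolding W'_def using subgrp_minus[OF U(1)] by blast
  have FU: "F \<subseteq> U"
  proof -
    have "conjg (- (p + t + q + q')) u \<in> U" if "p \<in> P" "t \<in> T" "q \<in> Q" "q' \<in> Q" for p t q q'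
    proof -
      have "p + t + q + q' \<in> G" by (rule subgrp_add[OF sgG PG[OF that(1,2)]]) (use Q(2) that in auto)
      then show ?thesis using U(2) u subgrp_minus[OF sgG] unfolding normalizes_def by blast
    qed
    then show ?thesis by (auto simp: F_def)
  qed
  then have F'U: "F' \<subseteq> U" unfolding F'_def using subgrp_minus[OF U(1)] by blast
  have fin: "finite W'" "finite F'" using P(1) Q(1) fin by (simp_all add: W'_def W_def F'_def F_def)
  have symW: "- f \<in> W'" if "f \<in> W'" for f using that by (auto simp: W'_def)
  have symF: "- f \<in> F'" if "f \<in> F'" for f using that by (auto simp: F'_def)
  obtain n where n: "commset W' n \<subseteq> A" using U(4) fin W'U unfolding loc_nilp_def by blast
  obtain n' where n': "commset F' n' \<subseteq> A" using U(4) fin F'U unfolding loc_nilp_def by blast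
  have nrmU: "normalizes S A" if "S \<subseteq> U" for S using nA that U(3) by (auto simp: normalizes_def)
  have genU: "generated S \<subseteq> G" if "S \<subseteq> U" for S using generated_least[OF that U(1)] U(3) by blast
  have EW: "central_chain (comm_series W')" "comm_series W' n \<subseteq> A" "comm_series W' 0 \<subseteq> G"
    using comm_series_central_chain[OF symW] comm_series_A[OF sgA nrmU[OF W'U] n] genU[OF W'U] by (simp_all add: comm_series_0)
  have EF: "central_chain (comm_series F')" "comm_series F' n' \<subseteq> A" "comm_series F' 0 \<subseteq> G"
    using comm_series_central_chain[OF symF] comm_series_A[OF sgA nrmU[OF F'U] n'] genU[OF F'U] by (simp_all add: comm_series_0)
  have "\<exists>L m. (\<forall>(r,l,x)\<in>set L. x \<in> generated (insert 0 (comm_series W' 0))) \<and> op_trace u L = (frag_of u - 1) ^ m \<and> kills u L W"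
  proof (rule ore_condition[OF EW uG])
    show "0 \<in> comm_series W' 0" using subgrp_0[OF comm_series_subgrp] .
    show "finite W" using fin by (simp add: W'_def)
    show "- 0 + v \<in> comm_series W' 0" if "v \<in> W" for v using that by (auto simp: comm_series_0 W'_def intro: generated.base)
  qed simp
  then obtain L m where L0: "\<forall>(r,l,x)\<in>set L. x \<in> generated (insert 0 (comm_series W' 0))" "op_trace u L = (frag_of u - 1) ^ m" "kills u L W"
    by blast
  have "generated (insert 0 (comm_series W' 0)) \<subseteq> generated W'"
    unfolding comm_series_0 by (intro generated_least generated_subgrp) (auto intro: generated.zero)
  then have L: "x \<in> generated W'" if "(r,l,x) \<in> set L" for r l x using L0(1) that by blast
  have conjW: "conjg q x \<in> generated F'" if "q \<in> Q" "x \<in> generated W'" for q x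
  proof (rule generated_conjg[OF _ that(2)])
    have *: "conjg q y \<in> F" if y: "y \<in> W" for y
    proof -
      obtain p t q' where p: "p \<in> P" "t \<in> T" "q' \<in> Q" "y = conjg (- (p + t + q')) u" using y by (auto simp: W_def)
      have "conjg q y = conjg (- (p + t + q' + - q)) u" unfolding p(4) by (simp only: minus_add[of "p + t + q'" "- q"] minus_minus conjg_add)
      then show ?thesis unfolding F_def using p Qm[OF \<open>q \<in> Q\<close>] by force
    qed
    show "conjg q y \<in> F'" if y: "y \<in> W'" for y
      using y * unfolding W'_def F'_def by (auto simp: conjg_uminus)
  qed
  let ?E = "generated F'"
  have key: "apply_op u L (frag_of p * eps * frag_of q) - op_trace u L * (frag_of p * eps) \<in> adm_span u ?E ?E"
    if p: "p \<in> P" and q: "q \<in> Q" for p q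
  proof -
    have mem: "apply_op u L (frag_of p * eps * frag_of q) \<in> augm A"
    proof (rule apply_op_eps)
      fix t assume t: "t \<in> T"
      then have "conjg (- (p + t + q)) u \<in> W" using p q by (force simp: W_def)
      then show "apply_op u L (frag_of (p + t + q)) \<in> augm A" using L0(3) PG[OF p t] Q(2) q by (auto simp: kills_def)
    qed
    define y where "y = apply_op u L (frag_of p * eps * frag_of q) * frag_of (- q)"
    have y: "y \<in> augm A" unfolding y_def by (rule augm_right[OF mem])
    have yq: "y * frag_of q = apply_op u L (frag_of p * eps * frag_of q)"
      unfolding y_def by (simp only: mult.assoc flip: frag_of_add) simp
    have "y = (\<Sum>(r,l,x)\<leftarrow>L. of_int r * (frag_of (mul l u) * (frag_of p * eps * frag_of (conjg q x))))"
    proof -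
      have "frag_of q * (frag_of x * frag_of (- q)) = frag_of (conjg q x)" for x
      proof -
        have "q + (x + - q) = conjg q x" by (simp only: conjg_def diff_conv_add_uminus add.assoc)
        then show ?thesis by (metis frag_of_add)
      qed
      then show ?thesis unfolding y_def apply_op_def by (induction L) (auto simp: distrib_right mult.assoc)
    qed
    then have "y - op_trace u L * (frag_of p * eps)
       = (\<Sum>(r,l,x)\<leftarrow>L. of_int r * (frag_of (mul l u + p) * eps * frag_of 0 * (frag_of (conjg q x) - 1)))"
      unfolding op_trace_apply_op by (induction L arbitrary: y) (auto simp: frag_of_add algebra_simps)
    also have "\<dots> \<in> adm_span u ?E ?E"
    proof (rule adm_span_sum_list)
      fix r l x assume rlx: "(r,l,x) \<in> set L"
      have "admissible u ?E p 0"
        unfolding admissible_def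
      proof (intro conjI ballI)
        fix t assume t: "t \<in> T"
        have "conjg (- (p + t + 0 + 0)) u \<in> F" unfolding F_def using p t Q(3) by force
        then show "conjg (- (p + t + 0)) u \<in> generated F'" by (auto simp: F'_def intro: generated.base)
      qed (use p P(2) subgrp_0[OF sgG] in auto)
      then have "admissible u ?E (mul l u + p) (0 + 0)"
        using subgrp_0[OF generated_subgrp, of F'] genU[OF F'U] uG generated_subgrp
        by (intro admissible_shift) (auto simp: normalizes_def conjg_def intro!: subgrp_diff subgrp_add)
      then show "frag_of (mul l u + p) * eps * frag_of 0 * (frag_of (conjg q x) - 1) \<in> adm_span u ?E ?E"
        using conjW[OF q L[OF rlx]] by (intro adm_span_base) simp_all
    qed
    finally have "y - op_trace u L * (frag_of p * eps) \<in> adm_span u ?E ?E" .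
    moreover have "y * frag_of q - y \<in> adm_span u ?E ?E" by (rule adm_span_augm2[OF augm_right_cong[OF y]])
    ultimately have "(y * frag_of q - y) + (y - op_trace u L * (frag_of p * eps)) \<in> adm_span u ?E ?E" by (intro adm_span_add)
    then show ?thesis by (simp add: yq)
  qed
  have actP: "apply_op u L (frag_of p * eps * omega) \<in> adm_span u ?E ?E" if p: "p \<in> P" for p
  proof -
    have "apply_op u L (frag_of p * eps * omega) = (\<Sum>(k,t)\<in>K \<times> T. apply_op u L (frag_of p * eps * frag_of k) - apply_op u L (frag_of p * eps * frag_of t))"
      unfolding omega_eq_sum_diff sum_distrib_left apply_op_sum by (rule sum.cong) (auto simp: right_diff_distrib apply_op_diff)
    also have "\<dots> \<in> adm_span u ?E ?E"
    proof (rule adm_span_sum, clarify)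
      fix k t assume "k \<in> K" "t \<in> T"
      then have "(apply_op u L (frag_of p * eps * frag_of k) - op_trace u L * (frag_of p * eps)) - (apply_op u L (frag_of p * eps * frag_of t) - op_trace u L * (frag_of p * eps)) \<in> adm_span u ?E ?E"
        by (intro adm_span_diff key p) (auto simp: Q_def)
      then show "apply_op u L (frag_of p * eps * frag_of k) - apply_op u L (frag_of p * eps * frag_of t) \<in> adm_span u ?E ?E" by simp
    qed
    finally show ?thesis .
  qed
  have "apply_op u L c \<in> addspan (adm_span u ?E ?E)"
    using P(3)
  proof (rule addspan_induct_map)
    fix x assume "x \<in> (\<lambda>p. frag_of p * eps * omega) ` P"
    then show "apply_op u L x \<in> addspan (adm_span u ?E ?E)" using actP by (auto intro: addspan.base)
  qed (rule apply_op_diff)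
  moreover have "addspan (adm_span u ?E ?E) \<subseteq> adm_span u ?E ?E" unfolding adm_span_def by (rule addspan_mono) simp
  ultimately have 1: "apply_op u L c \<in> adm_span u ?E ?E" by blast
  have "apply_op u L c - (frag_of u - 1) ^ m * c \<in> adm_span u ?E ?E"
    using adm_span_augm2[OF apply_op_on_augm[OF uG c(2)], of L] by (simp add: L0(2))
  from adm_span_diff[OF 1 this] have "(frag_of u - 1) ^ m * c \<in> adm_span u ?E ?E" by simp
  then have "\<exists>m'. (frag_of u - 1) ^ m' * ((frag_of u - 1) ^ m * c) \<in> augm2 A B"
    using unipotent_on_adm_span[OF EF uG] umul_augm[OF uG c(2)] unfolding comm_series_0 by blast
  then obtain m' where "(frag_of u - 1) ^ m' * ((frag_of u - 1) ^ m * c) \<in> augm2 A B" by blast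
  then have "(frag_of u - 1) ^ (m' + m) * c \<in> augm2 A B" by (simp only: power_add mult.assoc)
  then show ?thesis by blast
qed

text \<open>Up to the factor \<open>|K|\<close>, which is harmless because \<open>A/B\<close> is torsion-free, a multiple of \<open>a - 1\<close> equals a multiple
  of \<open>(a - 1) sumK\<close> in \<open>A/B\<close>, and that lies in the span of the \<open>p eps omega\<close>.\<close>

theorem unipotent:
  assumes U: "subgrp U" "normalizes G U" "U \<subseteq> G" "loc_nilp A U" and u: "u \<in> U" and a: "a \<in> A"
  shows "\<exists>m. (commu u ^^ m) a \<in> B"
proof -
  have uG: "u \<in> G" using u U by blast
  have aG: "a \<in> G" using a AG by blast
  define N where "N = card T * card T * card H"
  define c where "c = of_nat N * (frag_of a - 1) * sumK"
  have n: "of_nat n * z \<in> augm A" if "z \<in> augm A" for n z using that unfolding augm_def by (rule addspan_of_nat)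
  have fbn: "of_nat n * z \<in> augm2 A B" if "z \<in> augm2 A B" for n z using that unfolding augm2_def by (rule addspan_of_nat)
  have "(frag_of a - 1) * sumK = (\<Sum>k\<in>K. frag_of (a + k) - frag_of k)"
    by (simp add: sumK_def sum_distrib_left left_diff_distrib frag_of_add sum_subtractf)
  also have "\<dots> \<in> augm A" by (intro augm_sum augm_base a)
  finally have cfa: "c \<in> augm A" unfolding c_def by (simp add: mult.assoc n)
  obtain m where m: "(frag_of u - 1) ^ m * c \<in> augm2 A B"
    using unipotent_on_span[OF U u _ cfa] diff_sumK_in_span[OF aG] unfolding c_def N_def by blast
  have ca: "c - of_nat (N * card K) * (frag_of a - 1) \<in> augm2 A B"
  proof -
    have "of_nat N * ((frag_of a - 1) * sumK - of_nat (card K) * (frag_of a - 1)) \<in> augm2 A B"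
      unfolding sumK_def by (intro fbn augm_sum_mult a fin)
    then show ?thesis by (simp only: c_def right_diff_distrib left_diff_distrib mult.assoc of_nat_mult)
  qed
  have ad: "(commu u ^^ i) a \<in> A" for i
    by (induction i) (auto simp: a commu_conjg intro: subgrp_diff[OF sgA] cjA[OF uG])
  have adm: "(frag_of u - 1) ^ i * (frag_of a - 1) - (frag_of ((commu u ^^ i) a) - 1) \<in> augm2 A B" for i
  proof (induction i)
    case 0 then show ?case by (simp add: augm2_0)
  next
    case (Suc i)
    let ?b = "(commu u ^^ i) a"
    have 1: "(frag_of u - 1) ^ 1 * ((frag_of u - 1) ^ i * (frag_of a - 1) - (frag_of ?b - 1)) \<in> augm2 A B"
      by (rule umul_augm2[OF uG Suc])
    have 2: "frag_of u * (frag_of ?b - 1) - (frag_of (conjg u ?b) - 1) \<in> augm2 A B" by (rule conjg_frag[OF uG ad])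
    have 3: "(frag_of (conjg u ?b) - frag_of ?b) - (frag_of (conjg u ?b - ?b) - 1) \<in> augm2 A B"
      by (rule augm2_diff_frag[OF sgA cjA[OF uG ad] ad])
    have "(frag_of u - 1) ^ Suc i * (frag_of a - 1) - (frag_of ((commu u ^^ Suc i) a) - 1)
      = (frag_of u - 1) ^ 1 * ((frag_of u - 1) ^ i * (frag_of a - 1) - (frag_of ?b - 1))
       + (frag_of u * (frag_of ?b - 1) - (frag_of (conjg u ?b) - 1))
       + ((frag_of (conjg u ?b) - frag_of ?b) - (frag_of (conjg u ?b - ?b) - 1))"
      by (simp add: commu_conjg algebra_simps)
    then show ?case using augm2_add[OF augm2_add[OF 1 2] 3] by metis
  qed
  have M: "(frag_of u - 1) ^ m * (c - of_nat (N * card K) * (frag_of a - 1)) \<in> augm2 A B" by (rule umul_augm2[OF uG ca])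
  have "of_nat (N * card K) * ((frag_of u - 1) ^ m * (frag_of a - 1))
     = (frag_of u - 1) ^ m * c - (frag_of u - 1) ^ m * (c - of_nat (N * card K) * (frag_of a - 1))"
    by (simp only: right_diff_distrib nat_left) simp
  then have 4: "of_nat (N * card K) * ((frag_of u - 1) ^ m * (frag_of a - 1)) \<in> augm2 A B"
    using augm2_diff[OF m M] by metis
  have 5: "of_nat (N * card K) * ((frag_of u - 1) ^ m * (frag_of a - 1) - (frag_of ((commu u ^^ m) a) - 1)) \<in> augm2 A B"
    by (intro fbn adm)
  have "of_nat (N * card K) * (frag_of ((commu u ^^ m) a) - 1) \<in> augm2 A B"
    using augm2_diff[OF 4 5] by (simp only: right_diff_distrib) simp
  moreover have "N * card K > 0" using card_pos by (simp add: N_def)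
  ultimately show ?thesis using frag_tf[OF ad] by blast
qed

end

section \<open>Congruence modulo a normal subgroup\<close>

text \<open>Equality in the quotient \<open>R/Y\<close>, expressed as \<open>x - y \<in> Y\<close>.\<close>

locale cong =
  fixes R Y :: "'g::group_add set"
  assumes R: "subgrp R" and Y: "subgrp Y" and YR: "Y \<subseteq> R" and nY: "normalizes R Y"
begin

lemma cjY: "x \<in> R \<Longrightarrow> y \<in> Y \<Longrightarrow> conjg x y \<in> Y" using nY by (auto simp: normalizes_def)

lemma refl: "x - x \<in> Y" using subgrp_0[OF Y] by simp
lemma sym: "x - y \<in> Y \<Longrightarrow> y - x \<in> Y" using subgrp_minus[OF Y, of "x - y"] by simp
lemma trans: "x - y \<in> Y \<Longrightarrow> y - z \<in> Y \<Longrightarrow> x - z \<in> Y"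
  using subgrp_add[OF Y, of "x - y" "y - z"] by (simp add: gsimps del: add_uminus_conv_diff)
lemma add: assumes "x - x' \<in> Y" "y - y' \<in> Y" "x \<in> R" shows "(x + y) - (x' + y') \<in> Y"
proof -
  have "(x + y) - (x' + y') = conjg x (y - y') + (x - x')"
    by (simp add: conjg_def gsimps del: add_uminus_conv_diff)
  then show ?thesis using subgrp_add[OF Y cjY[OF assms(3,2)] assms(1)] by simp
qed
lemma commu_iff: "commu x y \<in> Y \<longleftrightarrow> (x + y) - (y + x) \<in> Y"
  by (simp add: commu_def gsimps del: add_uminus_conv_diff)
lemma mul_cong: assumes "x - y \<in> Y" "x \<in> R" shows "mul n x - mul n y \<in> Y"
proof (induction n)
  case 0 show ?case using subgrp_0[OF Y] by simp
next
  case (Suc n) show ?case unfolding mul.simps by (rule add[OF assms(1) Suc assms(2)])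
qed
lemma mul_comm_mod:
  assumes "commu x y \<in> Y" "x \<in> R" "y \<in> R" shows "(mul n x + y) - (y + mul n x) \<in> Y"
proof (induction n)
  case 0 show ?case using subgrp_0[OF Y] by simp
next
  case (Suc n)
  have 1: "(x + (mul n x + y)) - (x + (y + mul n x)) \<in> Y" by (rule add[OF refl Suc assms(2)])
  have 2: "((x + y) + mul n x) - ((y + x) + mul n x) \<in> Y"
    using assms(1) by (intro add[OF _ refl] subgrp_add[OF R] assms) (simp add: commu_iff)
  show ?case using trans[OF 1, of "(y + x) + mul n x"] 2 by (simp add: add.assoc)
qed
lemma mul_add_mod:
  assumes "commu x y \<in> Y" "x \<in> R" "y \<in> R" shows "mul n (x + y) - (mul n x + mul n y) \<in> Y"
proof (induction n)
  case 0 show ?case using subgrp_0[OF Y] by simp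
next
  case (Suc n)
  have 1: "((x + y) + mul n (x + y)) - ((x + y) + (mul n x + mul n y)) \<in> Y"
    by (rule add[OF refl Suc subgrp_add[OF R assms(2,3)]])
  have 2: "(x + ((y + mul n x) + mul n y)) - (x + ((mul n x + y) + mul n y)) \<in> Y"
    by (rule add[OF refl add[OF sym[OF mul_comm_mod[OF assms]] refl] assms(2)])
      (intro subgrp_add[OF R] subgrp_mul[OF R] assms)
  show ?case using trans[OF 1, of "x + ((mul n x + y) + mul n y)"] 2 by (simp add: add.assoc)
qed

end

text \<open>Let \<open>E\<close> be the lower central chain of the subgroup generated by \<open>a\<close> and \<open>b\<close>. If \<open>a\<close> and \<open>b\<close> agree modulo \<open>E i\<close>, then
  \<open>a\<close> and its conjugate by \<open>b\<close> agree modulo \<open>E (i + 1)\<close>; they also have the same \<open>n\<close>-th multiple modulo \<open>Y\<close>. By downward induction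
  on \<open>i\<close> they agree modulo \<open>Y\<close>, so \<open>a\<close> and \<open>b\<close> commute there and \<open>n (a - b)\<close> is zero.\<close>

lemma unique_roots:
  assumes Mh: "subgrp M" and Yh: "subgrp Y" "Y \<subseteq> M" "normalizes M Y" and loc_nilp: "loc_nilp Y M"
    and isolated: "\<And>x n. x \<in> M \<Longrightarrow> n > 0 \<Longrightarrow> mul n x \<in> Y \<Longrightarrow> x \<in> Y"
    and ab: "a \<in> M" "b \<in> M" "n > 0" "mul n a - mul n b \<in> Y"
  shows "a - b \<in> Y"
proof -
  interpret cong M Y using Mh Yh by unfold_locales
  define F where "F = {a, b, - a, - b}"
  have FX: "F \<subseteq> M" using ab subgrp_minus[OF Mh] by (auto simp: F_def)
  obtain k where k: "commset F k \<subseteq> Y"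
  proof -
    have "finite F" by (simp add: F_def)
    then show ?thesis using loc_nilp FX that unfolding loc_nilp_def by blast
  qed
  have symF: "- f \<in> F" if "f \<in> F" for f using that by (auto simp: F_def)
  have ch: "central_chain (comm_series F)" by (rule comm_series_central_chain[OF symF])
  have Ek: "comm_series F k \<subseteq> Y" using comm_series_A[OF Yh(1) _ k] normalizes_mono[OF Yh(3) FX] by blast
  have EX: "comm_series F 0 \<subseteq> M" using generated_least[OF FX Mh] by (simp add: comm_series_0)
  have "a - b \<in> Y" if "i \<le> k" "a \<in> comm_series F 0" "b \<in> comm_series F 0" "a - b \<in> comm_series F i" "mul n a - mul n b \<in> Y" for i a b
    using that
  proof (induction i arbitrary: a b rule: inc_induct)
    case base then show ?case using Ek by blast
  next
    case (step i)
    have aX: "a \<in> M" "b \<in> M" using step.prems EX by auto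
    have "commu b (a - b) \<in> comm_series F (Suc i)" using ch step.prems unfolding central_chain_def by blast
    then have 1: "conjg b a - a \<in> comm_series F (Suc i)"
      by (simp add: commu_def conjg_def gsimps del: add_uminus_conv_diff)
    have cja: "conjg b a \<in> comm_series F 0" using step.prems unfolding conjg_def by (intro subgrp_diff[OF comm_series_subgrp] subgrp_add[OF comm_series_subgrp])
    have cb: "conjg b (mul n b) = mul n b" by (simp only: conjg_def mul_comm) simp
    have "conjg b (mul n a - mul n b) - (mul n a - mul n b) \<in> Y"
      using cjY[OF aX(2) step.prems(4)] step.prems(4) by (rule subgrp_diff[OF Yh(1)])
    moreover have "conjg b (mul n a - mul n b) - (mul n a - mul n b) = mul n (conjg b a) - mul n a"
      unfolding conjg_mul[symmetric] conjg_diff cb by (simp add: gsimps del: add_uminus_conv_diff)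
    ultimately have 2: "mul n (conjg b a) - mul n a \<in> Y" by simp
    have "conjg b a - a \<in> Y" by (rule step.IH[OF cja step.prems(1) 1 2])
    then have commu: "commu b a \<in> Y" by (simp add: commu_conjg)
    have "mul n (a - b + b) - (mul n (a - b) + mul n b) \<in> Y"
    proof (rule mul_add_mod)
      have "commu (a - b) b = - commu b a" by (simp add: commu_def gsimps del: add_uminus_conv_diff)
      then show "commu (a - b) b \<in> Y" using subgrp_minus[OF Yh(1) commu] by simp
    qed (use aX subgrp_diff[OF Mh] in auto)
    then have "mul n a - (mul n (a - b) + mul n b) \<in> Y" by simp
    then have "(mul n (a - b) + mul n b) - mul n a \<in> Y" by (rule sym)
    then have "(mul n (a - b) + mul n b) - mul n b \<in> Y" using step.prems(4) by (rule trans)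
    then have "mul n (a - b) \<in> Y" by simp
    then show ?case by (rule isolated[OF subgrp_diff[OF Mh aX] ab(3)])
  qed
  note * = this
  have 0: "a \<in> comm_series F 0" "b \<in> comm_series F 0" unfolding comm_series_0 by (rule generated.base, simp add: F_def)+
  show ?thesis by (rule *[OF le0 0 subgrp_diff[OF comm_series_subgrp 0] ab(4)])
qed

section \<open>From unipotent action to local nilpotence\<close>

lemma loc_nilp_mono: assumes "loc_nilp A M" "A \<subseteq> B" shows "loc_nilp B M"
  unfolding loc_nilp_def
proof (intro allI impI)
  fix F assume "finite F \<and> F \<subseteq> M"
  then obtain n where "commset F n \<subseteq> A" using assms(1) unfolding loc_nilp_def by blast
  then show "\<exists>n. commset F n \<subseteq> B" using assms(2) by (meson subset_trans)
qed
lemma commset_mono: "F \<subseteq> F' \<Longrightarrow> commset F n \<subseteq> commset F' n"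
proof (induction n)
  case (Suc n) then show ?case unfolding commset.simps by (intro image_mono Sigma_mono) auto
qed simp
lemma commset_finite: "finite F \<Longrightarrow> finite (commset F n)" by (induction n) simp_all

locale abel_mod =
  fixes A Y :: "'g::group_add set"
  assumes A: "subgrp A" and Y: "subgrp Y" "Y \<subseteq> A" and com: "\<And>a b. a \<in> A \<Longrightarrow> b \<in> A \<Longrightarrow> commu a b \<in> Y"
begin

primrec upper_series :: "'g set \<Rightarrow> nat \<Rightarrow> 'g set" where
  "upper_series E 0 = Y"
| "upper_series E (Suc k) = {a \<in> A. \<forall>g\<in>E. commu g a \<in> upper_series E k}"

context
  fixes E P :: "'g set"
  assumes E: "subgrp P" "normalizes P A" "normalizes P Y" "E \<subseteq> P" "normalizes P E"
begin

lemma commu_Y: "g \<in> P \<Longrightarrow> a \<in> Y \<Longrightarrow> commu g a \<in> Y"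
  unfolding commu_conjg by (rule subgrp_diff[OF Y(1)]) (use E(3) in \<open>simp_all add: normalizes_def\<close>)
lemma upper_series_A: "upper_series E k \<subseteq> A" using Y by (cases k) auto
lemma upper_series_Suc: "upper_series E k \<subseteq> upper_series E (Suc k)"
proof (induction k)
  case 0 then show ?case using commu_Y E(4) Y(2) by auto
qed auto
lemma upper_series_mono: "k \<le> l \<Longrightarrow> upper_series E k \<subseteq> upper_series E l"
proof (induction rule: dec_induct)
  case (step n) show ?case by (rule subset_trans[OF step.IH upper_series_Suc])
qed simp
lemma Y_upper_series: "Y \<subseteq> upper_series E k" using upper_series_mono[of 0 k] by simp

lemma conjg_A: "subgrp V \<Longrightarrow> Y \<subseteq> V \<Longrightarrow> V \<subseteq> A \<Longrightarrow> a \<in> A \<Longrightarrow> v \<in> V \<Longrightarrow> conjg a v \<in> V"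
  unfolding conjg_commu_plus by (rule subgrp_add[of V]) (use com in blast)+

lemma upper_series_subgrp: "subgrp (upper_series E k)"
proof (induction k)
  case 0 then show ?case using Y by simp
next
  case (Suc k)
  show ?case unfolding subgrp_def
  proof (intro conjI ballI)
    show "0 \<in> upper_series E (Suc k)" using subgrp_0[OF A] subgrp_0[OF Suc] by simp
    fix a b assume ab: "a \<in> upper_series E (Suc k)" "b \<in> upper_series E (Suc k)"
    have "commu g (a - b) \<in> upper_series E k" if "g \<in> E" for g
    proof -
      have "commu g (a - b) = commu g a + - conjg (a - b) (commu g b)"
        by (simp add: commu_def conjg_def gsimps del: add_uminus_conv_diff)
      moreover have "conjg (a - b) (commu g b) \<in> upper_series E k"
        using ab that by (intro conjg_A[OF Suc Y_upper_series upper_series_A] subgrp_diff[OF A]) auto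
      ultimately show ?thesis using ab that subgrp_diff[OF Suc] by simp
    qed
    then show "a - b \<in> upper_series E (Suc k)" using ab subgrp_diff[OF A] by auto
  qed
qed

lemma upper_series_normalizes: "normalizes P (upper_series E k)"
proof (induction k)
  case 0 then show ?case using E by simp
next
  case (Suc k)
  show ?case unfolding normalizes_def
  proof (intro ballI)
    fix x a assume xa: "x \<in> P" "a \<in> upper_series E (Suc k)"
    have "commu g (conjg x a) \<in> upper_series E k" if "g \<in> E" for g
    proof -
      have "commu g (conjg x a) = conjg x (commu (conjg (- x) g) a)" by (simp add: conjg_commu)
      moreover have "conjg (- x) g \<in> E" using E(5) that subgrp_minus[OF E(1) xa(1)] by (auto simp: normalizes_def)
      ultimately show ?thesis using xa Suc by (auto simp: normalizes_def)
    qed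
    then show "conjg x a \<in> upper_series E (Suc k)" using xa E(2) by (auto simp: normalizes_def)
  qed
qed

lemma upper_series_generated:
  assumes "E = generated S" "a \<in> A" "\<And>s. s \<in> S \<Longrightarrow> commu s a \<in> upper_series E k"
  shows "a \<in> upper_series E (Suc k)"
proof -
  have "subgrp E" unfolding assms(1) by (rule generated_subgrp)
  then have sg: "subgrp {g \<in> E. commu g a \<in> upper_series E k}"
    by (rule subgrp_centralizer_mod[OF _ upper_series_subgrp normalizes_mono[OF upper_series_normalizes E(4)]])
  have "S \<subseteq> E" unfolding assms(1) by (rule generated_subset)
  then have "S \<subseteq> {g \<in> E. commu g a \<in> upper_series E k}" using assms(3) by blast
  then have "generated S \<subseteq> {g \<in> E. commu g a \<in> upper_series E k}" using sg by (rule generated_least)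
  then have "\<forall>g\<in>E. commu g a \<in> upper_series E k" using assms(1) by blast
  then show ?thesis using assms(2) by simp
qed

end

lemma frag_mod:
  assumes V: "subgrp V" "Y \<subseteq> V" "V \<subseteq> A" and ab: "a \<in> A" "b \<in> A"
  shows "frag_of a - frag_of b \<in> augm2 A V \<longleftrightarrow> a - b \<in> V"
proof -
  have "frag_of a - frag_of b \<in> augm2 A V \<longleftrightarrow> frag_of (a - b) - 1 \<in> augm2 A V"
    by (rule augm2_cong[OF augm2_diff_frag[OF A ab]])
  also have "\<dots> \<longleftrightarrow> a - b \<in> V"
    by (rule frag_of_diff_1_iff[OF A V(1,3) _ subgrp_diff[OF A ab]]) (rule subsetD[OF V(2) com])
  finally show ?thesis .
qed

lemma frag_diff_mod:
  assumes "a \<in> A" "b \<in> A" shows "frag_of (a - b) - (frag_of a - frag_of b + 1) \<in> augm2 A V"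
proof -
  have "frag_of (a - b) - (frag_of a - frag_of b + 1) = - ((frag_of a - frag_of b) - (frag_of (a - b) - 1))" by simp
  also have "\<dots> \<in> augm2 A V" by (rule augm2_minus[OF augm2_diff_frag[OF A assms]])
  finally show ?thesis .
qed

end

context abel_mod begin

lemma commu_commute_mod:
  assumes V: "subgrp V" "Y \<subseteq> V" "V \<subseteq> A"
    and m: "v \<in> A" "conjg s v \<in> A" "conjg s' v \<in> A" "conjg s (conjg s' v) \<in> A" "conjg s' (conjg s v) \<in> A"
    and d: "conjg s' (conjg s v) - conjg s (conjg s' v) \<in> V"
  shows "commu s' (commu s v) - commu s (commu s' v) \<in> V"
proof -
  define p q r p' where "p = conjg s' (conjg s v)" and "q = conjg s' v" and "r = conjg s v" and "p' = conjg s (conjg s' v)"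
  have mem: "p \<in> A" "q \<in> A" "r \<in> A" "p' \<in> A" using m by (simp_all add: p_def q_def r_def p'_def)
  have x: "commu s' (commu s v) = (p - q) - (r - v)" by (simp add: commu_conjg conjg_diff p_def q_def r_def)
  have y: "commu s (commu s' v) = (p' - r) - (q - v)" by (simp add: commu_conjg conjg_diff p'_def q_def r_def)
  note D = frag_diff_mod and dA = subgrp_diff[OF A]
  have 1: "frag_of ((a - b) - (c - v)) - (frag_of a - frag_of b - frag_of c + frag_of v + 1) \<in> augm2 A V"
    if "a \<in> A" "b \<in> A" "c \<in> A" for a b c
  proof -
    have "frag_of ((a - b) - (c - v)) - (frag_of a - frag_of b - frag_of c + frag_of v + 1)
      = (frag_of ((a - b) - (c - v)) - (frag_of (a - b) - frag_of (c - v) + 1))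
       + ((frag_of (a - b) - (frag_of a - frag_of b + 1)) - (frag_of (c - v) - (frag_of c - frag_of v + 1)))"
      by simp
    also have "\<dots> \<in> augm2 A V"
      by (intro augm2_add augm2_diff D dA that m)
    finally show ?thesis .
  qed
  have 2: "frag_of p - frag_of p' \<in> augm2 A V"
    using frag_mod[OF V mem(1,4)] d[folded p_def p'_def] by (rule iffD2)
  have "frag_of ((p - q) - (r - v)) - frag_of ((p' - r) - (q - v))
    = (frag_of ((p - q) - (r - v)) - (frag_of p - frag_of q - frag_of r + frag_of v + 1))
     - (frag_of ((p' - r) - (q - v)) - (frag_of p' - frag_of r - frag_of q + frag_of v + 1)) + (frag_of p - frag_of p')"
    by simp
  also have "\<dots> \<in> augm2 A V"
    by (intro augm2_add augm2_diff 1 2 mem)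
  finally have 3: "frag_of ((p - q) - (r - v)) - frag_of ((p' - r) - (q - v)) \<in> augm2 A V" .
  have "(p - q) - (r - v) \<in> A" "(p' - r) - (q - v) \<in> A" by (intro dA mem m)+
  from frag_mod[OF V this] 3 show ?thesis unfolding x y by (rule iffD1)
qed

lemma commu_cong_mod:
  assumes V: "subgrp V" "Y \<subseteq> V" "V \<subseteq> A"
    and m: "x \<in> A" "y \<in> A" "conjg s x \<in> A" "conjg s y \<in> A" and d: "x - y \<in> V" "conjg s (x - y) \<in> V"
  shows "commu s x - commu s y \<in> V"
proof -
  note D = frag_diff_mod and dA = subgrp_diff[OF A] and F = frag_mod[OF V]
  have 1: "frag_of x - frag_of y \<in> augm2 A V" using F[OF m(1,2)] d(1) by (rule iffD2)
  have 2: "frag_of (conjg s x) - frag_of (conjg s y) \<in> augm2 A V" using F[OF m(3,4)] d(2)[unfolded conjg_diff] by (rule iffD2)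
  have "frag_of (conjg s x - x) - frag_of (conjg s y - y)
    = (frag_of (conjg s x - x) - (frag_of (conjg s x) - frag_of x + 1)) - (frag_of (conjg s y - y) - (frag_of (conjg s y) - frag_of y + 1))
    + ((frag_of (conjg s x) - frag_of (conjg s y)) - (frag_of x - frag_of y))" by simp
  also have "\<dots> \<in> augm2 A V"
    by (intro augm2_add augm2_diff D 1 2 m)
  finally have 3: "frag_of (conjg s x - x) - frag_of (conjg s y - y) \<in> augm2 A V" .
  have "conjg s x - x \<in> A" "conjg s y - y \<in> A" by (intro dA m)+
  from F[OF this] 3 show ?thesis unfolding commu_conjg by (rule iffD1)
qed

text \<open>Let \<open>F = -F\<close> be finite, \<open>E = comm_series F\<close> and \<open>E n \<subseteq> A\<close>. By downward induction on \<open>i\<close>, every element of \<open>A\<close> lies in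
  some term of the upper series of \<open>A/Y\<close> under \<open>E i\<close>. For \<open>i = n\<close> the action is trivial. For the step, consider a
  layer of the upper series for \<open>E (i + 1)\<close>. On it the elements of \<open>E i\<close> commute as operators, because their
  commutators lie in \<open>E (i + 1)\<close>. As \<open>E i\<close> is generated over \<open>E (i + 1)\<close> by the finite set \<open>commset F i\<close>, whose elements are
  unipotent on \<open>A/Y\<close>, an induction on the sum of the exponents of unipotency applies. Case \<open>i = 0\<close> bounds the length of
  commutators of elements of \<open>F\<close> that are not in \<open>Y\<close>.\<close>

lemma loc_nilp_lift:
  assumes P: "subgrp P" "normalizes P A" "normalizes P Y" and loc_nilp: "loc_nilp A P"
    and un: "\<And>u a. u \<in> P \<Longrightarrow> a \<in> A \<Longrightarrow> \<exists>m. (commu u ^^ m) a \<in> Y"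
  shows "loc_nilp Y P"
  unfolding loc_nilp_def
proof (intro allI impI)
  fix F0 assume F0: "finite F0 \<and> F0 \<subseteq> P"
  define F where "F = F0 \<union> uminus ` F0"
  have FP: "finite F" "F \<subseteq> P" using F0 subgrp_minus[OF P(1)] by (auto simp: F_def)
  have symF: "- f \<in> F" if "f \<in> F" for f using that by (auto simp: F_def)
  obtain n where n: "commset F n \<subseteq> A" using loc_nilp FP unfolding loc_nilp_def by blast
  let ?E = "comm_series F" and ?Z = "upper_series"
  have ch: "central_chain ?E" by (rule comm_series_central_chain[OF symF])
  have EP: "?E i \<subseteq> P" for i
    using generated_least[OF FP(2) P(1)] comm_series_antimono[of 0 i F] by (auto simp: comm_series_0)
  have csetA: "commset F j \<subseteq> A" if "n \<le> j" for j by (rule commset_A[OF A normalizes_mono[OF P(2) FP(2)] n that])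
  have EnA: "?E n \<subseteq> A" by (rule comm_series_A[OF A normalizes_mono[OF P(2) FP(2)] n])
  have Eh: "subgrp P" "normalizes P A" "normalizes P Y" "?E i \<subseteq> P" "normalizes (?E 0) (?E i)" for i
    using P EP comm_series_normalizes[OF symF] by (auto simp: comm_series_0)
  have Eh0: "subgrp (?E 0)" "normalizes (?E 0) A" "normalizes (?E 0) Y" "?E i \<subseteq> ?E 0" "normalizes (?E 0) (?E i)" for i
    using normalizes_mono[OF P(2) EP] normalizes_mono[OF P(3) EP] comm_series_subgrp comm_series_antimono[of 0 i F] Eh(5) by auto
  have csE: "commset F j \<subseteq> ?E i" if "i \<le> j" for i j by (rule commset_comm_series[OF that])
  have main: "\<forall>a\<in>A. \<exists>k. a \<in> ?Z (?E i) k" if "i \<le> n" for i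
    using that
  proof (induction i rule: inc_induct)
    case base
    have "a \<in> ?Z (?E n) (Suc 0)" if "a \<in> A" for a using that EnA com by (auto simp: upper_series.simps)
    then show ?case by blast
  next
    case (step i)
    define ok where "ok a \<longleftrightarrow> (\<exists>k. a \<in> ?Z (?E i) k)" for a
    \<comment> \<open>finitely many generators decide: \<open>commset F j\<close> lies in \<open>A\<close> for \<open>j \<ge> n\<close> and acts trivially\<close>
    have crit: "ok a" if a: "a \<in> A" and s: "\<And>j s. i \<le> j \<Longrightarrow> j < n \<Longrightarrow> s \<in> commset F j \<Longrightarrow> ok (commu s a)" for a
    proof -
      define S where "S = (\<Union>j\<in>{i..<n}. commset F j)"
      have finS: "finite S" using commset_finite[OF FP(1)] by (auto simp: S_def)
      have "\<forall>s\<in>S. \<exists>k. commu s a \<in> ?Z (?E i) k" using s by (force simp: S_def ok_def)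
      then obtain f where f: "\<And>s. s \<in> S \<Longrightarrow> commu s a \<in> ?Z (?E i) (f s)" by metis
      define k where "k = Max (insert 0 (f ` S))"
      have "commu s a \<in> ?Z (?E i) k" if "s \<in> (\<Union>j\<in>{i..}. commset F j)" for s
      proof -
        from that obtain j where j: "i \<le> j" "s \<in> commset F j" by auto
        show ?thesis
        proof (cases "j < n")
          case True
          then have "s \<in> S" using j by (auto simp: S_def)
          then have "f s \<le> k" using finS by (simp add: k_def)
          then show ?thesis using f[OF \<open>s \<in> S\<close>] upper_series_mono[OF Eh0] by blast
        next
          case False
          then have "s \<in> A" using csetA[of j] j by auto
          then show ?thesis using com a Y_upper_series[OF Eh0] by blast
        qed
      qed
      then have "a \<in> ?Z (?E i) (Suc k)" by (rule upper_series_generated[OF Eh0 comm_series_def a])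
      then show ?thesis unfolding ok_def by (rule exI)
    qed
    have "?Z (?E (Suc i)) k \<subseteq> {a. ok a}" for k
    proof (induction k)
      case 0
      have "ok a" if "a \<in> Y" for a unfolding ok_def using that by (intro exI[of _ 0]) simp
      then show ?case by auto
    next
      case (Suc k)
      define V where "V = ?Z (?E (Suc i)) (Suc k)"
      define V' where "V' = ?Z (?E (Suc i)) k"
      note zf = upper_series_subgrp[OF Eh0] upper_series_A[OF Eh0] Y_upper_series[OF Eh0] upper_series_normalizes[OF Eh0]
      have V: "subgrp V" "V \<subseteq> A" "Y \<subseteq> V" "normalizes (?E 0) V" and V': "subgrp V'" "V' \<subseteq> A" "Y \<subseteq> V'" "normalizes (?E 0) V'"
        unfolding V_def V'_def by (rule zf)+
      have V'V: "V' \<subseteq> V" unfolding V_def V'_def by (rule upper_series_Suc[OF Eh0])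
      have VV: "commu g v \<in> V'" if "g \<in> ?E (Suc i)" "v \<in> V" for g v
        using that by (simp add: V_def V'_def upper_series.simps)
      have cjV: "conjg g v \<in> V" if "g \<in> ?E 0" "v \<in> V" for g v using V(4) that by (simp add: normalizes_def)
      have cjV': "conjg g v \<in> V'" if "g \<in> ?E 0" "v \<in> V'" for g v using V'(4) that by (simp add: normalizes_def)
      have cmV: "commu g v \<in> V" if "g \<in> ?E 0" "v \<in> V" for g v
        unfolding commu_conjg by (rule subgrp_diff[OF V(1) cjV[OF that] that(2)])
      have cmV': "commu g v \<in> V'" if "g \<in> ?E 0" "v \<in> V'" for g v
        unfolding commu_conjg by (rule subgrp_diff[OF V'(1) cjV'[OF that] that(2)])
      have powV: "(commu g ^^ m) v \<in> V" if "g \<in> ?E 0" "v \<in> V" for g v m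
        by (induction m) (simp_all add: that cmV)
      have commute: "commu s' (commu s v) - commu s (commu s' v) \<in> V'" if s: "s \<in> ?E i" "s' \<in> ?E i" "v \<in> V" for s s' v
      proof (rule commu_commute_mod[OF V'(1,3,2)])
        have s0: "s \<in> ?E 0" "s' \<in> ?E 0" using s Eh0(4) by auto
        show "v \<in> A" "conjg s v \<in> A" "conjg s' v \<in> A" "conjg s (conjg s' v) \<in> A" "conjg s' (conjg s v) \<in> A"
          using s(3) s0 cjV V(2) by blast+
        have "s' + s = commu s' s + (s + s')" by (simp add: commu_def gsimps del: add_uminus_conv_diff)
        then have "conjg s' (conjg s v) = conjg (commu s' s) (conjg s (conjg s' v))" by (simp flip: conjg_add)
        then have "conjg s' (conjg s v) - conjg s (conjg s' v) = commu (commu s' s) (conjg s (conjg s' v))" by (simp add: commu_conjg)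
        also have "\<dots> \<in> V'"
          using ch s(1) s0 by (intro VV cjV s0 s(3)) (auto simp: central_chain_def)
        finally show "conjg s' (conjg s v) - conjg s (conjg s' v) \<in> V'" .
      qed
      have cong: "commu s x - commu s y \<in> V'" if "s \<in> ?E 0" "x \<in> V" "y \<in> V" "x - y \<in> V'" for s x y
        using that cjV cjV' V(2) by (intro commu_cong_mod[OF V'(1,3,2)]) blast+
      have pow: "(commu s' ^^ m) (commu s v) - commu s ((commu s' ^^ m) v) \<in> V'" if s: "s \<in> ?E i" "s' \<in> ?E i" "v \<in> V" for s s' v m
      proof (induction m)
        case 0 then show ?case using subgrp_0[OF V'(1)] by simp
      next
        case (Suc m)
        have s0: "s \<in> ?E 0" "s' \<in> ?E 0" using s Eh0(4) by auto
        have 1: "commu s' ((commu s' ^^ m) (commu s v)) - commu s' (commu s ((commu s' ^^ m) v)) \<in> V'"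
          by (intro cong s0 powV cmV s(3) Suc)
        have 2: "commu s' (commu s ((commu s' ^^ m) v)) - commu s (commu s' ((commu s' ^^ m) v)) \<in> V'"
          by (intro commute s powV s0)
        have "(commu s' ((commu s' ^^ m) (commu s v)) - commu s' (commu s ((commu s' ^^ m) v))) + (commu s' (commu s ((commu s' ^^ m) v)) - commu s (commu s' ((commu s' ^^ m) v))) \<in> V'"
          by (rule subgrp_add[OF V'(1) 1 2])
        then show ?case by (simp add: gsimps del: add_uminus_conv_diff)
      qed
      have fS: "finite (commset F i)" by (rule commset_finite[OF FP(1)])
      have okV': "ok a" if "a \<in> V'" for a using that Suc.IH by (auto simp: V'_def)
      \<comment> \<open>induction on the total exponent; applying \<open>commu s\<close> lowers the exponent of \<open>s\<close> and keeps the others\<close>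
      have claim: "ok a" if "a \<in> V" "\<forall>s\<in>commset F i. (commu s ^^ ne s) a \<in> V'" for a ne
        using that
      proof (induction "sum ne (commset F i)" arbitrary: a ne rule: less_induct)
        case less
        show ?case
        proof (cases "\<exists>s\<in>commset F i. ne s = 0")
          case True
          then show ?thesis using less.prems(2) okV' by fastforce
        next
          case False
          show ?thesis
          proof (rule crit)
            show "a \<in> A" using less.prems(1) V(2) by blast
            fix j s assume j: "i \<le> j" "j < n" "s \<in> commset F j"
            show "ok (commu s a)"
            proof (cases "j = i")
              case False
              then have "s \<in> ?E (Suc i)" using j csE[of "Suc i" j] by auto
              then show ?thesis using VV less.prems(1) okV' by blast
            next
              case True
              then have s: "s \<in> commset F i" using j by simp
              have sE: "t \<in> ?E i" if "t \<in> commset F i" for t using that csE[of i i] by auto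
              define ne' where "ne' = ne(s := ne s - 1)"
              have pos: "ne s > 0" using False s by auto
              have "sum ne' (commset F i) < sum ne (commset F i)"
                by (rule sum_strict_mono_ex1[OF fS]) (use s pos in \<open>auto simp: ne'_def\<close>)
              moreover have "commu s a \<in> V" using cmV less.prems(1) sE[OF s] Eh0(4) by blast
              moreover have "(commu t ^^ ne' t) (commu s a) \<in> V'" if t: "t \<in> commset F i" for t
              proof (cases "t = s")
                case True
                obtain m where "ne s = Suc m" using pos by (cases "ne s") auto
                then show ?thesis using less.prems(2) s True by (force simp: ne'_def funpow_swap1)
              next
                case False
                have d: "(commu t ^^ ne t) (commu s a) - commu s ((commu t ^^ ne t) a) \<in> V'"
                  by (rule pow[OF sE[OF s] sE[OF t] less.prems(1)])
                have "commu s ((commu t ^^ ne t) a) \<in> V'"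
                  using cmV' sE[OF s] Eh0(4) less.prems(2) t by blast
                from subgrp_add[OF V'(1) d this] show ?thesis using False by (simp add: ne'_def)
              qed
              ultimately show ?thesis using less.hyps by blast
            qed
          qed
        qed
      qed
      show ?case
      proof
        fix a assume "a \<in> ?Z (?E (Suc i)) (Suc k)"
        then have a: "a \<in> V" by (simp only: V_def)
        have "\<exists>m. (commu s ^^ m) a \<in> V'" if "s \<in> commset F i" for s
          using un[of s a] that csE[of i i] EP[of i] a V(2) V'(3) by blast
        then obtain ne where "\<forall>s\<in>commset F i. (commu s ^^ ne s) a \<in> V'" by metis
        then show "a \<in> {a. ok a}" using claim[OF a] by blast
      qed
    qed
    then show ?case using step.IH by (auto simp: ok_def) blast
  qed
  have fc: "finite (commset F n)" by (rule commset_finite[OF FP(1)])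
  have "\<forall>a\<in>commset F n. \<exists>k. a \<in> ?Z (?E 0) k" using main[of 0] n by auto
  then obtain f where f: "\<And>a. a \<in> commset F n \<Longrightarrow> a \<in> ?Z (?E 0) (f a)" by metis
  define k where "k = Max (insert 0 (f ` commset F n))"
  have "commset F n \<subseteq> ?Z (?E 0) k"
  proof
    fix a assume a: "a \<in> commset F n"
    then have "f a \<le> k" using fc by (simp add: k_def)
    then show "a \<in> ?Z (?E 0) k" using f[OF a] upper_series_mono[OF Eh0] by blast
  qed
  then have "commset F (m + n) \<subseteq> ?Z (?E 0) (k - m)" if "m \<le> k" for m
    using that
  proof (induction m)
    case (Suc m)
    have km: "k - m = Suc (k - Suc m)" using Suc.prems by simp
    have "commset F (m + n) \<subseteq> ?Z (?E 0) (Suc (k - Suc m))" using Suc km by simp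
    moreover have "f \<in> ?E 0" if "f \<in> F" for f using csE[of 0 0] that by auto
    ultimately show ?case by (auto simp: upper_series.simps)
  qed simp
  from this[of k] have "commset F (k + n) \<subseteq> Y" by (simp add: upper_series.simps)
  moreover have "commset F0 (k + n) \<subseteq> commset F (k + n)" by (rule commset_mono) (simp add: F_def)
  ultimately show "\<exists>n. commset F0 n \<subseteq> Y" by blast
qed

end

section \<open>Inheritance of fixed elements\<close>

definition isolated :: "'g::group_add set \<Rightarrow> 'g set \<Rightarrow> bool" where
  "isolated M Y \<longleftrightarrow> (\<forall>x\<in>M. \<forall>n>0. mul n x \<in> Y \<longrightarrow> x \<in> Y)"

definition centr_mod :: "'g::group_add set \<Rightarrow> 'g set \<Rightarrow> 'g set \<Rightarrow> 'g set" where
  "centr_mod M Y S = {x \<in> M. \<forall>s\<in>S. commu x s \<in> Y}"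

lemma subgrp_normalizer:
  "subgrp {g. \<forall>v\<in>V. conjg g v \<in> V \<and> conjg (- g) v \<in> V}"
  unfolding subgrp_def
proof (intro conjI ballI)
  fix x y assume "x \<in> {g. \<forall>v\<in>V. conjg g v \<in> V \<and> conjg (- g) v \<in> V}" "y \<in> {g. \<forall>v\<in>V. conjg g v \<in> V \<and> conjg (- g) v \<in> V}"
  then have xy: "\<And>v. v \<in> V \<Longrightarrow> conjg x v \<in> V" "\<And>v. v \<in> V \<Longrightarrow> conjg (- x) v \<in> V" "\<And>v. v \<in> V \<Longrightarrow> conjg y v \<in> V" "\<And>v. v \<in> V \<Longrightarrow> conjg (- y) v \<in> V" by auto
  have "conjg (x - y) v = conjg x (conjg (- y) v)" "conjg (- (x - y)) v = conjg y (conjg (- x) v)" for v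
    by (simp_all add: gsimps flip: conjg_add del: add_uminus_conv_diff)
  then show "x - y \<in> {g. \<forall>v\<in>V. conjg g v \<in> V \<and> conjg (- g) v \<in> V}" using xy by simp
qed simp

lemma centr_mod_subgrp: assumes "subgrp M" "subgrp Y" "normalizes M Y" shows "subgrp (centr_mod M Y S)"
  unfolding subgrp_def
proof (intro conjI ballI)
  show "0 \<in> centr_mod M Y S" using subgrp_0[OF assms(1)] subgrp_0[OF assms(2)] by (simp add: centr_mod_def)
  fix x y assume xy: "x \<in> centr_mod M Y S" "y \<in> centr_mod M Y S"
  have "commu (x - y) s \<in> Y" if "s \<in> S" for s
  proof -
    have "x \<in> {x \<in> M. commu x s \<in> Y}" "y \<in> {x \<in> M. commu x s \<in> Y}" using xy that by (auto simp: centr_mod_def)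
    from subgrp_diff[OF subgrp_centralizer_mod[OF assms] this] show ?thesis by simp
  qed
  then show "x - y \<in> centr_mod M Y S" using xy subgrp_diff[OF assms(1)] by (simp add: centr_mod_def)
qed

lemma centr_mod_normalizes: assumes "normalizes G M" "normalizes G Y" "normalizes G S" "subgrp G" shows "normalizes G (centr_mod M Y S)"
  unfolding normalizes_def
proof (intro ballI)
  fix g x assume g: "g \<in> G" and x: "x \<in> centr_mod M Y S"
  have "commu (conjg g x) s \<in> Y" if "s \<in> S" for s
  proof -
    have "commu (conjg g x) s = conjg g (commu x (conjg (- g) s))" by (simp add: conjg_commu)
    moreover have "conjg (- g) s \<in> S" using assms(3) that subgrp_minus[OF assms(4) g] by (simp add: normalizes_def)
    ultimately show ?thesis using assms(2) g x by (simp add: normalizes_def centr_mod_def)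
  qed
  then show "conjg g x \<in> centr_mod M Y S" using assms(1) g x by (simp add: normalizes_def centr_mod_def)
qed

text \<open>If a multiple of \<open>x\<close> commutes with \<open>s\<close> modulo \<open>Y\<close>, then \<open>x\<close> and its conjugate by \<open>s\<close> have equal multiples, so they agree by
  uniqueness of roots.\<close>

lemma centr_mod_isolated:
  assumes M: "subgrp M" and Y: "subgrp Y" "Y \<subseteq> M" "normalizes M Y" "loc_nilp Y M" "isolated M Y" and S: "S \<subseteq> M"
  shows "isolated M (centr_mod M Y S)"
  unfolding isolated_def
proof (intro ballI allI impI)
  fix x n assume x: "x \<in> M" "(0::nat) < n" "mul n x \<in> centr_mod M Y S"
  have cmx: "commu x s = x - conjg s x" for x s :: 'a by (simp add: commu_def conjg_def gsimps del: add_uminus_conv_diff)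
  have "x - conjg s x \<in> Y" if "s \<in> S" for s
  proof (rule unique_roots[OF M Y(1-4) _ x(1) _ x(2)])
    show "conjg s x \<in> M" using that S x(1) unfolding conjg_def by (intro subgrp_diff[OF M] subgrp_add[OF M]) auto
    show "mul n x - mul n (conjg s x) \<in> Y" using x(3) that by (simp add: centr_mod_def cmx flip: conjg_mul)
  qed (use Y(5) in \<open>auto simp: isolated_def\<close>)
  then show "x \<in> centr_mod M Y S" using x(1) by (simp add: centr_mod_def cmx)
qed

context amalgam begin

definition T_inherits :: "'g set \<Rightarrow> 'g set \<Rightarrow> bool" where
  "T_inherits M Y \<longleftrightarrow> (\<forall>x\<in>M. (\<forall>h\<in>H. commu h x \<in> Y) \<longrightarrow> (\<forall>t\<in>T. commu t x \<in> Y))"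

text \<open>An element \<open>x\<close> of \<open>M\<close> fixed by \<open>H\<close> modulo \<open>A\<close> need not be fixed modulo \<open>Y\<close>, but a modification \<open>x'\<close> of a multiple of \<open>x\<close> by
  an element of \<open>A\<close> is. Then \<open>x'\<close> is \<open>T\<close>-fixed modulo \<open>Y\<close>, so a multiple of \<open>x\<close> is \<open>T\<close>-fixed modulo \<open>A\<close>, and so is \<open>x\<close> by
  uniqueness of roots.

  The obstruction to finding \<open>x'\<close> is the cocycle \<open>c h = [h,x]\<close> with values in \<open>A/Y\<close>. If \<open>x\<close> centralized \<open>A/Y\<close>, its
  \<open>|H|\<close>-fold multiple would be a coboundary by averaging over \<open>H\<close>, and correcting \<open>|H| x\<close> by the averaging element
  would finish the proof. In general \<open>x\<close> acts unipotently on the finitely many values of \<open>c\<close>, as \<open>M\<close> is locally nilpotent. The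
  same correction then moves the values of the cocycle one step down in the upper series of \<open>A/Y\<close> under \<open>x\<close>, and it can be
  repeated.\<close>

lemma T_inherits_up:
  assumes M: "subgrp M" "normalizes G M" "M \<subseteq> G" "loc_nilp {0} M"
    and Y: "subgrp Y" "normalizes G Y" "isolated M Y" and A: "subgrp A" "normalizes G A" "isolated M A"
    and YAM: "Y \<subseteq> A" "A \<subseteq> M" and com: "\<And>a b. a \<in> A \<Longrightarrow> b \<in> A \<Longrightarrow> commu a b \<in> Y"
    and good: "T_inherits M Y"
  shows "T_inherits M A"
proof -
  interpret gs: good_section H K T A Y
    using YAM M(3) com A Y good by unfold_locales (auto simp: isolated_def T_inherits_def)
  interpret am: abel_mod A Y by (rule abel_mod.intro[OF A(1) Y(1) YAM(1) com])
  interpret MA: cong M A by (rule cong.intro[OF M(1) A(1) YAM(2) normalizes_mono[OF A(2) M(3)]])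
  let ?Z = "\<lambda>y. am.upper_series (generated {y})"
  have genG: "generated {y} \<subseteq> G" if "y \<in> M" for y using generated_least[OF _ sgG, of "{y}"] that M(3) by blast
  have E: "subgrp (generated {y})" "normalizes (generated {y}) A" "normalizes (generated {y}) Y" "generated {y} \<subseteq> generated {y}" "normalizes (generated {y}) (generated {y})" if "y \<in> M" for y
    using generated_subgrp[of "{y}"] normalizes_mono[OF A(2) genG[OF that]] normalizes_mono[OF Y(2) genG[OF that]]
    by (auto simp: normalizes_def conjg_def intro: subgrp_diff[OF generated_subgrp] subgrp_add[OF generated_subgrp])
  have yy: "y \<in> generated {y}" for y :: 'g by (rule generated.base) simp
  have claim: "\<exists>n>0. \<exists>x'\<in>M. x' - mul n y \<in> A \<and> (\<forall>h\<in>H. commu h x' \<in> Y)"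
    if "y \<in> M" "\<forall>h\<in>H. commu h y \<in> ?Z y m" for y m
    using that
  proof (induction m arbitrary: y)
    case 0
    have "mul 1 y = y" by simp
    then have "y - mul 1 y \<in> A" using subgrp_0[OF A(1)] by simp
    moreover have "\<forall>h\<in>H. commu h y \<in> Y" using 0 by simp
    ultimately show ?case using 0(1) zero_less_one by blast
  next
    case (Suc m)
    note y = Suc.prems(1) and Ey = E[OF Suc.prems(1)]
    define c where "c h = commu h y" for h
    define N where "N = card H"
    define p where "p = mul N y"
    have cZ: "c h \<in> ?Z y (Suc m)" if "h \<in> H" for h using Suc.prems(2) that by (simp only: c_def)
    have cA: "c h \<in> A" if "h \<in> H" for h using cZ[OF that] am.upper_series_A[OF Ey] by blast
    define z where "z = (\<Sum>h\<in>H. frag_of (c h) - (1 :: 'g gring))"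
    have z1: "frag_of a - 1 \<in> augm A" if "a \<in> A" for a using augm_base[OF that, of 0] by simp
    have "z \<in> augm A" unfolding z_def by (intro augm_sum z1 cA)
    then obtain b where b: "b \<in> A" "z - (frag_of b - 1) \<in> augm2 A Y" using augm_representative[OF A(1)] by blast
    \<comment> \<open>the averaged element \<open>b\<close> exhibits \<open>N c\<close> as a coboundary, up to sign\<close>
    have bd: "(conjg h b - b) - (- mul N (c h)) \<in> Y" if h: "h \<in> H" for h
    proof -
      have hG: "h \<in> G" using h HG by blast
      have coc: "conjg h (c h') = c (h + h') - c h" for h'
        by (simp add: c_def commu_conjg conjg_add conjg_diff conjg_plus conjg_uminus gsimps del: add_uminus_conv_diff)
      have "bij_betw (\<lambda>x. h + x) H H"
        by (rule bij_betwI[of _ _ _ "\<lambda>x. - h + x"])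
          (use sg(1) h in \<open>auto simp: subgrp_add subgrp_minus add.assoc[symmetric]\<close>)
      then have re: "(\<Sum>x\<in>H. frag_of (c (h + x)) - 1) = z"
        unfolding z_def by (rule sum.reindex_bij_betw)
      have "frag_of h * z - z + of_nat N * (frag_of (c h) - 1)
        = (\<Sum>x\<in>H. frag_of h * (frag_of (c x) - 1)) - (\<Sum>x\<in>H. frag_of (c (h + x)) - 1) + (\<Sum>x\<in>H. frag_of (c h) - 1)"
        unfolding re by (simp only: z_def sum_distrib_left N_def sum_constant)
      also have "\<dots> = (\<Sum>x\<in>H. (frag_of h * (frag_of (c x) - 1) - (frag_of (conjg h (c x)) - 1))
           + (frag_of (c (h + x) - c h) - (frag_of (c (h + x)) - frag_of (c h) + 1)))"
        unfolding coc sum_subtractf[symmetric] sum.distrib[symmetric] by (rule sum.cong) simp_all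
      also have "\<dots> \<in> augm2 A Y"
        by (intro augm2_sum augm2_add gs.conjg_frag hG cA am.frag_diff_mod subgrp_add[OF sg(1)] h)
      finally have 1: "frag_of h * z - z + of_nat N * (frag_of (c h) - 1) \<in> augm2 A Y" .
      have "frag_of h * z - (frag_of (conjg h b) - 1) = frag_of h * (z - (frag_of b - 1)) + (frag_of h * (frag_of b - 1) - (frag_of (conjg h b) - 1))"
        by (simp add: right_diff_distrib)
      also have "\<dots> \<in> augm2 A Y" by (intro augm2_add gs.augm2_l gs.conjg_frag b hG)
      finally have 2: "frag_of h * z - (frag_of (conjg h b) - 1) \<in> augm2 A Y" .
      have 3: "of_nat N * (frag_of (c h) - 1) - (frag_of (mul N (c h)) - 1) \<in> augm2 A Y" by (rule gs.int_frag[OF cA[OF h]])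
      have mem: "conjg h b \<in> A" "mul N (c h) \<in> A" by (intro gs.cjA hG b subgrp_mul[OF A(1)] cA h)+
      have "frag_of (conjg h b - b) - frag_of (0 - mul N (c h))
        = (frag_of (conjg h b - b) - (frag_of (conjg h b) - frag_of b + 1)) - (frag_of (0 - mul N (c h)) - (frag_of 0 - frag_of (mul N (c h)) + 1))
         + ((frag_of h * z - z + of_nat N * (frag_of (c h) - 1)) - (frag_of h * z - (frag_of (conjg h b) - 1))
           + (z - (frag_of b - 1)) - (of_nat N * (frag_of (c h) - 1) - (frag_of (mul N (c h)) - 1)))"
        by simp
      also have "\<dots> \<in> augm2 A Y"
        by (intro augm2_add augm2_diff am.frag_diff_mod 1 2 3 b mem subgrp_0[OF A(1)])
      finally have 4: "frag_of (conjg h b - b) - frag_of (0 - mul N (c h)) \<in> augm2 A Y" .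
      have "(conjg h b - b) - (0 - mul N (c h)) \<in> Y"
        by (rule iffD1[OF am.frag_mod[OF Y(1) _ YAM(1)] 4]) (simp_all add: subgrp_minus[OF A(1)] subgrp_diff[OF A(1)] mem b)
      then show ?thesis by simp
    qed
    define y' where "y' = p + b"
    have pM: "p \<in> M" unfolding p_def by (rule subgrp_mul[OF M(1) y])
    have y'M: "y' \<in> M" unfolding y'_def using pM b(1) YAM(2) by (intro subgrp_add[OF M(1)]) auto
    have pE: "p \<in> generated {y}" unfolding p_def by (intro subgrp_mul[OF generated_subgrp] yy)
    \<comment> \<open>the corrected element acts on \<open>A/Y\<close> like \<open>N y\<close>, so its upper series is at least as large\<close>
    have Zle: "?Z y k \<subseteq> ?Z y' k" for k
    proof (induction k)
      case 0 show ?case by simp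
    next
      case (Suc k)
      show ?case
      proof
        fix a assume a: "a \<in> ?Z y (Suc k)"
        have aA: "a \<in> A" using a by simp
        have "commu y' a = conjg p (commu b a) + commu p a" by (simp add: y'_def commu_conjg conjg_add conjg_plus conjg_uminus gsimps del: add_uminus_conv_diff)
        moreover have "conjg p (commu b a) \<in> ?Z y k"
          using gs.cjB[OF _ com[OF b(1) aA], of p] pM M(3) am.Y_upper_series[OF Ey] by blast
        moreover have "commu p a \<in> ?Z y k" using a pE by simp
        ultimately have "commu y' a \<in> ?Z y k" using subgrp_add[OF am.upper_series_subgrp[OF Ey]] by metis
        then have "commu s a \<in> ?Z y' k" if "s \<in> {y'}" for s using Suc that by blast
        then show "a \<in> ?Z y' (Suc k)" by (rule am.upper_series_generated[OF E[OF y'M] HOL.refl aA])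
      qed
    qed
    define V where "V = ?Z y m"
    define R where "R = {g. \<forall>v\<in>V. conjg g v \<in> V \<and> conjg (- g) v \<in> V}"
    have V: "subgrp V" "V \<subseteq> A" "Y \<subseteq> V" "normalizes (generated {y}) V"
      unfolding V_def by (rule am.upper_series_subgrp[OF Ey] am.upper_series_A[OF Ey] am.Y_upper_series[OF Ey] am.upper_series_normalizes[OF Ey])+
    have sR: "subgrp R" unfolding R_def by (rule subgrp_normalizer)
    have ER: "generated {y} \<subseteq> R"
      using V(4) subgrp_minus[OF generated_subgrp] by (auto simp: R_def normalizes_def)
    have AR: "A \<subseteq> R"
      using am.conjg_A[OF Ey V(1,3,2)] subgrp_minus[OF A(1)] unfolding R_def by blast
    interpret RV: cong R V
      by (rule cong.intro[OF sR V(1) subset_trans[OF V(2) AR]]) (auto simp: normalizes_def R_def)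
    have "commu h y' \<in> V" if h: "h \<in> H" for h
    proof -
      define q where "q = mul N (c h)"
      have qA: "q \<in> A" "q \<in> ?Z y (Suc m)" unfolding q_def
        by (rule subgrp_mul[OF A(1) cA[OF h]], rule subgrp_mul[OF am.upper_series_subgrp[OF Ey] cZ[OF h]])
      have m: "c h \<in> R" "y \<in> R" using cA[OF h] AR ER yy by blast+
      have "commu y (c h) \<in> V" using cZ[OF h] yy by (simp add: V_def)
      then have "commu (c h) y \<in> V" using subgrp_minus[OF V(1)] commu_minus by metis
      then have 1: "mul N (c h + y) - (q + p) \<in> V" unfolding q_def p_def by (rule RV.mul_add_mod) (rule m)+
      have 2: "(conjg h b - b) - (- q) \<in> V" unfolding q_def using bd[OF h] V(3) by blast
      have 3: "(mul N (c h + y) + (conjg h b - b)) - ((q + p) + (- q)) \<in> V"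
        by (rule RV.add[OF 1 2 subgrp_mul[OF sR subgrp_add[OF sR m]]])
      have "commu p q \<in> V" using qA(2) pE by (simp add: V_def)
      then have "commu q p \<in> V" using subgrp_minus[OF V(1)] commu_minus by metis
      then have 4: "((q + p) + (- q)) - p \<in> V" by (simp add: commu_def)
      have "conjg h y = c h + y" by (simp add: c_def commu_conjg)
      then have "commu h y' = (mul N (c h + y) + (conjg h b - b)) - p"
        by (simp add: commu_conjg y'_def conjg_plus p_def conjg_mul gsimps del: add_uminus_conv_diff)
      then show ?thesis using RV.trans[OF 3 4] by simp
    qed
    then have "\<forall>h\<in>H. commu h y' \<in> ?Z y' m" using Zle V_def by blast
    from Suc.IH[OF y'M this] obtain n x' where x': "n > 0" "x' \<in> M" "x' - mul n y' \<in> A" "\<forall>h\<in>H. commu h x' \<in> Y" by blast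
    have "y' - p = conjg p b" by (simp add: y'_def conjg_def)
    then have "y' - p \<in> A" using gs.cjA[OF _ b(1), of p] pM M(3) by auto
    then have "mul n y' - mul n p \<in> A" by (rule MA.mul_cong[OF _ y'M])
    then have "x' - mul n p \<in> A" using MA.trans[OF x'(3)] by blast
    then have "x' - mul (n * N) y \<in> A" by (simp add: p_def mul_mult)
    moreover have "n * N > 0" using x'(1) card_pos by (simp add: N_def)
    ultimately show ?case using x' by blast
  qed
  have "commu t x \<in> A" if x: "x \<in> M" and xh: "\<forall>h\<in>H. commu h x \<in> A" and t: "t \<in> T" for x t
  proof -
    define F where "F = insert x ((\<lambda>h. commu h x) ` H)"
    have "finite F" "F \<subseteq> M" using fin(1) x xh YAM(2) by (auto simp: F_def)
    then obtain m where m: "commset F m \<subseteq> {0}" using M(4) unfolding loc_nilp_def by blast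
    have cs: "(commu x ^^ i) f \<in> commset F i" if "f \<in> F" for f i
      by (induction i) (use that in \<open>auto simp: F_def\<close>)
    have inZ: "a \<in> ?Z x i" if "a \<in> A" "(commu x ^^ i) a \<in> Y" for a i
      using that
    proof (induction i arbitrary: a)
      case (Suc i)
      have "commu x a \<in> A" using Suc.prems(1) gs.cjA[OF _ Suc.prems(1), of x] x M(3) unfolding commu_conjg by (intro subgrp_diff[OF A(1)]) auto
      moreover have "(commu x ^^ i) (commu x a) \<in> Y" using Suc.prems(2) by (simp add: funpow_swap1)
      ultimately have "commu x a \<in> ?Z x i" by (rule Suc.IH)
      then have "commu s a \<in> ?Z x i" if "s \<in> {x}" for s using that by simp
      then show ?case by (rule am.upper_series_generated[OF E[OF x] HOL.refl Suc.prems(1)])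
    qed simp
    have "commu h x \<in> ?Z x m" if "h \<in> H" for h
    proof (rule inZ)
      have "(commu x ^^ m) (commu h x) = 0" using cs[of "commu h x" m] m that by (auto simp: F_def)
      then show "(commu x ^^ m) (commu h x) \<in> Y" using subgrp_0[OF Y(1)] by simp
    qed (use xh that in blast)
    then obtain n x' where x': "n > 0" "x' \<in> M" "x' - mul n x \<in> A" "\<forall>h\<in>H. commu h x' \<in> Y" using claim[OF x] by blast
    then have 1: "conjg t x' - x' \<in> A" using good t YAM(1) by (auto simp: T_inherits_def commu_conjg)
    have tG: "t \<in> G" using t TG by blast
    have 2: "conjg t x' - conjg t (mul n x) \<in> A" unfolding conjg_diff[symmetric] by (rule gs.cjA[OF tG x'(3)])
    have "conjg t (mul n x) - mul n x \<in> A" by (rule MA.trans[OF MA.sym[OF 2] MA.trans[OF 1 x'(3)]])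
    then have 3: "mul n (conjg t x) - mul n x \<in> A" by (simp add: conjg_mul)
    have "loc_nilp A M" by (rule loc_nilp_mono[OF M(4)]) (simp add: subgrp_0[OF A(1)])
    have "conjg t x \<in> M" using M(2) tG x by (simp add: normalizes_def)
    have "conjg t x - x \<in> A"
      by (rule unique_roots[OF M(1) A(1) YAM(2) normalizes_mono[OF A(2) M(3)] \<open>loc_nilp A M\<close> _ \<open>conjg t x \<in> M\<close> x x'(1) 3])
        (use A(3) in \<open>auto simp: isolated_def\<close>)
    then show ?thesis by (simp add: commu_conjg)
  qed
  then show ?thesis by (auto simp: T_inherits_def)
qed

text \<open>This is where the hypothesis on centralizers enters: it concerns powers, and uniqueness of
  roots removes them.\<close>

lemma T_inherits_zero:
  assumes M: "subgrp M" "normalizes G M" "M \<subseteq> G" "loc_nilp {0} M" "isolated M {0}"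
    and cc: "\<And>x. x \<in> G \<Longrightarrow> \<forall>h\<in>H. commu h x = 0 \<Longrightarrow> \<exists>n>0. \<forall>t\<in>T. commu t (mul n x) = 0"
  shows "T_inherits M {0}"
  unfolding T_inherits_def
proof (intro ballI impI)
  fix x t assume x: "x \<in> M" "\<forall>h\<in>H. commu h x \<in> {0}" and t: "t \<in> T"
  then obtain n where n: "n > 0" "commu t (mul n x) = 0" using cc[of x] M(3) by auto
  have "subgrp {0::'g}" "normalizes M {0}" "{0} \<subseteq> M" using subgrp_0[OF M(1)] by (auto simp: subgrp_def normalizes_def)
  moreover have "conjg t x \<in> M" using M(2) TG t x by (auto simp: normalizes_def)
  moreover have "mul n (conjg t x) - mul n x \<in> {0}" using n(2) by (simp add: commu_conjg conjg_mul)
  ultimately have "conjg t x - x \<in> {0}" using M(5) by (intro unique_roots[OF M(1) _ _ _ M(4) _ _ x(1) n(1)]) (auto simp: isolated_def)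
  then show "commu t x \<in> {0}" by (simp add: commu_conjg)
qed

text \<open>Induction from \<open>M\<close> down to the trivial subgroup along good sections. The induction runs over isolated normal
  subgroups \<open>Y\<close> inheriting fixed elements and containing \<open>D k\<close>. If \<open>Y\<close> contains \<open>D (k + 1)\<close>, then \<open>D k\<close> is
  abelian modulo \<open>Y\<close>. Let \<open>C\<close> be its centralizer and \<open>A\<close> the centralizer of \<open>C\<close>, both in \<open>M\<close> modulo \<open>Y\<close>. Then \<open>A\<close> contains \<open>D k\<close> and
  is contained in \<open>C\<close>, so it is abelian modulo \<open>Y\<close>. While \<open>D k\<close> need not be
  isolated, \<open>A\<close> is, being a centralizer.\<close>

lemma layer_induct:
  assumes M: "subgrp M" "normalizes G M" "M \<subseteq> G" "loc_nilp {0} M" "isolated M {0}"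
    and cc: "\<And>x. x \<in> G \<Longrightarrow> \<forall>h\<in>H. commu h x = 0 \<Longrightarrow> \<exists>n>0. \<forall>t\<in>T. commu t (mul n x) = 0"
    and D: "\<And>i. normalizes G (D i)" "\<And>i. D (Suc i) \<subseteq> D i"
      "\<And>i x y. x \<in> D i \<Longrightarrow> y \<in> D i \<Longrightarrow> commu x y \<in> D (Suc i)" "D 0 = M" "D d = {0}"
    and Q: "Q M"
    and step: "\<And>A Y. good_section H K T A Y \<Longrightarrow> Q A \<Longrightarrow> Q Y"
  shows "Q {0}"
proof -
  have "Q Y" if "subgrp Y" "normalizes G Y" "Y \<subseteq> M" "isolated M Y" "T_inherits M Y" "D k \<subseteq> Y" for Y k
    using that
  proof (induction k arbitrary: Y)
    case 0
    then have "Y = M" using D(4) by simp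
    then show ?case using Q by simp
  next
    case (Suc k)
    note Y = Suc.prems
    define C where "C = centr_mod M Y (D k)"
    define A where "A = centr_mod M Y C"
    have nMY: "normalizes M Y" by (rule normalizes_mono[OF Y(2) M(3)])
    have DM: "D k \<subseteq> M" for k
    proof (induction k)
      case (Suc k) then show ?case using D(2)[of k] by blast
    qed (simp add: D(4))
    have DC: "D k \<subseteq> C" using DM D(3)[of _ k] Y(6) unfolding C_def centr_mod_def by blast
    have cmY: "commu x y \<in> Y" if "commu y x \<in> Y" for x y using subgrp_minus[OF Y(1) that] by (simp add: commu_minus)
    have DA: "D k \<subseteq> A" using DM cmY unfolding A_def C_def centr_mod_def by blast
    have AC: "A \<subseteq> C" using DC unfolding A_def C_def centr_mod_def by blast
    have com: "commu a b \<in> Y" if "a \<in> A" "b \<in> A" for a b using that AC unfolding A_def centr_mod_def by blast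
    have CM: "C \<subseteq> M" "A \<subseteq> M" by (auto simp: C_def A_def centr_mod_def)
    have YA: "Y \<subseteq> A"
    proof
      fix x assume x: "x \<in> Y"
      have "commu x s \<in> Y" if "s \<in> C" for s
        by (rule cmY, unfold commu_conjg, rule subgrp_diff[OF Y(1) _ x]) (use nMY that CM x in \<open>auto simp: normalizes_def\<close>)
      then show "x \<in> A" using x Y(3) by (auto simp: A_def centr_mod_def)
    qed
    have "loc_nilp Y M" by (rule loc_nilp_mono[OF M(4)]) (simp add: subgrp_0[OF Y(1)])
    have A: "subgrp A" "normalizes G A" "isolated M A"
      unfolding A_def C_def
      using centr_mod_subgrp[OF M(1) Y(1) nMY] centr_mod_normalizes[OF M(2) Y(2) centr_mod_normalizes[OF M(2) Y(2) D(1) sgG] sgG]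
        centr_mod_isolated[OF M(1) Y(1,3) nMY \<open>loc_nilp Y M\<close> Y(4)] CM(1) by (auto simp: C_def)
    have "T_inherits M A" by (rule T_inherits_up[OF M(1-4) Y(1,2,4) A YA CM(2) com Y(5)])
    then have "Q A" by (intro Suc.IH A CM(2) DA)
    moreover have "good_section H K T A Y"
      using YA M(3) CM(2) com A Y by unfold_locales (auto simp: isolated_def T_inherits_def)
    ultimately show ?case using step by blast
  qed
  moreover have "subgrp {0::'g}" "normalizes G {0}" "{0} \<subseteq> M" using subgrp_0[OF M(1)] by (auto simp: subgrp_def normalizes_def)
  moreover have "D d \<subseteq> {0}" using D(5) by simp
  ultimately show ?thesis using M(5) T_inherits_zero[OF M cc] by blast
qed

text \<open>Two applications of \<open>layer_induct\<close>. The first one shows that \<open>D i\<close> is locally nilpotent once \<open>D (i + 1)\<close> is: \<open>D i\<close> is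
  abelian modulo \<open>D (i + 1)\<close>, and local nilpotence descends through good sections by unipotence. The second
  one, for \<open>D 0\<close>, shows that \<open>D 0\<close> is contained in every \<open>Y\<close>: if it is contained in \<open>A\<close>, then \<open>A\<close> has finite index and
  collapses to \<open>Y\<close>. Finite index is expressed by a function \<open>f\<close> with finitely many values that
  separates the cosets of \<open>D 0\<close>.\<close>

theorem finite_amalgam:
  assumes D: "\<And>i. subgrp (D i)" "\<And>i. D i \<subseteq> G" "\<And>i. normalizes G (D i)" "\<And>i. D (Suc i) \<subseteq> D i"
      "\<And>i x y. x \<in> D i \<Longrightarrow> y \<in> D i \<Longrightarrow> commu x y \<in> D (Suc i)" "D d = {0}"
    and tf: "isolated (D 0) {0}"
    and cc: "\<And>x. x \<in> G \<Longrightarrow> \<forall>h\<in>H. commu h x = 0 \<Longrightarrow> \<exists>n>0. \<forall>t\<in>T. commu t (mul n x) = 0"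
    and idx: "finite (f ` G)" "\<And>x y. x \<in> G \<Longrightarrow> y \<in> G \<Longrightarrow> f x = f y \<Longrightarrow> x - y \<in> D 0"
  shows "finite G"
proof -
  have D0: "D i \<subseteq> D 0" for i
  proof (induction i)
    case (Suc i) then show ?case using D(4)[of i] by blast
  qed simp
  have isoD: "isolated (D i) {0}" for i using tf D0[of i] by (auto simp: isolated_def)
  have loc_nilp: "loc_nilp {0} (D i)" if "i \<le> d" for i
    using that
  proof (induction i rule: inc_induct)
    case base
    have "\<exists>n. commset F n \<subseteq> {0}" if "F \<subseteq> D d" for F using that D(6) by (intro exI[of _ 0]) simp
    then show ?case by (simp add: loc_nilp_def)
  next
    case (step i)
    show ?case
    proof (rule layer_induct[where M="D (Suc i)" and D="\<lambda>k. D (Suc i + k)" and Q="\<lambda>Y. loc_nilp Y (D i)" and d="d - Suc i"])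
      show "loc_nilp (D (Suc i)) (D i)"
        unfolding loc_nilp_def
      proof (intro allI impI exI[of _ 1])
        fix F assume "finite F \<and> F \<subseteq> D i"
        then show "commset F 1 \<subseteq> D (Suc i)" using D(5)[of _ i] by auto
      qed
      fix A Y assume gs: "good_section H K T A Y" and LNA: "loc_nilp A (D i)"
      interpret gs: good_section H K T A Y by (rule gs)
      interpret am: abel_mod A Y by (rule abel_mod.intro[OF gs.sgA gs.sgB gs.BA gs.comm])
      show "loc_nilp Y (D i)"
        by (rule am.loc_nilp_lift[OF D(1) normalizes_mono[OF gs.nA D(2)] normalizes_mono[OF gs.nB D(2)] LNA])
          (rule gs.unipotent[OF D(1,3,2) LNA])
    qed (use D step isoD cc in auto)
  qed
  have "D 0 \<subseteq> {0}"
  proof (rule layer_induct[where M="D 0" and D=D and Q="\<lambda>Y. D 0 \<subseteq> Y" and d=d])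
    fix A Y assume gs: "good_section H K T A Y" and NA: "D 0 \<subseteq> A"
    interpret gs: good_section H K T A Y by (rule gs)
    define r where "r v = (SOME x. x \<in> G \<and> f x = v)" for v
    have r: "r (f x) \<in> G" "f (r (f x)) = f x" if "x \<in> G" for x
      using someI[of "\<lambda>z. z \<in> G \<and> f z = f x" x] that by (auto simp: r_def)
    define cl where "cl x = {z \<in> G. z - x \<in> A}" for x
    have cl_eq: "cl x = cl y" if "x - y \<in> A" for x y
    proof -
      have "z - x \<in> A \<longleftrightarrow> z - y \<in> A" for z
        using subgrp_add[OF gs.sgA, of "z - x" "x - y"] subgrp_diff[OF gs.sgA, of "z - y" "x - y"] that
        by (auto simp: gsimps simp del: add_uminus_conv_diff)
      then show ?thesis by (simp add: cl_def)
    qed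
    have "cl ` G \<subseteq> (\<lambda>v. cl (r v)) ` f ` G"
    proof
      fix c assume "c \<in> cl ` G"
      then obtain x where x: "x \<in> G" "c = cl x" by blast
      have "cl x = cl (r (f x))" using idx(2)[OF x(1) r(1)[OF x(1)]] r(2)[OF x(1)] NA by (intro cl_eq) auto
      then show "c \<in> (\<lambda>v. cl (r v)) ` f ` G" using x by blast
    qed
    then have finc: "finite (cl ` G)" using idx(1) finite_subset by blast
    define s where "s c = (SOME x. x \<in> c)" for c :: "'g set"
    have s: "s (cl x) \<in> G" "s (cl x) - x \<in> A" if "x \<in> G" for x
    proof -
      have "x \<in> cl x" using that subgrp_0[OF gs.sgA] by (simp add: cl_def)
      then have "s (cl x) \<in> cl x" unfolding s_def by (rule someI)
      then show "s (cl x) \<in> G" "s (cl x) - x \<in> A" by (auto simp: cl_def)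
    qed
    have "A \<subseteq> Y"
    proof (rule gs.finite_index_case[where R="s ` cl ` G"])
      show "finite (s ` cl ` G)" using finc by blast
      show "s ` cl ` G \<subseteq> G" using s by blast
      show "s ` cl ` G \<noteq> {}" using subgrp_0[OF sgG] by blast
      fix x assume x: "x \<in> G"
      show "\<exists>!z. z \<in> s ` cl ` G \<and> x - z \<in> A"
      proof (rule ex1I[of _ "s (cl x)"])
        show "s (cl x) \<in> s ` cl ` G \<and> x - s (cl x) \<in> A" using x subgrp_minus[OF gs.sgA s(2)[OF x]] by auto
        fix z assume z: "z \<in> s ` cl ` G \<and> x - z \<in> A"
        then obtain y where y: "y \<in> G" "z = s (cl y)" by blast
        have "x - y \<in> A" using subgrp_add[OF gs.sgA, of "x - z" "z - y"] z s(2)[OF y(1)] y(2)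
          by (simp add: gsimps del: add_uminus_conv_diff)
        then show "z = s (cl x)" using cl_eq y by simp
      qed
    qed
    then show "D 0 \<subseteq> Y" using NA by blast
  qed (use D loc_nilp[of 0] isoD cc in auto)
  then have "inj_on f G" using idx(2) by (intro inj_onI) (metis eq_iff_diff_eq_0 singletonD subsetD)
  then show ?thesis using idx(1) finite_imageD by blast
qed

end

section \<open>Virtually torsion-free solvable groups\<close>

text \<open>The permutations of a type, with composition as addition. Every group embeds into such a type
  by its regular representation, which carries it into the class \<open>group_add\<close>.\<close>

typedef 'a permutation = "{f :: 'a \<Rightarrow> 'a. bij f}" morphisms bij_fun Permutation
  by (rule exI[of _ id]) simp

instantiation permutation :: (type) group_add
begin
definition "0 = Permutation id"
definition "f + g = Permutation (bij_fun f \<circ> bij_fun g)"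
definition "- f = Permutation (inv_into UNIV (bij_fun f))"
definition "f - g = f + - (g :: 'a permutation)"
instance
proof
  fix f g h :: "'a permutation"
  have b: "bij (bij_fun f)" for f :: "'a permutation" using bij_fun[of f] by simp
  show "f + g + h = f + (g + h)" using b by (simp add: plus_permutation_def Permutation_inverse bij_comp comp_assoc)
  show "0 + f = f" "f + 0 = f" by (simp_all add: plus_permutation_def zero_permutation_def Permutation_inverse bij_fun_inverse)
  show "- f + f = 0" using b by (simp add: plus_permutation_def zero_permutation_def uminus_permutation_def Permutation_inverse bij_imp_bij_inv bij_is_inj)
  show "f + - g = f - g" by (simp add: minus_permutation_def)
qed
end

lemma bij_fun_plus: "bij_fun (f + g) = bij_fun f \<circ> bij_fun g"
proof -
  have "bij (bij_fun f)" for f :: "'a permutation" using bij_fun[of f] by simp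
  then show ?thesis by (simp add: plus_permutation_def Permutation_inverse bij_comp)
qed

text \<open>Elements outside the carrier are fixed, so that the map is a bijection of the whole type.\<close>

definition cayley :: "('a, 'b) monoid_scheme \<Rightarrow> 'a \<Rightarrow> 'a permutation" where
  "cayley G g = Permutation (\<lambda>x. if x \<in> carrier G then g \<otimes>\<^bsub>G\<^esub> x else x)"

context group begin

abbreviation "\<phi> \<equiv> cayley G"

lemma bij_fun_cayley:
  assumes "g \<in> carrier G"
  shows "bij_fun (\<phi> g) = (\<lambda>x. if x \<in> carrier G then g \<otimes> x else x)"
proof -
  have "bij (\<lambda>x. if x \<in> carrier G then g \<otimes> x else x)"
    by (rule o_bij[of "\<lambda>x. if x \<in> carrier G then inv g \<otimes> x else x"])
      (use assms in \<open>auto simp: fun_eq_iff m_assoc[symmetric]\<close>)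
  then show ?thesis by (simp add: cayley_def Permutation_inverse)
qed

lemma cayley_mult: assumes "g \<in> carrier G" "h \<in> carrier G" shows "\<phi> (g \<otimes> h) = \<phi> g + \<phi> h"
proof -
  have "bij_fun (\<phi> (g \<otimes> h)) = bij_fun (\<phi> g + \<phi> h)"
    using assms by (auto simp: bij_fun_plus bij_fun_cayley fun_eq_iff m_assoc)
  then show ?thesis by (simp add: bij_fun_inject)
qed

lemma cayley_inj: "inj_on \<phi> (carrier G)"
proof (rule inj_onI)
  fix g h assume gh: "g \<in> carrier G" "h \<in> carrier G" "\<phi> g = \<phi> h"
  have "bij_fun (\<phi> g) \<one> = bij_fun (\<phi> h) \<one>" by (simp only: gh(3))
  then show "g = h" using gh(1,2) by (simp add: bij_fun_cayley)
qed

lemma cayley_eq: "g \<in> carrier G \<Longrightarrow> h \<in> carrier G \<Longrightarrow> \<phi> g = \<phi> h \<longleftrightarrow> g = h"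
  using cayley_inj by (auto simp: inj_on_def)

lemma cayley_one: "\<phi> \<one> = 0"
proof -
  have "\<phi> \<one> + \<phi> \<one> = \<phi> \<one> + 0" using cayley_mult[of \<one> \<one>] by simp
  then show ?thesis by (rule add_left_imp_eq)
qed

lemma cayley_inv: assumes "g \<in> carrier G" shows "\<phi> (inv g) = - \<phi> g"
proof -
  have "\<phi> (inv g) + \<phi> g = 0" using cayley_mult[of "inv g" g] assms by (simp add: cayley_one)
  then show ?thesis by (simp add: eq_neg_iff_add_eq_0)
qed

lemma cayley_diff: "g \<in> carrier G \<Longrightarrow> h \<in> carrier G \<Longrightarrow> \<phi> (g \<otimes> inv h) = \<phi> g - \<phi> h"
  by (simp add: cayley_mult cayley_inv)

lemma cayley_conjg: "g \<in> carrier G \<Longrightarrow> h \<in> carrier G \<Longrightarrow> conjg (\<phi> g) (\<phi> h) = \<phi> (g \<otimes> h \<otimes> inv g)"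
  by (simp add: conjg_def cayley_mult cayley_inv)

lemma cayley_commu: "g \<in> carrier G \<Longrightarrow> h \<in> carrier G \<Longrightarrow> commu (\<phi> g) (\<phi> h) = \<phi> (g \<otimes> h \<otimes> inv g \<otimes> inv h)"
  by (simp add: commu_def cayley_mult cayley_inv)

lemma cayley_commu_0: "g \<in> carrier G \<Longrightarrow> h \<in> carrier G \<Longrightarrow> commu (\<phi> g) (\<phi> h) = 0 \<longleftrightarrow> g \<otimes> h = h \<otimes> g"
proof -
  assume gh: "g \<in> carrier G" "h \<in> carrier G"
  have "commu (\<phi> g) (\<phi> h) = (\<phi> g + \<phi> h) - (\<phi> h + \<phi> g)" by (simp add: commu_def gsimps del: add_uminus_conv_diff)
  also have "\<dots> = \<phi> (g \<otimes> h) - \<phi> (h \<otimes> g)" using gh by (simp add: cayley_mult)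
  finally show ?thesis using gh by (simp add: cayley_eq)
qed

lemma cayley_pow: "g \<in> carrier G \<Longrightarrow> \<phi> (g [^] (n::nat)) = mul n (\<phi> g)"
  by (induction n) (simp_all add: cayley_one cayley_mult mul_comm)

lemma cayley_subgrp: assumes "subgroup S G" shows "subgrp (\<phi> ` S)"
  unfolding subgrp_def
proof (intro conjI ballI)
  interpret S: subgroup S G by (rule assms)
  show "0 \<in> \<phi> ` S" using cayley_one S.one_closed by (metis imageI)
  fix x y assume "x \<in> \<phi> ` S" "y \<in> \<phi> ` S"
  then obtain g h where "g \<in> S" "h \<in> S" "x = \<phi> g" "y = \<phi> h" by blast
  then show "x - y \<in> \<phi> ` S" using cayley_diff[of g h] S.mem_carrier S.m_closed S.m_inv_closed by (metis imageI)
qed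

lemma cayley_generated: assumes "S \<subseteq> carrier G" shows "generated (\<phi> ` S) = \<phi> ` generate G S"
proof
  show "generated (\<phi> ` S) \<subseteq> \<phi> ` generate G S"
    by (rule generated_least[OF _ cayley_subgrp[OF generate_is_subgroup[OF assms]]]) (auto intro: generate.incl)
  have "\<phi> g \<in> generated (\<phi> ` S)" if "g \<in> generate G S" for g
    using that
  proof induction
    case one then show ?case by (simp add: cayley_one generated.zero)
  next
    case (incl h) then show ?case by (simp add: generated.base)
  next
    case (inv h)
    then have "h \<in> carrier G" "\<phi> h \<in> generated (\<phi> ` S)" using assms by (auto intro: generated.base)
    then show ?case by (simp add: cayley_inv subgrp_minus[OF generated_subgrp])
  next
    case (eng g h)
    then show ?case using generate_in_carrier[OF assms] by (simp add: cayley_mult subgrp_add[OF generated_subgrp])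
  qed
  then show "\<phi> ` generate G S \<subseteq> generated (\<phi> ` S)" by blast
qed

text \<open>The finite-index subgroup \<open>S\<close> is replaced by its normal core \<open>N\<close>, and the subgroups \<open>D i\<close> of the additive
  argument are the images of the derived series of \<open>N\<close>, cut down to \<open>\<langle>K,T\<rangle>\<close>. The cosets of \<open>N\<close> are separated by the action of
  \<open>G\<close> on the finite set of cosets of \<open>S\<close>. If \<open>g\<close> centralizes \<open>H\<close>, two of its powers lie in the same coset of the
  centralizer of \<open>T\<close>, so some positive power centralizes \<open>T\<close>.\<close>

lemma finite_join:
  assumes vtfs: "virtually_torsion_free_solvable G"
    and H: "subgroup H G" "finite H" and K: "subgroup K G" "finite K" and T: "subgroup T G" "finite T"
    and sub: "H \<subseteq> K" "H \<subseteq> T" and fic: "finite_index G (centralizer G H) (centralizer G T)"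
  shows "finite (generate G (K \<union> T))"
proof -
  obtain S where S: "subgroup S G" "finite_index G (carrier G) S" "torsion_free_group (G\<lparr>carrier := S\<rparr>)" "solvable (G\<lparr>carrier := S\<rparr>)"
    using vtfs unfolding virtually_torsion_free_solvable_def by blast
  interpret S: subgroup S G by (rule S)
  have KT: "K \<union> T \<subseteq> carrier G" using K T by (simp add: subgroup.subset)
  define L where "L = generate G (K \<union> T)"
  have L: "subgroup L G" unfolding L_def by (rule generate_is_subgroup[OF KT])
  have Lc: "L \<subseteq> carrier G" using L by (rule subgroup.subset)
  interpret amalgam "\<phi> ` H" "\<phi> ` K" "\<phi> ` T"
    by unfold_locales (use H K T sub cayley_subgrp in auto)
  have G_eq: "amalgam.G (\<phi> ` K) (\<phi> ` T) = \<phi> ` L"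
    unfolding G_def L_def using cayley_generated[OF KT] by (simp add: image_Un)
  define N where "N = {n \<in> carrier G. \<forall>x\<in>carrier G. x \<otimes> n \<otimes> inv x \<in> S}"
  have NS: "N \<subseteq> S"
  proof
    fix n assume n: "n \<in> N"
    have "\<one> \<otimes> n \<otimes> inv \<one> \<in> S" using n one_closed unfolding N_def by blast
    moreover have "n \<in> carrier G" using n by (simp add: N_def)
    ultimately show "n \<in> S" by simp
  qed
  have subN: "subgroup N G"
  proof (rule subgroupI)
    show "N \<subseteq> carrier G" by (auto simp: N_def)
    have "\<one> \<in> N" by (simp add: N_def)
    then show "N \<noteq> {}" by blast
    fix a assume a: "a \<in> N"
    then have ac: "a \<in> carrier G" by (simp add: N_def)
    have "x \<otimes> inv a \<otimes> inv x = inv (x \<otimes> a \<otimes> inv x)" if "x \<in> carrier G" for x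
      using that ac by (simp add: inv_mult_group m_assoc)
    then show "inv a \<in> N" using a ac by (simp add: N_def)
    fix b assume b: "b \<in> N"
    then have bc: "b \<in> carrier G" by (simp add: N_def)
    have "x \<otimes> (a \<otimes> b) \<otimes> inv x = (x \<otimes> a \<otimes> inv x) \<otimes> (x \<otimes> b \<otimes> inv x)" if "x \<in> carrier G" for x
    proof -
      have "(x \<otimes> a \<otimes> inv x) \<otimes> (x \<otimes> b \<otimes> inv x) = x \<otimes> a \<otimes> (inv x \<otimes> x) \<otimes> b \<otimes> inv x"
        using that ac bc by (simp only: m_assoc m_closed inv_closed)
      then show ?thesis using that ac bc by (simp add: m_assoc)
    qed
    then show "a \<otimes> b \<in> N" using a b ac bc by (simp add: N_def)
  qed
  have norN: "N \<lhd> G"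
    unfolding normal_inv_iff
  proof (intro conjI subN ballI)
    fix x n assume x: "x \<in> carrier G" and n: "n \<in> N"
    then have nc: "n \<in> carrier G" by (simp add: N_def)
    have "y \<otimes> (x \<otimes> n \<otimes> inv x) \<otimes> inv y = (y \<otimes> x) \<otimes> n \<otimes> inv (y \<otimes> x)" if "y \<in> carrier G" for y
      using that x nc by (simp add: inv_mult_group m_assoc)
    then show "x \<otimes> n \<otimes> inv x \<in> N" using x n nc by (simp add: N_def)
  qed
  let ?D = "\<lambda>i. (derived G ^^ i) N"
  have nD: "?D i \<lhd> G" for i by (induction i) (simp_all add: norN derived_is_normal)
  have sD: "subgroup (?D i) G" for i by (rule normal_imp_subgroup[OF nD])
  have cD: "?D i \<subseteq> carrier G" for i by (rule subgroup.subset[OF sD])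
  have "\<exists>d. ?D d = {\<one>}"
  proof -
    interpret SG: group "G\<lparr>carrier := S\<rparr>" by (rule subgroup_imp_group[OF S(1)])
    obtain d where d: "(derived (G\<lparr>carrier := S\<rparr>) ^^ d) S = {\<one>}"
      using SG.solvable_imp_trivial_derived_seq[of S] S(4) by (auto simp: solvable_def)
    have "(derived (G\<lparr>carrier := S\<rparr>) ^^ i) S = (derived G ^^ i) S \<and> (derived G ^^ i) S \<subseteq> S" for i
      by (induction i) (auto simp: derived_consistent[OF _ S(1)] dest!: subsetD[OF derived_incl[OF _ S(1)]])
    then have "?D d \<subseteq> {\<one>}" using mono_exp_of_derived[OF NS, of d] d by auto
    then show ?thesis using subgroup.one_closed[OF sD, of d] by blast
  qed
  then obtain d where d: "?D d = {\<one>}" by blast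
  define E where "E i = \<phi> ` ?D i \<inter> \<phi> ` L" for i
  define F where "F g = (\<lambda>C\<in>rcosets S. C #> g)" for g
  define f where "f y = F (inv_into L \<phi> y)" for y
  have injL: "inj_on \<phi> L" by (rule inj_on_subset[OF cayley_inj Lc])
  have fphi: "f (\<phi> g) = F g" if "g \<in> L" for g by (simp add: f_def inv_into_f_f[OF injL that])
  have "finite (amalgam.G (\<phi> ` K) (\<phi> ` T))"
  proof (rule finite_amalgam[of E d f])
    show "subgrp (E i)" for i
      unfolding E_def using cayley_subgrp[OF sD[of i]] cayley_subgrp[OF L] by (auto simp: subgrp_def)
    show "E i \<subseteq> amalgam.G (\<phi> ` K) (\<phi> ` T)" for i by (simp add: E_def G_eq)
    show "normalizes (amalgam.G (\<phi> ` K) (\<phi> ` T)) (E i)" for i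
      unfolding normalizes_def G_eq
    proof (intro ballI)
      fix x a assume x: "x \<in> \<phi> ` L" and a: "a \<in> E i"
      obtain g where g: "g \<in> L" "x = \<phi> g" using x by blast
      obtain b where b: "b \<in> ?D i" "a = \<phi> b" "a \<in> \<phi> ` L" using a by (auto simp: E_def)
      have c: "g \<in> carrier G" "b \<in> carrier G" using g b cD Lc by blast+
      have "conjg x a \<in> \<phi> ` ?D i"
        unfolding g(2) b(2) cayley_conjg[OF c] using normal.inv_op_closed2[OF nD c(1) b(1)] by blast
      moreover have "conjg x a \<in> \<phi> ` L"
        unfolding conjg_def by (intro subgrp_diff[OF cayley_subgrp[OF L]] subgrp_add[OF cayley_subgrp[OF L]] x b)
      ultimately show "conjg x a \<in> E i" by (simp add: E_def)
    qed
    show "E (Suc i) \<subseteq> E i" for i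
      using derived_incl[OF subset_refl sD[of i]] by (auto simp: E_def)
    show "commu x y \<in> E (Suc i)" if xy: "x \<in> E i" "y \<in> E i" for x y i
    proof -
      obtain a where a: "a \<in> ?D i" "x = \<phi> a" using xy by (auto simp: E_def)
      obtain b where b: "b \<in> ?D i" "y = \<phi> b" using xy by (auto simp: E_def)
      have c: "a \<in> carrier G" "b \<in> carrier G" using a b cD by blast+
      have "a \<otimes> b \<otimes> inv a \<otimes> inv b \<in> derived_set G (?D i)" using a b by blast
      then have "commu x y \<in> \<phi> ` ?D (Suc i)"
        unfolding a(2) b(2) cayley_commu[OF c] by (auto simp: derived_def intro: generate.incl)
      moreover have "commu x y \<in> \<phi> ` L"
        using xy unfolding commu_def E_def by (intro subgrp_diff[OF cayley_subgrp[OF L]] subgrp_add[OF cayley_subgrp[OF L]]) auto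
      ultimately show ?thesis by (simp add: E_def)
    qed
    show "E d = {0}" using subgroup.one_closed[OF L] by (auto simp: E_def d cayley_one[symmetric])
    show "isolated (E 0) {0}"
      unfolding isolated_def
    proof (intro ballI allI impI)
      fix x n assume "x \<in> E 0" and n: "(0::nat) < n" "mul n x \<in> {0}"
      then obtain a where a: "a \<in> N" "x = \<phi> a" by (auto simp: E_def)
      have ac: "a \<in> carrier G" "a \<in> S" using a NS S.subset by blast+
      have "\<phi> (a [^] n) = \<phi> \<one>" using n(2) ac by (simp add: cayley_pow a(2) cayley_one)
      then have "a [^] n = \<one>" using ac by (simp add: cayley_eq)
      then have "a [^]\<^bsub>G\<lparr>carrier := S\<rparr>\<^esub> n = \<one>" by (simp add: nat_pow_def)
      then have "a = \<one>" using S(3) ac n(1) unfolding torsion_free_group_def by simp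
      then show "x \<in> {0}" by (simp add: a cayley_one)
    qed
    show "\<exists>n>0. \<forall>t\<in>\<phi> ` T. commu t (mul n x) = 0"
      if x: "x \<in> amalgam.G (\<phi> ` K) (\<phi> ` T)" and xh: "\<forall>h\<in>\<phi> ` H. commu h x = 0" for x
    proof -
      obtain g where g: "g \<in> L" "x = \<phi> g" using x G_eq by auto
      have gc: "g \<in> carrier G" using g Lc by blast
      have Hc: "H \<subseteq> carrier G" "T \<subseteq> carrier G" using H T by (simp_all add: subgroup.subset)
      have gH: "h \<otimes> g = g \<otimes> h" if "h \<in> H" for h
        using xh that Hc cayley_commu_0[of h g] gc by (auto simp: g(2))
      have gpc: "h \<otimes> g [^] n = g [^] n \<otimes> h" if "h \<in> H" for h and n :: nat
      proof (induction n)
        case (Suc n)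
        have hc: "h \<in> carrier G" using that Hc by blast
        have "h \<otimes> g [^] Suc n = (h \<otimes> g [^] n) \<otimes> g" using hc gc by (simp add: m_assoc)
        also have "\<dots> = g [^] n \<otimes> (h \<otimes> g)" using hc gc Suc by (simp add: m_assoc)
        also have "\<dots> = g [^] Suc n \<otimes> h" using hc gc gH[OF that] by (simp add: m_assoc)
        finally show ?case .
      qed (use that Hc in auto)
      then have gC: "g [^] n \<in> centralizer G H" for n :: nat using gc by (simp add: centralizer_def)
      let ?c = "\<lambda>n::nat. centralizer G T #> g [^] n"
      have "range ?c \<subseteq> rcosets\<^bsub>G\<lparr>carrier := centralizer G H\<rparr>\<^esub> (centralizer G T)"
        using gC by (auto simp: RCOSETS_def r_coset_def)
      then have "finite (range ?c)" using fic finite_subset unfolding finite_index_def by blast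
      then have "\<not> inj ?c" using finite_imageD infinite_UNIV_nat by blast
      then obtain i j :: nat where ij: "i < j" "?c i = ?c j"
        unfolding inj_on_def by (metis linorder_neqE_nat)
      have one: "\<one> \<in> centralizer G T" using Hc(2) by (auto simp: centralizer_def)
      have "\<one> \<otimes> g [^] j \<in> ?c j" using one unfolding r_coset_def by blast
      then have "g [^] j \<in> ?c i" using gc ij(2) by simp
      then obtain u where u: "u \<in> centralizer G T" "g [^] j = u \<otimes> g [^] i" by (auto simp: r_coset_def)
      have uc: "u \<in> carrier G" using u by (simp add: centralizer_def)
      have "g [^] (j - i) \<otimes> g [^] i = g [^] j" using gc ij(1) by (simp add: nat_pow_mult)
      then have "g [^] (j - i) = u" using u(2) uc gc by simp
      then have "t \<otimes> g [^] (j - i) = g [^] (j - i) \<otimes> t" if "t \<in> T" for t using u(1) that by (simp add: centralizer_def)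
      then have "commu (\<phi> t) (mul (j - i) x) = 0" if "t \<in> T" for t
        using that Hc(2) gc cayley_commu_0[of t "g [^] (j - i)"] by (auto simp: g(2) cayley_pow)
      then show ?thesis using ij(1) by (intro exI[of _ "j - i"]) auto
    qed
    have fR: "finite (rcosets S)" using S(2) by (simp add: finite_index_def)
    have FR: "F g \<in> rcosets S \<rightarrow>\<^sub>E rcosets S" if "g \<in> carrier G" for g
    proof -
      have "C #> g \<in> rcosets S" if "C \<in> rcosets S" for C
        using that \<open>g \<in> carrier G\<close> by (auto simp: RCOSETS_def coset_mult_assoc[OF S.subset])
      then show ?thesis unfolding F_def by simp
    qed
    have "f ` \<phi> ` L \<subseteq> rcosets S \<rightarrow>\<^sub>E rcosets S"
    proof
      fix y assume "y \<in> f ` \<phi> ` L"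
      then obtain g where "g \<in> L" "y = F g" using fphi by auto
      then show "y \<in> rcosets S \<rightarrow>\<^sub>E rcosets S" using FR Lc by blast
    qed
    then show "finite (f ` amalgam.G (\<phi> ` K) (\<phi> ` T))"
      unfolding G_eq by (rule finite_subset) (simp add: finite_PiE fR)
    show "x - y \<in> E 0"
      if xy: "x \<in> amalgam.G (\<phi> ` K) (\<phi> ` T)" "y \<in> amalgam.G (\<phi> ` K) (\<phi> ` T)" and eq: "f x = f y" for x y
    proof -
      obtain g h where g: "g \<in> L" "x = \<phi> g" and h: "h \<in> L" "y = \<phi> h" using xy G_eq by auto
      have c: "g \<in> carrier G" "h \<in> carrier G" using g h Lc by blast+
      have Feq: "F g = F h" using eq g h fphi by simp
      have "x \<otimes> (g \<otimes> inv h) \<otimes> inv x \<in> S" if x: "x \<in> carrier G" for x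
      proof -
        have "S #> x \<in> rcosets S" using x by (auto simp: RCOSETS_def)
        then have "S #> x #> g = S #> x #> h" using fun_cong[OF Feq, of "S #> x"] by (simp add: F_def)
        then have "S #> (x \<otimes> g) = S #> (x \<otimes> h)" using x c by (simp add: coset_mult_assoc[OF S.subset])
        moreover have "x \<otimes> g \<in> S #> (x \<otimes> g)" using x c S.one_closed by (force simp: r_coset_def)
        ultimately obtain s where s: "s \<in> S" "x \<otimes> g = s \<otimes> (x \<otimes> h)" by (auto simp: r_coset_def)
        have "s = (x \<otimes> g) \<otimes> inv (x \<otimes> h)" using s x c S.mem_carrier by (simp add: inv_solve_right)
        then have "s = x \<otimes> (g \<otimes> inv h) \<otimes> inv x" using x c by (simp add: inv_mult_group m_assoc)
        then show ?thesis using s by simp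
      qed
      then have "g \<otimes> inv h \<in> N" using c by (simp add: N_def)
      moreover have "g \<otimes> inv h \<in> L" using g h L by (simp add: subgroup.m_closed subgroup.m_inv_closed)
      ultimately show ?thesis using c by (auto simp: E_def g h cayley_diff[symmetric])
    qed
  qed
  then show ?thesis unfolding G_eq L_def[symmetric] using injL by (rule finite_imageD)
qed

end

section \<open>Homotopies of order complexes\<close>

lemma powertop_real_eq_euclidean: "(powertop_real UNIV :: ('p \<Rightarrow> real) topology) = euclidean"
  by (rule euclidean_product_topology)

lemma closed_closed_simplex:
  assumes "finite C" shows "closed (closed_simplex C :: ('p \<Rightarrow> real) set)"
proof -
  have eq: "closed_simplex C = (\<Inter>p. {f. 0 \<le> f p}) \<inter> (\<Inter>p\<in>- C. {f. f p = 0}) \<inter> {f. sum f C = 1}"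
    by (auto simp: closed_simplex_def)
  have c: "continuous_on UNIV (\<lambda>f. f p)" for p :: 'p and f :: "'p \<Rightarrow> real" by simp
  have "closed {f :: 'p \<Rightarrow> real. 0 \<le> f p}" for p by (rule closed_Collect_le) (simp_all add: continuous_on_const)
  moreover have "closed {f :: 'p \<Rightarrow> real. f p = 0}" for p by (rule closed_Collect_eq) (simp_all add: continuous_on_const)
  moreover have "closed {f :: 'p \<Rightarrow> real. sum f C = 1}"
    by (rule closed_Collect_eq) (simp_all add: continuous_on_const continuous_on_sum)
  ultimately show ?thesis unfolding eq by (intro closed_Int closed_INT) auto
qed

text \<open>On the finite subcomplex spanned by \<open>V\<close> the weak topology is that of coordinates: a closed set meets it in a finite
  union of sets closed in single simplices, hence closed.\<close>

lemma continuous_map_into_realization: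
  fixes g :: "'z::topological_space \<Rightarrow> 'p \<Rightarrow> real"
  assumes V: "finite V" "\<And>z. z \<in> Z \<Longrightarrow> \<exists>D\<in>order_simplices P r. D \<subseteq> V \<and> g z \<in> closed_simplex D"
    and cont: "\<And>v. continuous_on Z (\<lambda>z. g z v)"
  shows "continuous_map (top_of_set Z) (geometric_realization P r) g"
  unfolding continuous_map_closedin
proof (intro conjI allI impI)
  let ?X = "geometric_realization P r"
  show "g \<in> topspace (top_of_set Z) \<rightarrow> topspace ?X"
    using V(2) by (fastforce simp: topspace_geometric_realization)
  fix Q assume Q: "closedin ?X Q"
  define \<D> where "\<D> = {D \<in> order_simplices P r. D \<subseteq> V}"
  have "finite \<D>" using V(1) by (rule finite_subset[rotated, OF finite_Pow_iff[THEN iffD2]]) (auto simp: \<D>_def)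
  have cg: "continuous_on Z g" by (rule continuous_on_coordinatewise_then_product[OF cont])
  have "closedin (top_of_set Z) (Z \<inter> g -` (Q \<inter> closed_simplex D))" if D: "D \<in> \<D>" for D
  proof -
    have D': "D \<in> order_simplices P r" "finite D" using D by (auto simp: \<D>_def order_simplices_def)
    have "openin (top_of_set (closed_simplex D)) ((topspace ?X - Q) \<inter> closed_simplex D)"
      using Q D'(1) by (simp add: closedin_def openin_geometric_realization powertop_real_eq_euclidean)
    then have "closedin (top_of_set (closed_simplex D)) (closed_simplex D - ((topspace ?X - Q) \<inter> closed_simplex D))"
      by (simp add: openin_closedin_eq)
    also have "closed_simplex D - ((topspace ?X - Q) \<inter> closed_simplex D) = Q \<inter> closed_simplex D"
      using D'(1) by (auto simp: topspace_geometric_realization)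
    finally have "closed (Q \<inter> closed_simplex D)"
      using closed_closed_simplex[OF D'(2)] closedin_closed_trans by blast
    then show ?thesis by (rule continuous_closedin_preimage[OF cg])
  qed
  then have "closedin (top_of_set Z) (\<Union>D\<in>\<D>. Z \<inter> g -` (Q \<inter> closed_simplex D))"
    using \<open>finite \<D>\<close> by (intro closedin_Union) auto
  also have "(\<Union>D\<in>\<D>. Z \<inter> g -` (Q \<inter> closed_simplex D)) = {z \<in> topspace (top_of_set Z). g z \<in> Q}"
    using V(2) by (fastforce simp: \<D>_def)
  finally show "closedin (top_of_set Z) {z \<in> topspace (top_of_set Z). g z \<in> Q}" .
qed

text \<open>The weak topology of a product with the unit interval is the product topology. The proof is
  the tube lemma: for a compact interval \<open>J\<close> around \<open>s0\<close>, the set \<open>N\<close> of points \<open>x\<close> with \<open>h (J \<times> {x})\<close> inside the open set \<open>U\<close> meets every simplex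
  in an open set, because it is enough that \<open>h\<close> is continuous on the product of the interval with that simplex.\<close>

lemma continuous_map_homotopy_realization:
  fixes h :: "real \<times> ('p \<Rightarrow> real) \<Rightarrow> 'p \<Rightarrow> real"
  assumes V: "\<And>C. C \<in> order_simplices P r \<Longrightarrow> finite (V C)"
      "\<And>C s x. C \<in> order_simplices P r \<Longrightarrow> s \<in> {0..1} \<Longrightarrow> x \<in> closed_simplex C
        \<Longrightarrow> \<exists>D\<in>order_simplices P r. D \<subseteq> V C \<and> h (s, x) \<in> closed_simplex D"
    and cont: "\<And>C v. C \<in> order_simplices P r \<Longrightarrow> continuous_on ({0..1} \<times> closed_simplex C) (\<lambda>z. h z v)"
  shows "continuous_map (prod_topology (top_of_set {0..1}) (geometric_realization P r)) (geometric_realization P r) h"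
proof -
  let ?X = "geometric_realization P r" and ?I = "{0..1} :: real set"
  have h: "continuous_map (prod_topology (top_of_set ?I) (top_of_set (closed_simplex C))) ?X h"
    if "C \<in> order_simplices P r" for C
    unfolding prod_topology_subtopology_eu
    by (rule continuous_map_into_realization[OF V(1)[OF that] _ cont[OF that]]) (use V(2)[OF that] in auto)
  show ?thesis
    unfolding continuous_map_def
  proof (intro conjI allI impI)
    show "h \<in> topspace (prod_topology (top_of_set ?I) ?X) \<rightarrow> topspace ?X"
      using V(2) by (fastforce simp: topspace_geometric_realization)
    fix U assume U: "openin ?X U"
    define W where "W = {z \<in> topspace (prod_topology (top_of_set ?I) ?X). h z \<in> U}"
    have WC: "openin (prod_topology (top_of_set ?I) (top_of_set (closed_simplex C))) {z \<in> ?I \<times> closed_simplex C. h z \<in> U}"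
      if "C \<in> order_simplices P r" for C
      using openin_continuous_map_preimage[OF h[OF that] U] by simp
    have "openin (prod_topology (top_of_set ?I) ?X) W"
      unfolding openin_prod_topology_alt
    proof (intro allI impI)
      fix s0 x0 assume "(s0, x0) \<in> W"
      then have s0: "s0 \<in> ?I" and x0: "x0 \<in> topspace ?X" and hU: "h (s0, x0) \<in> U" by (auto simp: W_def)
      obtain C0 where C0: "C0 \<in> order_simplices P r" "x0 \<in> closed_simplex C0"
        using x0 by (auto simp: topspace_geometric_realization)
      from WC[OF C0(1)] s0 C0(2) hU
      obtain A B where "openin (top_of_set ?I) A" "s0 \<in> A" "x0 \<in> B"
          and AB: "A \<times> B \<subseteq> {z \<in> ?I \<times> closed_simplex C0. h z \<in> U}"
        unfolding openin_prod_topology_alt by blast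
      then obtain e where e: "e > 0" "\<And>s. s \<in> ?I \<Longrightarrow> dist s s0 < e \<Longrightarrow> s \<in> A"
        unfolding openin_euclidean_subtopology_iff by blast
      define J where "J = cball s0 (e / 2) \<inter> ?I"
      have J: "compact J" "J \<subseteq> ?I" by (auto simp: J_def)
      have JU: "h (s, x0) \<in> U" if "s \<in> J" for s
      proof -
        have "s \<in> A" using that e by (auto simp: J_def dist_commute)
        then show ?thesis using AB \<open>x0 \<in> B\<close> by blast
      qed
      define N where "N = {x \<in> topspace ?X. \<forall>s\<in>J. h (s, x) \<in> U}"
      have "openin ?X N"
        unfolding openin_geometric_realization powertop_real_eq_euclidean
      proof (intro conjI ballI)
        show "N \<subseteq> (\<Union>C\<in>order_simplices P r. closed_simplex C)" by (auto simp: N_def topspace_geometric_realization)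
        fix C assume C: "C \<in> order_simplices P r"
        show "openin (top_of_set (closed_simplex C)) (N \<inter> closed_simplex C)"
        proof (subst openin_subopen, intro ballI)
          fix y assume y: "y \<in> N \<inter> closed_simplex C"
          have "compactin (top_of_set ?I) J" using J by (simp add: compactin_subtopology)
          moreover have "J \<times> {y} \<subseteq> {z \<in> ?I \<times> closed_simplex C. h z \<in> U}" using y J(2) by (auto simp: N_def)
          ultimately obtain A' B' where "openin (top_of_set (closed_simplex C)) B'" "J \<subseteq> A'" "y \<in> B'"
              and AB': "A' \<times> B' \<subseteq> {z \<in> ?I \<times> closed_simplex C. h z \<in> U}"
            using tube_lemma_left[OF WC[OF C], of J y] y by auto
          moreover have "B' \<subseteq> N \<inter> closed_simplex C"
          proof
            fix x assume x: "x \<in> B'"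
            then have "x \<in> closed_simplex C" using openin_subset[OF \<open>openin (top_of_set (closed_simplex C)) B'\<close>] by auto
            moreover have "h (s, x) \<in> U" if "s \<in> J" for s using AB' \<open>J \<subseteq> A'\<close> that x by blast
            ultimately show "x \<in> N \<inter> closed_simplex C" using C by (auto simp: N_def topspace_geometric_realization)
          qed
          ultimately show "\<exists>T. openin (top_of_set (closed_simplex C)) T \<and> y \<in> T \<and> T \<subseteq> N \<inter> closed_simplex C" by blast
        qed
      qed
      moreover have "openin (top_of_set ?I) (?I \<inter> ball s0 (e / 2))" by (rule openin_open_Int) simp
      moreover have "s0 \<in> ?I \<inter> ball s0 (e / 2)" using s0 e(1) by simp
      moreover have "x0 \<in> N" using x0 JU by (simp add: N_def)
      moreover have "(?I \<inter> ball s0 (e / 2)) \<times> N \<subseteq> W" by (auto simp: W_def N_def J_def)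
      ultimately show "\<exists>U V. openin (top_of_set ?I) U \<and> openin ?X V \<and> s0 \<in> U \<and> x0 \<in> V \<and> U \<times> V \<subseteq> W" by blast
    qed
    then show "openin (prod_topology (top_of_set ?I) ?X) {z \<in> topspace (prod_topology (top_of_set ?I) ?X). h z \<in> U}"
      by (simp only: W_def)
  qed
qed

section \<open>Conically contractible posets\<close>

text \<open>The map induced on barycentric coordinates by \<open>f\<close>, and a homotopy from the identity to it. The comparison \<open>p \<le> f p\<close> puts \<open>C\<close> and
  \<open>f ` C\<close> into a prism, and at time \<open>s\<close> the topmost mass \<open>s\<close> of a chain has been moved from \<open>p\<close> to \<open>f p\<close>. Moving from the top keeps the
  support a chain: unmoved elements lie below the moved ones, hence below their images.
  Sums range over the support because the function does not know the simplex it lies in.\<close>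

definition push :: "('p \<Rightarrow> 'p) \<Rightarrow> ('p \<Rightarrow> real) \<Rightarrow> 'p \<Rightarrow> real" where
  "push f m q = (\<Sum>p | m p \<noteq> 0 \<and> f p = q. m p)"

definition moved :: "real \<Rightarrow> ('p::order \<Rightarrow> real) \<Rightarrow> 'p \<Rightarrow> real" where
  "moved s x p = max 0 (min (x p) (s - (\<Sum>q | x q \<noteq> 0 \<and> p < q. x q)))"

definition prism :: "('p::order \<Rightarrow> 'p) \<Rightarrow> real \<times> ('p \<Rightarrow> real) \<Rightarrow> 'p \<Rightarrow> real" where
  "prism f = (\<lambda>(s, x) q. x q - moved s x q + push f (moved s x) q)"

lemma simplexD:
  assumes "x \<in> closed_simplex C" shows "0 \<le> x p" "p \<notin> C \<Longrightarrow> x p = 0" "sum x C = 1"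
  using assms by (auto simp: closed_simplex_def)

lemma order_simplexD:
  assumes "C \<in> order_simplices P r"
  shows "C \<subseteq> P" "finite C" "C \<noteq> {}" "x \<in> C \<Longrightarrow> y \<in> C \<Longrightarrow> r x y \<or> r y x"
  using assms by (auto simp: order_simplices_def)

lemma push_eq: assumes "finite C" "\<And>p. p \<notin> C \<Longrightarrow> m p = 0" shows "push f m q = (\<Sum>p\<in>C. if f p = q then m p else 0)"
proof -
  have "push f m q = (\<Sum>p\<in>{p \<in> C. f p = q}. m p)"
    unfolding push_def by (rule sum.mono_neutral_left) (use assms in auto)
  also have "\<dots> = (\<Sum>p\<in>C. if f p = q then m p else 0)" using assms(1) by (simp add: sum.inter_filter)
  finally show ?thesis .
qed

lemma above_eq: assumes "finite C" "\<And>p. p \<notin> C \<Longrightarrow> x p = 0"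
  shows "(\<Sum>q | x q \<noteq> 0 \<and> p < q. x q) = (\<Sum>q\<in>{q \<in> C. p < q}. x (q::'p::order))"
  by (rule sum.mono_neutral_left) (use assms in auto)

lemma moved_bounds: "0 \<le> x p \<Longrightarrow> 0 \<le> moved s x p" "0 \<le> x p \<Longrightarrow> moved s x p \<le> x p"
  by (auto simp: moved_def)

lemma moved_outside: "x p = 0 \<Longrightarrow> moved s x p = 0"
  by (auto simp: moved_def)

lemma in_closed_simplexI:
  fixes y :: "'p \<Rightarrow> real"
  assumes V: "finite V" "\<And>q. q \<notin> V \<Longrightarrow> y q = 0" "sum y V = 1" and y: "\<And>q. 0 \<le> y q"
    and D: "\<And>q. y q \<noteq> 0 \<Longrightarrow> q \<in> D" "D \<subseteq> V" "D \<subseteq> P" "\<And>p q. p \<in> D \<Longrightarrow> q \<in> D \<Longrightarrow> r p q \<or> r q p"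
  shows "D \<in> order_simplices P r" "y \<in> closed_simplex D"
proof -
  have fD: "finite D" using D(2) V(1) finite_subset by blast
  have s: "sum y D = 1"
    unfolding V(3)[symmetric] by (rule sum.mono_neutral_left) (use V(1) D in auto)
  then have "D \<noteq> {}" by auto
  then show "D \<in> order_simplices P r" using D fD by (simp add: order_simplices_def)
  show "y \<in> closed_simplex D" using y s D(1) by (auto simp: closed_simplex_def)
qed

lemma sum_push:
  assumes "finite C" "\<And>p. p \<notin> C \<Longrightarrow> m p = 0" "finite V" "f ` C \<subseteq> V"
  shows "sum (push f m) V = sum m C"
proof -
  have "sum (push f m) V = (\<Sum>q\<in>V. \<Sum>p\<in>C. if f p = q then m p else 0)"
    by (rule sum.cong) (simp_all add: push_eq[OF assms(1,2)])
  also have "\<dots> = (\<Sum>p\<in>C. \<Sum>q\<in>V. if f p = q then m p else 0)" by (rule sum.swap)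
  also have "\<dots> = sum m C" by (rule sum.cong) (use assms in \<open>auto simp: sum.delta\<close>)
  finally show ?thesis .
qed

lemma push_nonneg: "(\<And>p. 0 \<le> m p) \<Longrightarrow> 0 \<le> push f m q"
  unfolding push_def by (rule sum_nonneg) simp

lemma push_nonzero:
  assumes "push f m q \<noteq> 0" obtains p where "m p \<noteq> 0" "q = f p"
proof -
  have "{p. m p \<noteq> 0 \<and> f p = q} \<noteq> {}" using assms unfolding push_def by (metis sum.empty)
  then show ?thesis using that by blast
qed

text \<open>The prism moves every point \<open>x\<close> to its image under \<open>f\<close>. Since \<open>t\<close> lies below all values of \<open>f\<close>, that image and the
  vertex \<open>t\<close> span a common simplex, and a straight line leads from one to the other.\<close>

theorem contractible_conical_poset:
  fixes P :: "'p::order set"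
  assumes f: "\<And>p. p \<in> P \<Longrightarrow> f p \<in> P" "\<And>p q. p \<in> P \<Longrightarrow> q \<in> P \<Longrightarrow> p \<le> q \<Longrightarrow> f p \<le> f q"
      "\<And>p. p \<in> P \<Longrightarrow> p \<le> f p"
    and t: "t \<in> P" "\<And>p. p \<in> P \<Longrightarrow> t \<le> f p"
  shows "contractible_space (geometric_realization P (\<le>))"
proof -
  let ?X = "geometric_realization P (\<le>)"
  define \<delta> :: "'p \<Rightarrow> real" where "\<delta> q = (if q = t then 1 else 0)" for q
  define cone where "cone = (\<lambda>(s, x) q. (1 - s) * push f x q + s * \<delta> q)"
  have mv: "moved s x p = max 0 (min (x p) (s - (\<Sum>q\<in>{q \<in> C. p < q}. x q)))"
    if "C \<in> order_simplices P (\<le>)" "x \<in> closed_simplex C" for C s x p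
    using above_eq[OF order_simplexD(2)[OF that(1)], of x] simplexD[OF that(2)] by (simp add: moved_def)
  have mv_pos: "(\<Sum>q\<in>{q \<in> C. p < q}. x q) < s"
    if "C \<in> order_simplices P (\<le>)" "x \<in> closed_simplex C" "moved s x p \<noteq> 0" for C s x p
  proof (rule ccontr)
    assume "\<not> (\<Sum>q\<in>{q \<in> C. p < q}. x q) < s"
    then have "min (x p) (s - (\<Sum>q\<in>{q \<in> C. p < q}. x q)) \<le> 0" by (intro min.coboundedI2) simp
    then show False using mv[OF that(1,2), of s p] that(3) by (simp only: max_absorb1)
  qed
  have mv_all: "moved s x p = x p"
    if "C \<in> order_simplices P (\<le>)" "x \<in> closed_simplex C" "x p \<le> s - (\<Sum>q\<in>{q \<in> C. p < q}. x q)" for C s x p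
    unfolding mv[OF that(1,2)] using that(3) simplexD(1)[OF that(2), of p] by (simp only: min_absorb1 max_absorb2)
  have m0: "moved s x p = 0" if "x \<in> closed_simplex C" "p \<notin> C" for C s x p
    by (rule moved_outside) (use simplexD[OF that(1)] that(2) in simp)
  have coord: "continuous_on S (\<lambda>z. snd z q)" for S :: "(real \<times> ('p \<Rightarrow> real)) set" and q
    by (rule continuous_on_product_then_coordinatewise[OF continuous_on_snd[OF continuous_on_id]])
  have prism: "continuous_map (prod_topology (top_of_set {0..1}) ?X) ?X (prism f)"
  proof (rule continuous_map_homotopy_realization)
    fix C :: "'p set" assume C: "C \<in> order_simplices P (\<le>)"
    note CD = order_simplexD[OF C]
    show "finite (C \<union> f ` C)" using CD(2) by simp
    show "\<exists>D\<in>order_simplices P (\<le>). D \<subseteq> C \<union> f ` C \<and> prism f (s, x) \<in> closed_simplex D"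
      if s: "s \<in> {0..1}" and x: "x \<in> closed_simplex C" for s x
    proof -
      note xD = simplexD[OF x]
      let ?m = "moved s x" and ?V = "C \<union> f ` C"
      define D where "D = {p \<in> C. x p \<noteq> ?m p} \<union> f ` {p \<in> C. ?m p \<noteq> 0}"
      have fV: "finite ?V" using CD(2) by simp
      have nz: "q \<in> D" if "prism f (s, x) q \<noteq> 0" for q
      proof -
        have "x q \<noteq> ?m q \<or> push f ?m q \<noteq> 0" using that by (auto simp: prism_def)
        then show ?thesis
        proof
          assume a: "x q \<noteq> ?m q"
          then have "q \<in> C" using xD(2)[of q] m0[OF x, of q] by metis
          then show ?thesis using a by (simp add: D_def)
        next
          assume "push f ?m q \<noteq> 0"
          then obtain p where "?m p \<noteq> 0" "q = f p" by (rule push_nonzero)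
          then show ?thesis using m0[OF x, of p] by (auto simp: D_def)
        qed
      qed
      \<comment> \<open>no mass at \<open>p'\<close> is moved before everything above it, in particular \<open>p\<close>, has been moved\<close>
      have key: "p \<le> p'" if p: "p \<in> C" "x p \<noteq> ?m p" and p': "p' \<in> C" "?m p' \<noteq> 0" for p p'
      proof (rule ccontr)
        assume "\<not> p \<le> p'"
        then have lt: "p' < p" using CD(4)[OF p(1) p'(1)] by auto
        have "insert p {q \<in> C. p < q} \<subseteq> {q \<in> C. p' < q}" using lt p(1) by auto
        then have "sum x (insert p {q \<in> C. p < q}) \<le> sum x {q \<in> C. p' < q}"
          using CD(2) xD(1) by (intro sum_mono2) auto
        then have "x p + (\<Sum>q\<in>{q \<in> C. p < q}. x q) \<le> (\<Sum>q\<in>{q \<in> C. p' < q}. x q)"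
          using CD(2) by simp
        moreover have "(\<Sum>q\<in>{q \<in> C. p' < q}. x q) < s"
          by (rule mv_pos[OF C x p'(2)])
        ultimately have "?m p = x p" by (intro mv_all[OF C x]) linarith
        then show False using p(2) by simp
      qed
      have ch: "p \<le> q \<or> q \<le> p" if "p \<in> D" "q \<in> D" for p q
      proof -
        have *: "p \<le> f p'" if "p \<in> C" "x p \<noteq> ?m p" "p' \<in> C" "?m p' \<noteq> 0" for p p'
          using key[OF that] f(3)[of p'] that(3) CD(1) order_trans by blast
        have **: "f p \<le> f p' \<or> f p' \<le> f p" if "p \<in> C" "p' \<in> C" for p p'
          using CD(4)[OF that] f(2) CD(1) that by blast
        have "(p \<in> C \<and> x p \<noteq> ?m p) \<or> (\<exists>p0\<in>C. ?m p0 \<noteq> 0 \<and> p = f p0)" if "p \<in> D" for p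
          using that unfolding D_def by blast
        from this[OF that(1)] this[OF that(2)] show ?thesis
          by (elim disjE bexE conjE) (use CD(4) * ** in blast)+
      qed
      have sumV: "sum (prism f (s, x)) ?V = 1"
      proof -
        have e: "sum g ?V = sum g C" if "\<And>p. p \<notin> C \<Longrightarrow> g p = 0" for g :: "'p \<Rightarrow> real"
          by (rule sum.mono_neutral_right) (use fV that in auto)
        have "sum (prism f (s, x)) ?V = sum x ?V - sum ?m ?V + sum (push f ?m) ?V"
          by (simp add: prism_def sum.distrib sum_subtractf)
        also have "sum (push f ?m) ?V = sum ?m C"
          by (rule sum_push) (use CD(2) m0[OF x] in auto)
        also have "sum ?m ?V = sum ?m C" by (rule e) (rule m0[OF x])
        also have "sum x ?V = 1" using e[of x] xD by simp
        finally show ?thesis by simp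
      qed
      have DV: "D \<subseteq> ?V" by (auto simp: D_def)
      have DP: "D \<subseteq> P" using CD(1) f(1) by (auto simp: D_def)
      have out: "prism f (s, x) q = 0" if "q \<notin> ?V" for q using nz DV that by blast
      have mpos: "0 \<le> ?m p" for p by (rule moved_bounds(1)) (rule xD(1))
      have pos: "0 \<le> prism f (s, x) q" for q
        using moved_bounds(2)[of x q s] xD(1)[of q] push_nonneg[of ?m f q, OF mpos] by (simp add: prism_def)
      have "D \<in> order_simplices P (\<le>)"
        by (rule in_closed_simplexI(1)[where V="?V" and y="prism f (s, x)"]) (fact fV out sumV pos nz DV DP ch)+
      moreover have "prism f (s, x) \<in> closed_simplex D"
        by (rule in_closed_simplexI(2)[where V="?V" and P=P and r="(\<le>)"]) (fact fV out sumV pos nz DV DP ch)+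
      ultimately show ?thesis using DV by blast
    qed
    show "continuous_on ({0..1} \<times> closed_simplex C) (\<lambda>z. prism f z v)" for v
    proof -
      let ?mm = "\<lambda>z p. max 0 (min (snd z p) (fst z - (\<Sum>q\<in>{q \<in> C. p < q}. snd z q)))"
      have "continuous_on ({0..1} \<times> closed_simplex C) (\<lambda>z. snd z v - ?mm z v + (\<Sum>p\<in>C. if f p = v then ?mm z p else 0))"
      proof -
        have m: "continuous_on ({0..1} \<times> closed_simplex C) (\<lambda>z. ?mm z p)" for p
          by (intro continuous_on_max continuous_on_min continuous_on_const continuous_on_diff continuous_on_sum continuous_on_fst continuous_on_id coord)
        have "continuous_on ({0..1} \<times> closed_simplex C) (\<lambda>z. if f p = v then ?mm z p else 0)" for p
          using m[of p] by (cases "f p = v") simp_all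
        then show ?thesis by (intro continuous_on_add continuous_on_diff continuous_on_sum coord m)
      qed
      moreover have "prism f z v = snd z v - ?mm z v + (\<Sum>p\<in>C. if f p = v then ?mm z p else 0)"
        if z: "z \<in> {0..1} \<times> closed_simplex C" for z
      proof -
        obtain s x where sx: "z = (s, x)" "x \<in> closed_simplex C" using z by auto
        have "push f (moved s x) v = (\<Sum>p\<in>C. if f p = v then moved s x p else 0)"
          by (rule push_eq[OF CD(2)]) (rule m0[OF sx(2)])
        then show ?thesis
          unfolding sx(1) prism_def prod.case by (simp only: mv[OF C sx(2)] fst_conv snd_conv)
      qed
      ultimately show ?thesis by (simp cong: continuous_on_cong)
    qed
  qed
  have cone: "continuous_map (prod_topology (top_of_set {0..1}) ?X) ?X cone"
  proof (rule continuous_map_homotopy_realization)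
    fix C :: "'p set" assume C: "C \<in> order_simplices P (\<le>)"
    note CD = order_simplexD[OF C]
    let ?V = "insert t (f ` C)"
    show "finite ?V" using CD(2) by simp
    show "\<exists>D\<in>order_simplices P (\<le>). D \<subseteq> ?V \<and> cone (s, x) \<in> closed_simplex D"
      if s: "s \<in> {0..1}" and x: "x \<in> closed_simplex C" for s x
    proof -
      note xD = simplexD[OF x]
      have fV: "finite ?V" using CD(2) by simp
      have out: "cone (s, x) q = 0" if "q \<notin> ?V" for q
      proof -
        have "push f x q = 0" using that push_nonzero[of f x q] xD(2) by blast
        then show ?thesis using that by (simp add: cone_def \<delta>_def)
      qed
      have "sum \<delta> ?V = 1" using fV unfolding \<delta>_def by (subst sum.delta) auto
      moreover have "sum (push f x) ?V = 1"
        unfolding xD(3)[symmetric] by (rule sum_push[OF CD(2) _ fV]) (use xD(2) in auto)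
      ultimately have sumV: "sum (cone (s, x)) ?V = 1"
        by (simp only: cone_def prod.case sum.distrib sum_distrib_left[symmetric]) simp
      have pos: "0 \<le> cone (s, x) q" for q
        using s push_nonneg[of x f q, OF xD(1)] by (simp add: cone_def \<delta>_def)
      have nz: "q \<in> ?V" if "cone (s, x) q \<noteq> 0" for q using out that by blast
      have VP: "?V \<subseteq> P" using CD(1) f(1) t(1) by auto
      have ch: "p \<le> q \<or> q \<le> p" if "p \<in> ?V" "q \<in> ?V" for p q
      proof -
        have **: "f p \<le> f p' \<or> f p' \<le> f p" if "p \<in> C" "p' \<in> C" for p p'
          using CD(4)[OF that] f(2) CD(1) that by blast
        have "t \<le> f p" if "p \<in> C" for p using t(2) CD(1) that by blast
        then show ?thesis using that ** by blast
      qed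
      have "?V \<in> order_simplices P (\<le>)"
        by (rule in_closed_simplexI(1)[where V="?V" and y="cone (s, x)"]) (fact fV out sumV pos nz subset_refl VP ch)+
      moreover have "cone (s, x) \<in> closed_simplex ?V"
        by (rule in_closed_simplexI(2)[where V="?V" and P=P and r="(\<le>)"]) (fact fV out sumV pos nz subset_refl VP ch)+
      ultimately show ?thesis by blast
    qed
    show "continuous_on ({0..1} \<times> closed_simplex C) (\<lambda>z. cone z v)" for v
    proof -
      have "continuous_on ({0..1} \<times> closed_simplex C) (\<lambda>z. (1 - fst z) * (\<Sum>p\<in>C. if f p = v then snd z p else 0) + fst z * \<delta> v)"
      proof -
        have "continuous_on ({0..1::real} \<times> closed_simplex C) (\<lambda>z. if f p = v then snd z p else 0)" for p
          using coord[of "{0..1} \<times> closed_simplex C" p] by (cases "f p = v") simp_all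
        then show ?thesis by (intro continuous_on_add continuous_on_mult continuous_on_const continuous_on_diff continuous_on_sum continuous_on_fst continuous_on_id)
      qed
      moreover have "cone z v = (1 - fst z) * (\<Sum>p\<in>C. if f p = v then snd z p else 0) + fst z * \<delta> v"
        if z: "z \<in> {0..1} \<times> closed_simplex C" for z
      proof -
        obtain s x where sx: "z = (s, x)" "x \<in> closed_simplex C" using z by auto
        have "push f x v = (\<Sum>p\<in>C. if f p = v then x p else 0)"
          by (rule push_eq[OF CD(2)]) (rule simplexD(2)[OF sx(2)])
        then show ?thesis
          unfolding sx(1) by (simp only: cone_def prod.case fst_conv snd_conv)
      qed
      ultimately show ?thesis by (simp cong: continuous_on_cong)
    qed
  qed
  have ends: "prism f (0, x) = x" "prism f (1, x) = push f x" if xX: "x \<in> topspace ?X" for x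
  proof -
    obtain C where C: "C \<in> order_simplices P (\<le>)" "x \<in> closed_simplex C"
      using xX by (auto simp: topspace_geometric_realization)
    note CD = order_simplexD[OF C(1)] and xD = simplexD[OF C(2)]
    have a0: "0 \<le> (\<Sum>q\<in>{q \<in> C. p < q}. x q)" for p by (rule sum_nonneg) (rule xD(1))
    have "moved 0 x p = 0" for p using mv_pos[OF C, of 0 p] a0[of p] by linarith
    then show "prism f (0, x) = x" by (auto simp: prism_def push_def)
    have "moved 1 x p = x p" for p
    proof (cases "p \<in> C")
      case True
      have "sum x (insert p {q \<in> C. p < q}) \<le> sum x C"
        using CD(2) xD(1) True by (intro sum_mono2) auto
      then have "x p + (\<Sum>q\<in>{q \<in> C. p < q}. x q) \<le> 1" using CD(2) xD(3) by simp
      then show ?thesis by (intro mv_all[OF C]) linarith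
    next
      case False then show ?thesis using xD(2) m0[OF C(2)] by simp
    qed
    then have "moved 1 x = x" by blast
    then show "prism f (1, x) = push f x" by (auto simp: prism_def)
  qed
  have "homotopic_with (\<lambda>_. True) ?X ?X id (push f)"
    by (subst homotopic_with) (use prism ends in auto)
  moreover have "homotopic_with (\<lambda>_. True) ?X ?X (push f) (\<lambda>_. \<delta>)"
    by (subst homotopic_with) (use cone in \<open>auto intro!: exI[of _ cone] simp: cone_def\<close>)
  ultimately have "homotopic_with (\<lambda>_. True) ?X ?X id (\<lambda>_. \<delta>)" by (rule homotopic_with_trans)
  then show ?thesis unfolding contractible_space_def by blast
qed

theorem proposition3p5:
  fixes \<Gamma> :: "('a, 'b) monoid_scheme" and H :: "'a set"
  assumes "group \<Gamma>"
    and "virtually_torsion_free_solvable \<Gamma>"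
    and "H \<in> finite_subgroups \<Gamma>"
    and "\<exists>T\<in>finite_subgroups \<Gamma>. H \<subset> T \<and> finite_index \<Gamma> (centralizer \<Gamma> H) (centralizer \<Gamma> T)"
  shows "contractible_space (geometric_realization (finite_subgroups_above \<Gamma> H) (\<subseteq>))"
proof -
  interpret \<Gamma>: group \<Gamma> by (rule assms(1))
  obtain T where T: "subgroup T \<Gamma>" "finite T" "H \<subset> T"
    and idx: "finite_index \<Gamma> (centralizer \<Gamma> H) (centralizer \<Gamma> T)"
    using assms(4) by (auto simp: finite_subgroups_def)
  have H: "subgroup H \<Gamma>" "finite H" using assms(3) by (auto simp: finite_subgroups_def)
  let ?P = "finite_subgroups_above \<Gamma> H" and ?f = "\<lambda>K. generate \<Gamma> (K \<union> T)"
  have P: "K \<in> ?P \<longleftrightarrow> subgroup K \<Gamma> \<and> finite K \<and> H \<subset> K" for K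
    by (auto simp: finite_subgroups_above_def finite_subgroups_def)
  have incl: "K \<union> T \<subseteq> ?f K" for K by (auto intro: generate.incl)
  show ?thesis
  proof (rule contractible_conical_poset[where f="?f" and t=T])
    fix K assume "K \<in> ?P"
    then have K: "subgroup K \<Gamma>" "finite K" "H \<subset> K" by (auto simp: P)
    have "K \<union> T \<subseteq> carrier \<Gamma>" using K(1) T(1) by (simp add: subgroup.subset)
    then have "subgroup (?f K) \<Gamma>" by (rule \<Gamma>.generate_is_subgroup)
    moreover have "finite (?f K)"
      by (rule \<Gamma>.finite_join[OF assms(2) H K(1,2) T(1,2) _ _ idx]) (use K T in auto)
    moreover have "H \<subset> ?f K" using K(3) incl[of K] by blast
    ultimately show "?f K \<in> ?P" by (simp add: P)
    show "K \<subseteq> ?f K" "T \<subseteq> ?f K" using incl[of K] by auto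
  next
    fix K K' :: "'a set" assume "K \<subseteq> K'"
    then show "?f K \<subseteq> ?f K'" by (intro \<Gamma>.mono_generate) auto
  next
    show "T \<in> ?P" using T by (simp add: P)
  qed
qed

end
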